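(* Let $n\ge 1$, $\hbar>0$ and $p\in\mathbb{C}^n$, and let $\mathcal{A}_{p,\hbar}$ be the quotient space defined in the context, with the locally convex topology determined by the seminorms $\|\cdot\|^{p,\hbar}_{m,\ell,R,S}$. (i) $\mathcal{A}_{p,\hbar}$ is a Hausdorff locally convex topological vector space. (ii) Every class $[f]\in\mathcal{A}_{p,\hbar}$ has a unique real-analytic representative $f\in C^\omega(\mathbb{C}^n)$. (Hence $\mathcal{A}_{p,\hbar}$ is identified with the corresponding subspace of $C^\omega(\mathbb{C}^n)$; this identification is used in (iii) and (iv).) (iii) Every $f\in\mathcal{A}_{p,\hbar}$ has a unique extension to a function $\hat f$ on $\mathbb{C}^n\times\mathbb{C}^n$ which is holomorphic in the first and anti-holomorphic in the second argument, such that $f=\Delta^*\hat f$, where $\Delta:\mathbb{C}^n\to\mathbb{C}^n\times\mathbb{C}^n$, $\Delta(z)=(z,z)$, is the diagonal. (iv) Any $f\in C^\omega(\mathbb{C}^n)$ for which there exist constants $a,b,c>0$ with $$\left|\frac{\partial^{|R|+|S|}f}{\partial\overline{z}^R\partial z^S}(p)\right|\le c\,a^{|R|}b^{|S|}\quad\text{for all } R,S\in\mathbb{N}^n$$ belongs to $\mathcal{A}_{p,\hbar}$. In particular $\mathbb{C}[z,\overline{z}]\subseteq\mathcal{A}_{p,\hbar}$.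
   Context: Conventions: $\mathbb{N}=\{0,1,2,\dots\}$; $z=(z^1,\dots,z^n)$ are the standard holomorphic coordinates on $\mathbb{C}^n$; for multiindices $R,S\in\mathbb{N}^n$, $|R|,R!,z^R$, binomial coefficients $\binom{R}{I}$ and $R\le S$ are understood componentwise in the usual way; $\sum_{N=0}^\infty$ means summation over $N\in\mathbb{N}^n$ and $\sum_{I=0}^R$ means summation over $I\in\mathbb{N}^n$ with $I\le R$. $C^\infty(\mathbb{C}^n)$ and $C^\omega(\mathbb{C}^n)$ are the complex-valued smooth, respectively real-analytic, functions on $\mathbb{C}^n\cong\mathbb{R}^{2n}$. For $f\in C^\infty(\mathbb{C}^n)$, $m\in\mathbb{N}$, $\ell\in\{0,\dots,2^m-1\}$, $R,S\in\mathbb{N}^n$ define recursively, with values in $[0,+\infty]$, $$h^{p,\hbar}_{0,0,R,S}(f)=\sum_{N=0}^\infty\frac{(2\hbar)^{|R|+|S|+|N|}}{N!}\left|\frac{\partial^{|R|+|S|+|N|}f}{\partial z^R\partial\overline{z}^{N+S}}(p)\right|^2,$$ and for $m\ge1$ $$h^{p,\hbar}_{m,\ell,R,S}(f)=\sum_{N=0}^\infty\frac1{N!}\Big(\sum_{I=0}^R\sum_{J=0}^{N+S}\tbinom{R}{I}\tbinom{N+S}{J}h^{p,\hbar}_{m-1,\ell/2,I,J}(f)\Big)^2\quad(\ell\text{ even}),$$ $$h^{p,\hbar}_{m,\ell,R,S}(f)=\sum_{N=0}^\infty\frac1{N!}\Big(\sum_{I=0}^R\sum_{J=0}^{N+S}\tbinom{R}{I}\tbinom{N+S}{J}h^{p,\hbar}_{m-1,(\ell-1)/2,J,I}(f)\Big)^2\quad(\ell\text{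 odd}).$$ Put $\|f\|^{p,\hbar}_{m,\ell,R,S}=\big(h^{p,\hbar}_{m,\ell,R,S}(f)\big)^{1/2^{m+1}}\in[0,+\infty]$ and $\widetilde{\mathcal{A}}_{p,\hbar}=\{f\in C^\infty(\mathbb{C}^n)\mid \|f\|^{p,\hbar}_{m,\ell,R,S}<\infty\text{ for all }m,\ell,R,S\}$, a vector space on which the $\|\cdot\|^{p,\hbar}_{m,\ell,R,S}$ are seminorms. Define $$\mathcal{A}_{p,\hbar}=\widetilde{\mathcal{A}}_{p,\hbar}\big/\{f\in C^\infty(\mathbb{C}^n)\mid \text{all partial derivatives of } f \text{ of all orders}\ge 0\text{ vanish at }p\},$$ with the topology induced by the seminorms (which depend only on the Taylor coefficients at $p$ and hence descend to the quotient). *)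

theory Defs
  imports "HOL-Analysis.Analysis" "HOL-Algebra.Module"
begin

section \<open>Multiindices\<close>

text \<open>The order on \<^typ>\<open>nat ^ 'n\<close> provided by the library is the componentwise one.\<close>

type_synonym 'n mindex = "nat ^ 'n"

definition mabs :: "'n::finite mindex \<Rightarrow> nat"
  where "mabs R = (\<Sum>j\<in>UNIV. R $ j)"

definition mfact :: "'n::finite mindex \<Rightarrow> nat"
  where "mfact R = (\<Prod>j\<in>UNIV. fact (R $ j))"

definition mbinom :: "'n::finite mindex \<Rightarrow> 'n mindex \<Rightarrow> nat"
  where "mbinom R I = (\<Prod>j\<in>UNIV. (R $ j) choose (I $ j))"

definition mpow :: "'a::comm_monoid_mult ^ 'n::finite \<Rightarrow> 'n mindex \<Rightarrow> 'a"
  where "mpow z R = (\<Prod>j\<in>UNIV. (z $ j) ^ (R $ j))"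


section \<open>Smooth, real-analytic and holomorphic functions\<close>

text \<open>The elements of \<open>Basis :: (complex ^ 'n) set\<close> are \<open>axis j 1\<close> and \<open>axis j \<i>\<close>, so
  \<open>pdiff (axis j 1)\<close> and \<open>pdiff (axis j \<i>)\<close> are the partial derivatives with respect to the
  real coordinates \<open>x\<^sup>j = Re z\<^sup>j\<close> and \<open>y\<^sup>j = Im z\<^sup>j\<close>.\<close>

definition pdiff :: "complex ^ 'n \<Rightarrow> (complex ^ 'n \<Rightarrow> complex) \<Rightarrow> complex ^ 'n::finite \<Rightarrow> complex"
  where "pdiff b f z = frechet_derivative f (at z) b"

text \<open>All iterated real partial derivatives (the empty list giving \<open>f\<close> itself) exist and are
  differentiable in the real sense.\<close>

definition smooth :: "(complex ^ 'n::finite \<Rightarrow> complex) \<Rightarrow> bool"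
  where "smooth f \<longleftrightarrow> (\<forall>bs\<in>lists Basis. \<forall>z. foldr pdiff bs f differentiable at z)"

definition real_analytic :: "(complex ^ 'n::finite \<Rightarrow> complex) \<Rightarrow> bool"
  where "real_analytic f \<longleftrightarrow>
    (\<forall>q. \<exists>(a :: 'n mindex \<Rightarrow> 'n mindex \<Rightarrow> complex) e. 0 < e \<and>
      (\<forall>z\<in>ball q e.
        ((\<lambda>(K, L). a K L * of_real (mpow (\<chi> j. Re (z $ j - q $ j)) K)
                         * of_real (mpow (\<chi> j. Im (z $ j - q $ j)) L)) has_sum f z) UNIV))"

definition holomorphic_Cn :: "(complex ^ 'n::finite \<Rightarrow> complex) \<Rightarrow> bool"
  where "holomorphic_Cn f \<longleftrightarrow>
    (\<forall>z. \<exists>D. (f has_derivative D) (at z) \<and> (\<forall>c v. D (c *s v) = c * D v))"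

definition antiholomorphic_Cn :: "(complex ^ 'n::finite \<Rightarrow> complex) \<Rightarrow> bool"
  where "antiholomorphic_Cn f \<longleftrightarrow> holomorphic_Cn (\<lambda>z. cnj (f z))"

definition polynomial_functions :: "(complex ^ 'n::finite \<Rightarrow> complex) set"
  where "polynomial_functions =
    {f. \<exists>(F :: ('n mindex \<times> 'n mindex) set) c. finite F \<and>
        (\<forall>z. f z = (\<Sum>(K, L)\<in>F. c K L * mpow z K * mpow (\<chi> j. cnj (z $ j)) L))}"


section \<open>Wirtinger derivatives\<close>

definition wirt :: "'n \<Rightarrow> (complex ^ 'n::finite \<Rightarrow> complex) \<Rightarrow> complex ^ 'n \<Rightarrow> complex"
  where "wirt j f z = (pdiff (axis j 1) f z - \<i> * pdiff (axis j \<i>) f z) / 2"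

definition wirt_bar :: "'n \<Rightarrow> (complex ^ 'n::finite \<Rightarrow> complex) \<Rightarrow> complex ^ 'n \<Rightarrow> complex"
  where "wirt_bar j f z = (pdiff (axis j 1) f z + \<i> * pdiff (axis j \<i>) f z) / 2"

text \<open>The choice of an enumeration of the index type is only needed to write down an iterated
  derivative; the order is irrelevant for smooth functions.\<close>

definition iter_deriv ::
  "('n \<Rightarrow> (complex ^ 'n::finite \<Rightarrow> complex) \<Rightarrow> complex ^ 'n \<Rightarrow> complex) \<Rightarrow> 'n mindex \<Rightarrow>
    (complex ^ 'n \<Rightarrow> complex) \<Rightarrow> complex ^ 'n \<Rightarrow> complex"
  where "iter_deriv D R f =
    foldr (\<lambda>j. D j ^^ (R $ j)) (SOME js. distinct js \<and> set js = UNIV) f"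

text \<open>\<open>wirtinger R S f\<close> is the derivative of order \<open>R\<close> in \<open>z\<close> and of order \<open>S\<close> in the conjugate
  variables.\<close>

definition wirtinger ::
  "'n mindex \<Rightarrow> 'n mindex \<Rightarrow> (complex ^ 'n::finite \<Rightarrow> complex) \<Rightarrow> complex ^ 'n \<Rightarrow> complex"
  where "wirtinger R S f = iter_deriv wirt R (iter_deriv wirt_bar S f)"


section \<open>The seminorms\<close>

text \<open>The index \<open>l\<close> is meant to range over \<open>{0..<2 ^ m}\<close>; for odd \<open>l\<close>, \<open>l div 2 = (l - 1) / 2\<close>.
  The value type \<^typ>\<open>ennreal\<close> is \<open>[0, \<infinity>]\<close>.\<close>

primrec hfun :: "complex ^ 'n::finite \<Rightarrow> real \<Rightarrow> (complex ^ 'n \<Rightarrow> complex) \<Rightarrow>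
    nat \<Rightarrow> nat \<Rightarrow> 'n mindex \<Rightarrow> 'n mindex \<Rightarrow> ennreal"
  where
    "hfun p hb f 0 = (\<lambda>l R S. \<Sum>\<^sub>\<infinity>N.
       ennreal ((2 * hb) ^ (mabs R + mabs S + mabs N) / real (mfact N)
                * (cmod (wirtinger R (N + S) f p))\<^sup>2))"
  | "hfun p hb f (Suc m) = (\<lambda>l R S. \<Sum>\<^sub>\<infinity>N.
       (\<Sum>I\<in>{..R}. \<Sum>J\<in>{..N + S}. of_nat (mbinom R I) * of_nat (mbinom (N + S) J) *
          (if even l then hfun p hb f m (l div 2) I J else hfun p hb f m (l div 2) J I))\<^sup>2
       / of_nat (mfact N))"

definition hnorm :: "complex ^ 'n::finite \<Rightarrow> real \<Rightarrow>
    nat \<Rightarrow> nat \<Rightarrow> 'n mindex \<Rightarrow> 'n mindex \<Rightarrow> (complex ^ 'n \<Rightarrow> complex) \<Rightarrow> ennreal"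
  where "hnorm p hb m l R S f =
    (if hfun p hb f m l R S = \<infinity> then \<infinity>
     else ennreal (enn2real (hfun p hb f m l R S) powr (1 / 2 ^ (m + 1))))"

definition A_tilde :: "complex ^ 'n::finite \<Rightarrow> real \<Rightarrow> (complex ^ 'n \<Rightarrow> complex) set"
  where "A_tilde p hb =
    {f. smooth f \<and> (\<forall>m. \<forall>l<2 ^ m. \<forall>R S. hnorm p hb m l R S f < \<infinity>)}"


section \<open>The quotient space\<close>

definition flat_at :: "complex ^ 'n::finite \<Rightarrow> (complex ^ 'n \<Rightarrow> complex) set"
  where "flat_at p = {f. smooth f \<and> (\<forall>bs\<in>lists Basis. foldr pdiff bs f p = 0)}"

definition taylor_rel ::
  "complex ^ 'n::finite \<Rightarrow> real \<Rightarrow> ((complex ^ 'n \<Rightarrow> complex) \<times> (complex ^ 'n \<Rightarrow> complex)) set"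
  where "taylor_rel p hb =
    {(f, g). f \<in> A_tilde p hb \<and> g \<in> A_tilde p hb \<and> (\<lambda>z. f z - g z) \<in> flat_at p}"

text \<open>The record type for modules also has slots for a ring multiplication and a unit of the
  module; they play no role for a vector space and are left unspecified.\<close>

definition A_space ::
  "complex ^ 'n::finite \<Rightarrow> real \<Rightarrow> (complex, (complex ^ 'n \<Rightarrow> complex) set) module"
  where "A_space p hb =
    \<lparr>carrier = A_tilde p hb // taylor_rel p hb,
     monoid.mult = undefined,
     one = undefined,
     zero = taylor_rel p hb `` {\<lambda>z. 0},
     add = (\<lambda>X Y. \<Union>f\<in>X. \<Union>g\<in>Y. taylor_rel p hb `` {\<lambda>z. f z + g z}),
     smult = (\<lambda>c X. \<Union>f\<in>X. taylor_rel p hb `` {\<lambda>z. c * f z})\<rparr>"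

text \<open>The seminorms are finite and constant on each class, so that \<^const>\<open>the_elem\<close> is applied
  to a singleton.\<close>

definition A_seminorm :: "complex ^ 'n::finite \<Rightarrow> real \<Rightarrow>
    nat \<Rightarrow> nat \<Rightarrow> 'n mindex \<Rightarrow> 'n mindex \<Rightarrow> (complex ^ 'n \<Rightarrow> complex) set \<Rightarrow> real"
  where "A_seminorm p hb m l R S X = the_elem ((\<lambda>f. enn2real (hnorm p hb m l R S f)) ` X)"

definition seminorm_topology :: "(complex, 'b) module \<Rightarrow> ('b \<Rightarrow> real) set \<Rightarrow> 'b topology"
  where "seminorm_topology V Q =
    topology_generated_by
      {{y \<in> carrier V. q (y \<ominus>\<^bsub>V\<^esub> x) < e} | q x e. q \<in> Q \<and> x \<in> carrier V \<and> 0 < e}"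

definition A_topology ::
  "complex ^ 'n::finite \<Rightarrow> real \<Rightarrow> (complex ^ 'n \<Rightarrow> complex) set topology"
  where "A_topology p hb =
    seminorm_topology (A_space p hb) {A_seminorm p hb m l R S | m l R S. l < 2 ^ m}"

text \<open>The subspace of the real-analytic functions with which the quotient is identified by
  passing to the real-analytic representative.\<close>

definition A_analytic :: "complex ^ 'n::finite \<Rightarrow> real \<Rightarrow> (complex ^ 'n \<Rightarrow> complex) set"
  where "A_analytic p hb = {f. real_analytic f \<and> (\<exists>X\<in>carrier (A_space p hb). f \<in> X)}"


section \<open>Locally convex topological vector spaces\<close>

definition complex_ring :: "complex ring"
  where "complex_ring =
    \<lparr>carrier = UNIV, monoid.mult = (*), one = 1, zero = 0, add = (+)\<rparr>"

definition topological_vector_space :: "(complex, 'b) module \<Rightarrow> 'b topology \<Rightarrow> bool"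
  where "topological_vector_space V T \<longleftrightarrow>
    Module.module complex_ring V \<and> topspace T = carrier V \<and>
    continuous_map (prod_topology T T) T (\<lambda>(x, y). x \<oplus>\<^bsub>V\<^esub> y) \<and>
    continuous_map (prod_topology euclidean T) T (\<lambda>(c, x). c \<odot>\<^bsub>V\<^esub> x)"

definition convex_in :: "(complex, 'b) module \<Rightarrow> 'b set \<Rightarrow> bool"
  where "convex_in V C \<longleftrightarrow> C \<subseteq> carrier V \<and>
    (\<forall>x\<in>C. \<forall>y\<in>C. \<forall>t\<in>{0..1::real}.
      (complex_of_real (1 - t) \<odot>\<^bsub>V\<^esub> x) \<oplus>\<^bsub>V\<^esub> (complex_of_real t \<odot>\<^bsub>V\<^esub> y) \<in> C)"

definition locally_convex_tvs :: "(complex, 'b) module \<Rightarrow> 'b topology \<Rightarrow> bool"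
  where "locally_convex_tvs V T \<longleftrightarrow>
    topological_vector_space V T \<and>
    (\<forall>U. openin T U \<and> \<zero>\<^bsub>V\<^esub> \<in> U \<longrightarrow>
      (\<exists>C. openin T C \<and> \<zero>\<^bsub>V\<^esub> \<in> C \<and> C \<subseteq> U \<and> convex_in V C))"

end

(*
  The seminorm with m = 0 only gives decay of the Taylor coefficients in the antiholomorphic
  direction; the one with m = l = 1 sums the squares of the former ones over the holomorphic
  direction as well.  Together they give
    |d^R dbar^S f (p)|^2 <= C (2 hbar)^(-|R|-|S|) R! S!,
  so the Taylor series at p converges on all of C^n x C^n when z and cnj z are treated as
  independent variables.  Its restriction to the diagonal is the real-analytic representative,
  unique by the identity theorem, and the series itself is the extension.
  For uniqueness of the extension let D be the difference of two of them, restricted to a complex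
  line.  D is only separately (anti)holomorphic, but bounded on some polydisc around a diagonal
  point by Baire's theorem; there D(s, s) = 0 forces all derivatives of D in its first variable to
  vanish on the diagonal.
  Each h_m is convex and homogeneous of degree 2^(m+1) in f, whence its root is a seminorm.  A
  bound c a^|R| b^|S| on the derivatives is inherited, with other constants, by h_0, h_1, ...
  through the binomial theorem.
*)
theory Submission
  imports Defs "HOL-Complex_Analysis.Conformal_Mappings"
begin

section \<open>Topologies generated by seminorms\<close>

text \<open>A class is determined by its jet of Wirtinger derivatives at \<open>p\<close>: the
  seminorms see nothing else of a function, and flatness at \<open>p\<close> is the vanishing of
  this jet. A squared derivative of size \<open>R! S!\<close> gives, after division by
  \<open>R! S!\<close>, a Taylor coefficient of size \<open>1 / sqrt (R! S!)\<close> up to a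
  geometric factor; hence convergence everywhere, whatever the value of \<open>hb\<close>. The
  obstacle on the analytic side is that \<open>real_analytic\<close> asks for expansions in real
  coordinates about every point, whereas the series at hand is centred at \<open>p\<close> and runs
  in \<open>z\<close> and its conjugate. Both are therefore written as one kind of power series in
  2n complex variables, indexed by a sum type; recentring and a linear substitution carry one into
  the other. On the topological side, the recursion for \<open>hfun\<close> alternates sums and
  squares and is not a familiar norm. Convexity is used because it survives each of these
  operations, also for the value infinity.\<close>

lemma complex_ring_simps [simp]:
  "carrier complex_ring = UNIV" "x \<otimes>\<^bsub>complex_ring\<^esub> y = x * y" "\<one>\<^bsub>complex_ring\<^esub> = 1"
  "\<zero>\<^bsub>complex_ring\<^esub> = 0" "x \<oplus>\<^bsub>complex_ring\<^esub> y = x + y"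
  by (simp_all add: complex_ring_def)

lemma cring_complex_ring: "cring complex_ring"
proof (rule cringI)
  show "abelian_group complex_ring"
    by (rule abelian_groupI) (auto intro: exI[of _ "- x" for x] simp: algebra_simps)
  show "Group.comm_monoid complex_ring"
    by (rule comm_monoidI) (auto simp: algebra_simps)
qed (auto simp: algebra_simps)

lemma complex_ring_minus [simp]: "\<ominus>\<^bsub>complex_ring\<^esub> x = - x"
proof -
  interpret R: cring complex_ring by (rule cring_complex_ring)
  have "- x \<oplus>\<^bsub>complex_ring\<^esub> x = \<zero>\<^bsub>complex_ring\<^esub>" by simp
  then show ?thesis using R.minus_equality[of "- x" x] by simp
qed

text \<open>Nonemptiness of \<open>Q\<close> makes the balls cover the carrier; the empty family
  would generate the topology of the empty space. Nonnegativity and the value at zero follow from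
  the two inequalities assumed.\<close>

locale seminormed_module = Module.module complex_ring V for V :: "(complex, 'b) module" (structure) +
  fixes Q :: "('b \<Rightarrow> real) set"
  assumes Q_nonempty: "Q \<noteq> {}"
    and seminorm_add: "q \<in> Q \<Longrightarrow> x \<in> carrier V \<Longrightarrow> y \<in> carrier V \<Longrightarrow> q (x \<oplus> y) \<le> q x + q y"
    and seminorm_smult: "q \<in> Q \<Longrightarrow> x \<in> carrier V \<Longrightarrow> q (c \<odot> x) = cmod c * q x"
begin

lemma smult_in [simp]: "x \<in> carrier V \<Longrightarrow> c \<odot> x \<in> carrier V"
  by (rule smult_closed) auto

lemma seminorm_zero: "q \<in> Q \<Longrightarrow> q \<zero> = 0"
  using seminorm_smult[of q "\<zero>" 0] smult_l_null[of "\<zero>"] by simp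

lemma seminorm_uminus: "q \<in> Q \<Longrightarrow> x \<in> carrier V \<Longrightarrow> q (\<ominus> x) = q x"
  using seminorm_smult[of q x "-1"] smult_l_minus[of 1 x] smult_one[of x] by simp

lemma seminorm_nonneg: "q \<in> Q \<Longrightarrow> x \<in> carrier V \<Longrightarrow> 0 \<le> q x"
  using seminorm_add[of q x "\<ominus> x"] seminorm_zero[of q] seminorm_uminus[of q x]
  by (simp add: M.r_neg)

lemma seminorm_diff_triangle:
  assumes "q \<in> Q" "x \<in> carrier V" "y \<in> carrier V" "z \<in> carrier V"
  shows "q (x \<ominus> z) \<le> q (x \<ominus> y) + q (y \<ominus> z)"
proof -
  have "x \<ominus> z = (x \<ominus> y) \<oplus> (y \<ominus> z)"
  proof -
    have "(x \<ominus> y) \<oplus> (y \<ominus> z) = x \<oplus> ((\<ominus> y \<oplus> y) \<oplus> \<ominus> z)"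
      using assms by (simp add: a_minus_def M.a_assoc)
    then show ?thesis using assms by (simp add: M.l_neg a_minus_def)
  qed
  then show ?thesis using seminorm_add[of q "x \<ominus> y" "y \<ominus> z"] assms by simp
qed

lemma seminorm_diff_commute:
  assumes "q \<in> Q" "x \<in> carrier V" "y \<in> carrier V"
  shows "q (x \<ominus> y) = q (y \<ominus> x)"
proof -
  have "\<ominus> (x \<ominus> y) = y \<ominus> x"
    using assms by (simp add: a_minus_def M.minus_add M.a_comm)
  then show ?thesis using seminorm_uminus[of q "x \<ominus> y"] assms by simp
qed

section \<open>The topology and the continuity of the vector space operations\<close>

abbreviation "T \<equiv> seminorm_topology V Q"

definition sball :: "('b \<Rightarrow> real) \<Rightarrow> 'b \<Rightarrow> real \<Rightarrow> 'b set"
  where "sball q x e = {y \<in> carrier V. q (y \<ominus> x) < e}"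

lemma T_eq: "T = topology_generated_by {sball q x e | q x e. q \<in> Q \<and> x \<in> carrier V \<and> 0 < e}"
  by (simp add: seminorm_topology_def sball_def)

lemma sball_self: "q \<in> Q \<Longrightarrow> x \<in> carrier V \<Longrightarrow> 0 < e \<Longrightarrow> x \<in> sball q x e"
  using seminorm_zero[of q] by (simp add: sball_def M.r_neg a_minus_def)

lemma topspace_T: "topspace T = carrier V"
proof -
  obtain q where q: "q \<in> Q" using Q_nonempty by blast
  have "x \<in> \<Union> {sball q x e | q x e. q \<in> Q \<and> x \<in> carrier V \<and> 0 < e}" if "x \<in> carrier V" for x
    using sball_self[OF q that, of 1] that q zero_less_one by blast
  moreover have "sball q x e \<subseteq> carrier V" for q x e by (auto simp: sball_def)
  ultimately show ?thesis unfolding T_eq topology_generated_by_topspace by blast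
qed

lemma openin_sball: "q \<in> Q \<Longrightarrow> x \<in> carrier V \<Longrightarrow> 0 < e \<Longrightarrow> openin T (sball q x e)"
  unfolding T_eq by (rule topology_generated_by_Basis) blast

text \<open>Continuity can be tested on the subbasis of balls. The hypothesis is local, so that an
  explicit product neighbourhood can be supplied for each operation.\<close>

lemma continuous_map_into_T:
  assumes "\<And>a. a \<in> topspace X \<Longrightarrow> f a \<in> carrier V"
    and "\<And>q x e a. q \<in> Q \<Longrightarrow> x \<in> carrier V \<Longrightarrow> 0 < e \<Longrightarrow> a \<in> topspace X \<Longrightarrow> q (f a \<ominus> x) < e \<Longrightarrow>
       \<exists>U. openin X U \<and> a \<in> U \<and> (\<forall>b\<in>U. q (f b \<ominus> x) < e)"
  shows "continuous_map X T f"
  unfolding T_eq continuous_on_generated_topo_iff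
proof (intro conjI allI impI)
  fix U assume "U \<in> {sball q x e | q x e. q \<in> Q \<and> x \<in> carrier V \<and> 0 < e}"
  then obtain q x e where U: "U = sball q x e" "q \<in> Q" "x \<in> carrier V" "0 < e" by blast
  show "openin X (f -` U \<inter> topspace X)"
  proof (subst openin_subopen, intro ballI)
    fix a assume a: "a \<in> f -` U \<inter> topspace X"
    then have "q (f a \<ominus> x) < e" by (simp add: U sball_def)
    then obtain W where W: "openin X W" "a \<in> W" "\<forall>b\<in>W. q (f b \<ominus> x) < e"
      using assms(2)[of q x e a] U a by blast
    have "W \<subseteq> f -` U \<inter> topspace X"
      using W openin_subset[OF W(1)] assms(1) by (auto simp: U sball_def)
    then show "\<exists>W. openin X W \<and> a \<in> W \<and> W \<subseteq> f -` U \<inter> topspace X" using W by blast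
  qed
next
  show "f ` topspace X \<subseteq> \<Union> {sball q x e | q x e. q \<in> Q \<and> x \<in> carrier V \<and> 0 < e}"
    using assms(1) topspace_T unfolding T_eq topology_generated_by_topspace by blast
qed

lemma continuous_map_add: "continuous_map (prod_topology T T) T (\<lambda>(x, y). x \<oplus> y)"
proof (rule continuous_map_into_T)
  fix a assume "a \<in> topspace (prod_topology T T)"
  then show "(case a of (x, y) \<Rightarrow> x \<oplus> y) \<in> carrier V" by (auto simp: topspace_T)
next
  fix q x0 a and e :: real
  assume q: "q \<in> Q" and x0: "x0 \<in> carrier V" and e: "0 < e" and a: "a \<in> topspace (prod_topology T T)"
    and lt: "q ((case a of (x, y) \<Rightarrow> x \<oplus> y) \<ominus> x0) < e"
  obtain x y where xy: "a = (x, y)" "x \<in> carrier V" "y \<in> carrier V" using a by (auto simp: topspace_T)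
  define d where "d = (e - q ((x \<oplus> y) \<ominus> x0)) / 2"
  have d: "d > 0" using lt by (simp add: d_def xy)
  have *: "q (x' \<oplus> y' \<ominus> x0) < e" if "x' \<in> sball q x d" "y' \<in> sball q y d" for x' y'
  proof -
    have c: "x' \<in> carrier V" "y' \<in> carrier V" using that by (auto simp: sball_def)
    have "(x' \<oplus> y') \<ominus> (x \<oplus> y) = (x' \<ominus> x) \<oplus> (y' \<ominus> y)"
      using c xy by (simp add: a_minus_def M.minus_add M.a_ac)
    then have "q ((x' \<oplus> y') \<ominus> (x \<oplus> y)) \<le> q (x' \<ominus> x) + q (y' \<ominus> y)"
      using seminorm_add[OF q, of "x' \<ominus> x" "y' \<ominus> y"] c xy by simp
    moreover have "q (x' \<ominus> x) < d" "q (y' \<ominus> y) < d" using that by (auto simp: sball_def)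
    moreover have "q (x' \<oplus> y' \<ominus> x0) \<le> q ((x' \<oplus> y') \<ominus> (x \<oplus> y)) + q ((x \<oplus> y) \<ominus> x0)"
      using seminorm_diff_triangle[OF q, of "x' \<oplus> y'" "x \<oplus> y" x0] c xy x0 by simp
    ultimately show ?thesis by (simp add: d_def field_simps)
  qed
  show "\<exists>U. openin (prod_topology T T) U \<and> a \<in> U \<and> (\<forall>b\<in>U. q ((case b of (x, y) \<Rightarrow> x \<oplus> y) \<ominus> x0) < e)"
    using * sball_self[OF q _ d] openin_sball[OF q _ d] xy
    by (intro exI[of _ "sball q x d \<times> sball q y d"]) (auto simp: openin_prod_Times_iff)
qed

lemma continuous_map_smult: "continuous_map (prod_topology euclidean T) T (\<lambda>(c, x). c \<odot> x)"
proof (rule continuous_map_into_T)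
  fix a assume "a \<in> topspace (prod_topology (euclidean :: complex topology) T)"
  then show "(case a of (c, x) \<Rightarrow> c \<odot> x) \<in> carrier V" by (auto simp: topspace_T)
next
  fix q x0 a and e :: real
  assume q: "q \<in> Q" and x0: "x0 \<in> carrier V" and e: "0 < e"
    and a: "a \<in> topspace (prod_topology (euclidean :: complex topology) T)"
    and lt: "q ((case a of (c, x) \<Rightarrow> c \<odot> x) \<ominus> x0) < e"
  obtain c x where cx: "a = (c, x)" "x \<in> carrier V" using a by (auto simp: topspace_T)
  define e' where "e' = e - q ((c \<odot> x) \<ominus> x0)"
  have e': "e' > 0" using lt by (simp add: e'_def cx)
  \<comment> \<open>From \<open>c' x' - c x = c' (x' - x) + (c' - c) x\<close> and
    \<open>cmod c' \<le> cmod c + 1\<close> (as \<open>d \<le> 1\<close>), a perturbation of size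
    \<open>d\<close> in both arguments changes the product by at most \<open>d * K\<close>.\<close>
  define K where "K = cmod c + 1 + q x"
  have K: "K > 0" using seminorm_nonneg[OF q cx(2)] norm_ge_zero[of c] unfolding K_def by linarith
  define d where "d = min 1 (e' / (2 * K))"
  have d: "d > 0" using e' K by (simp add: d_def)
  have dK: "d * K < e'"
  proof -
    have "d * K \<le> e' / (2 * K) * K" using K by (intro mult_right_mono) (auto simp: d_def)
    then show ?thesis using K e' by simp
  qed
  have *: "q (c' \<odot> x' \<ominus> x0) < e" if "c' \<in> ball c d" "x' \<in> sball q x d" for c' x'
  proof -
    have m: "x' \<in> carrier V" using that by (auto simp: sball_def)
    have dc: "cmod (c' - c) < d" using that by (simp add: dist_norm norm_minus_commute)
    have c'1: "cmod c' \<le> cmod c + 1"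
      using dc norm_triangle_ineq[of c "c' - c"] by (simp add: d_def)
    have "q (c' \<odot> x' \<ominus> c' \<odot> x) = q (c' \<odot> (x' \<ominus> x))"
      using m cx by (simp add: a_minus_def smult_r_distr smult_r_minus)
    also have "\<dots> = cmod c' * q (x' \<ominus> x)" using seminorm_smult[OF q] m cx by simp
    also have "\<dots> \<le> (cmod c + 1) * d"
      using that c'1 seminorm_nonneg[OF q, of "x' \<ominus> x"] m cx by (intro mult_mono) (auto simp: sball_def)
    finally have 1: "q (c' \<odot> x' \<ominus> c' \<odot> x) \<le> (cmod c + 1) * d" .
    have "c' \<odot> x \<ominus> c \<odot> x = (c' - c) \<odot> x"
      using cx smult_l_distr[of c' "- c" x] smult_l_minus[of c x] by (simp add: a_minus_def)
    then have "q (c' \<odot> x \<ominus> c \<odot> x) = cmod (c' - c) * q x" using seminorm_smult[OF q] cx by simp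
    also have "\<dots> \<le> d * q x" using dc seminorm_nonneg[OF q cx(2)] by (intro mult_right_mono) auto
    finally have 2: "q (c' \<odot> x \<ominus> c \<odot> x) \<le> d * q x" .
    have "q (c' \<odot> x' \<ominus> x0) \<le> q (c' \<odot> x' \<ominus> c' \<odot> x) + q (c' \<odot> x \<ominus> x0)"
      using m cx x0 by (intro seminorm_diff_triangle[OF q]) auto
    also have "q (c' \<odot> x \<ominus> x0) \<le> q (c' \<odot> x \<ominus> c \<odot> x) + q (c \<odot> x \<ominus> x0)"
      using m cx x0 by (intro seminorm_diff_triangle[OF q]) auto
    finally have "q (c' \<odot> x' \<ominus> x0) \<le> d * K + q (c \<odot> x \<ominus> x0)"
      using 1 2 by (simp add: K_def algebra_simps)
    then show ?thesis using dK by (simp add: e'_def)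
  qed
  show "\<exists>U. openin (prod_topology euclidean T) U \<and> a \<in> U \<and>
      (\<forall>b\<in>U. q ((case b of (c, x) \<Rightarrow> c \<odot> x) \<ominus> x0) < e)"
    using * sball_self[OF q _ d] openin_sball[OF q _ d] cx d
    by (intro exI[of _ "ball c d \<times> sball q x d"]) (auto simp: openin_prod_Times_iff)
qed

section \<open>Neighbourhoods, local convexity and separation\<close>

text \<open>Subbasic balls may have any centre. A ball about \<open>z\<close> that contains
  \<open>x\<close> also contains the ball about \<open>x\<close> whose radius is the slack left by
  the triangle inequality, so finitely many conditions centred at \<open>x\<close> suffice.\<close>

lemma T_nhds:
  assumes "openin T U" "x \<in> U"
  shows "\<exists>F e. finite F \<and> F \<subseteq> Q \<and> 0 < e \<and> {y \<in> carrier V. \<forall>q\<in>F. q (y \<ominus> x) < e} \<subseteq> U"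
proof -
  have "generate_topology_on {sball q x e | q x e. q \<in> Q \<and> x \<in> carrier V \<and> 0 < e} U"
    using assms(1) unfolding T_eq openin_topology_generated_by_iff .
  then show ?thesis using assms(2)
  proof (induction arbitrary: x)
    case Empty
    then show ?case by simp
  next
    case (Int A B)
    obtain F e where F: "finite F" "F \<subseteq> Q" "0 < e" "{y \<in> carrier V. \<forall>q\<in>F. q (y \<ominus> x) < e} \<subseteq> A"
      using Int.IH(1)[of x] Int.prems by auto
    obtain G d where G: "finite G" "G \<subseteq> Q" "0 < d" "{y \<in> carrier V. \<forall>q\<in>G. q (y \<ominus> x) < d} \<subseteq> B"
      using Int.IH(2)[of x] Int.prems by auto
    have "{y \<in> carrier V. \<forall>q\<in>F \<union> G. q (y \<ominus> x) < min e d} \<subseteq> A \<inter> B" using F(4) G(4) by auto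
    then show ?case using F G
      by (intro exI[of _ "F \<union> G"] exI[of _ "min e d"]) auto
  next
    case (UN K)
    then obtain k where k: "k \<in> K" "x \<in> k" by blast
    then show ?case using UN.IH[of k x] by blast
  next
    case (Basis s)
    then obtain q z e where s: "s = sball q z e" "q \<in> Q" "z \<in> carrier V" "0 < e" by blast
    have x: "x \<in> carrier V" "q (x \<ominus> z) < e" using Basis.prems by (auto simp: s sball_def)
    have "{y \<in> carrier V. \<forall>q\<in>{q}. q (y \<ominus> x) < e - q (x \<ominus> z)} \<subseteq> s"
    proof
      fix y assume "y \<in> {y \<in> carrier V. \<forall>q\<in>{q}. q (y \<ominus> x) < e - q (x \<ominus> z)}"
      then show "y \<in> s" using seminorm_diff_triangle[OF s(2), of y x z] x s by (auto simp: sball_def)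
    qed
    then show ?case using s(2) x by (intro exI[of _ "{q}"] exI[of _ "e - q (x \<ominus> z)"]) auto
  qed
qed

lemma openin_finite_sballs:
  assumes "finite F" "F \<subseteq> Q" "0 < e" "x \<in> carrier V"
  shows "openin T {y \<in> carrier V. \<forall>q\<in>F. q (y \<ominus> x) < e}"
  using assms
proof (induction F)
  case empty
  then show ?case using openin_topspace[of T] by (simp add: topspace_T)
next
  case (insert q F)
  have "{y \<in> carrier V. \<forall>q\<in>insert q F. q (y \<ominus> x) < e}
      = sball q x e \<inter> {y \<in> carrier V. \<forall>q\<in>F. q (y \<ominus> x) < e}" by (auto simp: sball_def)
  then show ?case using insert openin_sball[of q x e] by auto
qed

lemma locally_convex_tvs_T: "locally_convex_tvs V T"
  unfolding locally_convex_tvs_def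
proof (intro conjI allI impI)
  show "topological_vector_space V T"
    unfolding topological_vector_space_def
    using continuous_map_add continuous_map_smult topspace_T module_axioms by blast
next
  fix U assume "openin T U \<and> \<zero> \<in> U"
  then obtain F e where F: "finite F" "F \<subseteq> Q" "0 < e" "{y \<in> carrier V. \<forall>q\<in>F. q (y \<ominus> \<zero>) < e} \<subseteq> U"
    using T_nhds[of U "\<zero>"] by blast
  \<comment> \<open>The basic neighbourhood is itself convex, being cut out by seminorm balls about
    zero.\<close>
  define C where "C = {y \<in> carrier V. \<forall>q\<in>F. q (y \<ominus> \<zero>) < e}"
  have C_eq: "C = {y \<in> carrier V. \<forall>q\<in>F. q y < e}"
  proof -
    have "\<ominus> \<zero> = \<zero>" by (rule M.minus_equality) auto
    then have "y \<ominus> \<zero> = y" if "y \<in> carrier V" for y using that by (simp add: a_minus_def)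
    then show ?thesis unfolding C_def by (intro Collect_cong) (auto cong: conj_cong)
  qed
  have "convex_in V C"
    unfolding convex_in_def
  proof (intro conjI ballI)
    fix x y and t :: real assume x: "x \<in> C" and y: "y \<in> C" and t: "t \<in> {0..1}"
    have "q ((complex_of_real (1 - t) \<odot> x) \<oplus> (complex_of_real t \<odot> y)) < e" if q: "q \<in> F" for q
    proof -
      have q': "q \<in> Q" and l: "q x < e" "q y < e" using q F(2) x y by (auto simp: C_eq)
      have c: "x \<in> carrier V" "y \<in> carrier V" using x y by (auto simp: C_eq)
      have "q ((complex_of_real (1 - t) \<odot> x) \<oplus> (complex_of_real t \<odot> y))
          \<le> cmod (complex_of_real (1 - t)) * q x + cmod (complex_of_real t) * q y"
        using seminorm_add[OF q', of "complex_of_real (1 - t) \<odot> x" "complex_of_real t \<odot> y"]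
          seminorm_smult[OF q'] c by simp
      also have "\<dots> = (1 - t) * q x + t * q y" using t by (simp del: of_real_diff)
      also have "\<dots> < e" using t l convex_bound_lt[of "q x" e "q y" "1 - t" t] by simp
      finally show ?thesis .
    qed
    then show "(complex_of_real (1 - t) \<odot> x) \<oplus> (complex_of_real t \<odot> y) \<in> C"
      using x y by (simp add: C_eq)
  qed (auto simp: C_def)
  moreover have "openin T C" unfolding C_def using F by (intro openin_finite_sballs) auto
  moreover have "q \<zero> < e" if "q \<in> F" for q using that seminorm_zero[of q] F(2,3) by auto
  then have "\<zero> \<in> C" unfolding C_eq by blast
  moreover have "C \<subseteq> U" using F(4) by (simp add: C_def)
  ultimately show "\<exists>C. openin T C \<and> \<zero> \<in> C \<and> C \<subseteq> U \<and> convex_in V C" by blast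
qed

lemma Hausdorff_space_T:
  assumes "\<And>x. x \<in> carrier V \<Longrightarrow> (\<And>q. q \<in> Q \<Longrightarrow> q x = 0) \<Longrightarrow> x = \<zero>"
  shows "Hausdorff_space T"
  unfolding Hausdorff_space_def topspace_T
proof (intro allI impI)
  fix x y assume xy: "x \<in> carrier V \<and> y \<in> carrier V \<and> x \<noteq> y"
  have "x \<ominus> y \<noteq> \<zero>"
  proof
    assume "x \<ominus> y = \<zero>"
    then have "(x \<ominus> y) \<oplus> y = y" using xy by simp
    moreover have "(x \<ominus> y) \<oplus> y = x" using xy by (simp add: a_minus_def M.a_assoc M.l_neg)
    ultimately show False using xy by simp
  qed
  then obtain q where q: "q \<in> Q" "q (x \<ominus> y) \<noteq> 0" using assms[of "x \<ominus> y"] xy by auto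
  define e where "e = q (x \<ominus> y) / 2"
  have e: "e > 0" using q seminorm_nonneg[OF q(1), of "x \<ominus> y"] xy by (simp add: e_def)
  have "disjnt (sball q x e) (sball q y e)"
    unfolding disjnt_iff
  proof (intro allI notI)
    fix z assume "z \<in> sball q x e \<and> z \<in> sball q y e"
    then show False using seminorm_diff_triangle[OF q(1), of x z y] seminorm_diff_commute[OF q(1), of x z] xy
      by (auto simp: sball_def e_def)
  qed
  then show "\<exists>U W. openin T U \<and> openin T W \<and> x \<in> U \<and> y \<in> W \<and> disjnt U W"
    using openin_sball[OF q(1) _ e] sball_self[OF q(1) _ e] xy by blast
qed

end

section \<open>Separately holomorphic functions vanishing on the diagonal\<close>

text \<open>The hypotheses are chosen to be stable under differentiation in \<open>s\<close> at the
  price of half the radius. Boundedness stands in for joint continuity, and the slices are entire in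
  \<open>s\<close> so that a jet at \<open>a\<close> determines them globally. With the second
  argument conjugated, the diagonal is the set of pairs \<open>(s, cnj s)\<close>.\<close>

definition bounded_sep_hol :: "(complex \<Rightarrow> complex \<Rightarrow> complex) \<Rightarrow> complex \<Rightarrow> real \<Rightarrow> bool"
  where "bounded_sep_hol K a r \<longleftrightarrow> 0 < r \<and>
    (\<forall>t\<in>ball (cnj a) r. (\<lambda>s. K s t) holomorphic_on UNIV) \<and>
    (\<forall>s\<in>ball a r. K s holomorphic_on ball (cnj a) r) \<and>
    (\<exists>M. \<forall>s\<in>ball a r. \<forall>t\<in>ball (cnj a) r. cmod (K s t) \<le> M) \<and>
    (\<forall>s\<in>ball a r. K s (cnj s) = 0)"

text \<open>Cauchy's inequality on discs of radius \<open>r / 2\<close> bounds the derivatives in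
  \<open>s\<close> uniformly in \<open>t\<close>. From this come the new bound, the holomorphy of
  the derivative in \<open>t\<close>, and a chain rule along the curves
  \<open>(s, cnj s)\<close>.\<close>

lemma bounded_sep_hol_deriv:
  assumes "bounded_sep_hol K a r"
  shows "bounded_sep_hol (\<lambda>s t. deriv (\<lambda>s. K s t) s) a (r / 2)"
proof -
  define b where "b = cnj a"
  define K1 where "K1 = (\<lambda>s t. deriv (\<lambda>s. K s t) s)"
  have r: "0 < r" and hs: "\<And>t. t \<in> ball b r \<Longrightarrow> (\<lambda>s. K s t) holomorphic_on UNIV"
    and ht: "\<And>s. s \<in> ball a r \<Longrightarrow> K s holomorphic_on ball b r"
    and K0: "\<And>s. s \<in> ball a r \<Longrightarrow> K s (cnj s) = 0"
    using assms by (auto simp: bounded_sep_hol_def b_def)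
  obtain M where M: "\<And>s t. s \<in> ball a r \<Longrightarrow> t \<in> ball b r \<Longrightarrow> cmod (K s t) \<le> M"
    using assms unfolding bounded_sep_hol_def b_def by blast
  have sub: "cball s (r / 2) \<subseteq> ball a r" if "s \<in> ball a (r / 2)" for s
  proof
    fix z assume "z \<in> cball s (r / 2)"
    then show "z \<in> ball a r" using that dist_triangle[of a z s] by (simp add: dist_commute)
  qed
  have cauchy: "cmod ((deriv ^^ n) (\<lambda>s. K s t) s) \<le> fact n * M / (r / 2) ^ n"
    if "s \<in> ball a (r / 2)" "t \<in> ball b r" for s t n
  proof (rule Cauchy_inequality)
    show "(\<lambda>s. K s t) holomorphic_on ball s (r / 2)"
      using hs[OF that(2)] by (rule holomorphic_on_subset) auto
    show "continuous_on (cball s (r / 2)) (\<lambda>s. K s t)"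
      using holomorphic_on_imp_continuous_on[OF hs[OF that(2)]] by (rule continuous_on_subset) auto
    show "cmod (K x t) \<le> M" if "cmod (s - x) = r / 2" for x
      using M[of x t] sub[OF \<open>s \<in> ball a (r / 2)\<close>] that \<open>t \<in> ball b r\<close> by (force simp: dist_norm)
  qed (use r in auto)
  \<comment> \<open>Cauchy's bound for the second derivative in \<open>s\<close>, the same for all
    \<open>t\<close> in the disc; this uniformity replaces joint regularity of
    \<open>K\<close>.\<close>
  define C where "C = fact 2 * M / (r / 2) ^ 2"
  have taylor: "cmod (K (s + h) t - K s t - h * K1 s t) \<le> C * (cmod h)\<^sup>2"
    if "s \<in> ball a (r / 2)" "s + h \<in> ball a (r / 2)" "t \<in> ball b r" for s h t
  proof -
    have "cmod ((deriv ^^ 0) (\<lambda>s. K s t) (s + h)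
        - (\<Sum>i\<le>1. (deriv ^^ i) (\<lambda>s. K s t) s * (s + h - s) ^ i / fact i))
      \<le> C * cmod (s + h - s) ^ Suc 1 / fact 1"
    proof (rule complex_Taylor[of "ball a (r / 2)" 1 "\<lambda>i. (deriv ^^ i) (\<lambda>s. K s t)"])
      show "((deriv ^^ i) (\<lambda>s. K s t) has_field_derivative (deriv ^^ Suc i) (\<lambda>s. K s t) x)
          (at x within ball a (r / 2))" for i x
        using holomorphic_derivI[OF holomorphic_higher_deriv[OF hs[OF that(3)]], of x i]
        by (simp add: has_field_derivative_at_within)
      show "cmod ((deriv ^^ Suc 1) (\<lambda>s. K s t) x) \<le> C" if "x \<in> ball a (r / 2)" for x
        using cauchy[OF that \<open>t \<in> ball b r\<close>, of 2] by (simp add: C_def numeral_2_eq_2)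
    qed (use that in auto)
    then show ?thesis by (simp add: K1_def algebra_simps power2_eq_square)
  qed
  have K1_hol: "K1 s holomorphic_on ball b r" if s: "s \<in> ball a (r / 2)" for s
  proof -
    obtain d where d: "0 < d" "ball s d \<subseteq> ball a (r / 2)"
      using s openE[OF open_ball, of s a "r / 2"] by blast
    define h where "h n = d / 2 * inverse (real (Suc n))" for n
    have h: "0 < h n" "h n < d" for n
    proof -
      show "0 < h n" using d by (simp add: h_def)
      have "inverse (real (Suc n)) \<le> 1" by (simp add: inverse_le_1_iff)
      then have "h n \<le> d / 2 * 1" unfolding h_def using d by (intro mult_left_mono) auto
      then show "h n < d" using d by simp
    qed
    have sh: "s + of_real (h n) \<in> ball a (r / 2)" for n
      by (rule subsetD[OF d(2)]) (use h[of n] in \<open>simp add: dist_norm\<close>)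
    \<comment> \<open>Division of the Taylor remainder by \<open>h n\<close> leaves
      \<open>C * h n\<close> for all \<open>t\<close> at once, so the derivative in \<open>s\<close>
      is a uniform limit of functions holomorphic in \<open>t\<close>.\<close>
    have ul: "uniform_limit (ball b r) (\<lambda>n t. (K (s + of_real (h n)) t - K s t) / of_real (h n)) (K1 s) sequentially"
    proof (rule uniform_limitI)
      fix e :: real assume e: "0 < e"
      have "(\<lambda>n. C * h n) \<longlonglongrightarrow> C * (d / 2 * 0)"
        unfolding h_def by (intro tendsto_intros LIMSEQ_inverse_real_of_nat)
      then have "\<forall>\<^sub>F n in sequentially. C * h n < e" using e by (auto intro: order_tendstoD)
      then show "\<forall>\<^sub>F n in sequentially. \<forall>t\<in>ball b r.
          dist ((K (s + of_real (h n)) t - K s t) / of_real (h n)) (K1 s t) < e"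
      proof eventually_elim
        case (elim n)
        show ?case
        proof
          fix t assume t: "t \<in> ball b r"
          have "(K (s + of_real (h n)) t - K s t) / of_real (h n) - K1 s t
              = (K (s + of_real (h n)) t - K s t - of_real (h n) * K1 s t) / of_real (h n)"
            using h(1)[of n] by (simp add: divide_simps)
          then have "cmod ((K (s + of_real (h n)) t - K s t) / of_real (h n) - K1 s t)
              = cmod (K (s + of_real (h n)) t - K s t - of_real (h n) * K1 s t) / h n"
            using h(1)[of n] by (simp add: norm_divide)
          also have "\<dots> \<le> C * (cmod (of_real (h n)))\<^sup>2 / h n"
            using taylor[OF s sh t] h(1)[of n] by (intro divide_right_mono) auto
          also have "\<dots> = C * h n" using h(1)[of n] by (simp add: power2_eq_square)
          finally show "dist ((K (s + of_real (h n)) t - K s t) / of_real (h n)) (K1 s t) < e"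
            using elim by (simp add: dist_norm)
        qed
      qed
    qed
    have hq: "(\<lambda>t. (K (s + of_real (h n)) t - K s t) / of_real (h n)) holomorphic_on ball b r" for n
    proof (intro holomorphic_intros ht)
      have "ball a (r / 2) \<subseteq> ball a r" using r by auto
      then show "s + of_real (h n) \<in> ball a r" "s \<in> ball a r" using sh[of n] s by blast+
      show "complex_of_real (h n) \<noteq> 0" using h(1)[of n] by simp
    qed
    show ?thesis
    proof (rule holomorphic_uniform_sequence[OF open_ball hq])
      fix x assume "x \<in> ball b r"
      then obtain d where "0 < d" "cball x d \<subseteq> ball b r" using open_contains_cball open_ball by blast
      then show "\<exists>d>0. cball x d \<subseteq> ball b r \<and>
        uniform_limit (cball x d) (\<lambda>n t. (K (s + of_real (h n)) t - K s t) / of_real (h n)) (K1 s) sequentially"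
        using uniform_limit_on_subset[OF ul] by blast
    qed
  qed
  have K1_diag: "K1 s (cnj s) = 0" if s: "s \<in> ball a (r / 2)" for s
  proof -
    define t where "t = cnj s"
    have sr: "s \<in> ball a r" using s r by auto
    have cnj_ball: "cnj z \<in> ball b r \<longleftrightarrow> z \<in> ball a r" for z r
      by (simp add: b_def dist_norm flip: complex_cnj_diff)
    have t: "t \<in> ball b r" using sr cnj_ball by (simp add: t_def)
    define L where "L = deriv (K s) t"
    \<comment> \<open>The derivative of \<open>K s (cnj s) = 0\<close> in the real direction
      \<open>u\<close>: the first argument moves by \<open>u\<close>, the second by
      \<open>cnj u\<close>.\<close>
    have dir: "u * K1 s t + cnj u * L = 0" if u: "cmod u = 1" for u
    proof -
      have x0: "((\<lambda>x. of_real x * u) \<longlongrightarrow> 0) (at_right (0::real))"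
        by (auto intro!: tendsto_eq_intros)
      have x0': "((\<lambda>x. of_real x * cnj u) \<longlongrightarrow> 0) (at_right (0::real))"
        by (auto intro!: tendsto_eq_intros)
      have ss: "((\<lambda>x. s + of_real x * u) \<longlongrightarrow> s) (at_right (0::real))"
        using tendsto_add[OF tendsto_const x0, of s] by simp
      have ev_s: "\<forall>\<^sub>F x in at_right (0::real). s + of_real x * u \<in> ball a (r / 2)"
        by (rule topological_tendstoD[OF ss open_ball s])
      have tt: "((\<lambda>x. t + of_real x * cnj u) \<longlongrightarrow> t) (at_right (0::real))"
        using tendsto_add[OF tendsto_const x0', of t] by simp
      have ev_t: "\<forall>\<^sub>F x in at_right (0::real). t + of_real x * cnj u \<in> ball b r"
        by (rule topological_tendstoD[OF tt open_ball t])
      have pos: "\<forall>\<^sub>F x in at_right (0::real). 0 < x" by (simp add: eventually_at_right_less)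
      \<comment> \<open>The chain rule by hand. The increment is split at
        \<open>(s, t + x * cnj u)\<close>; the part in \<open>s\<close> is taken at a moving
        \<open>t\<close>, where the uniform Taylor estimate applies.\<close>
      have 1: "((\<lambda>x. (K (s + of_real x * u) (t + of_real x * cnj u) - K s (t + of_real x * cnj u)
          - of_real x * u * K1 s (t + of_real x * cnj u)) / of_real x) \<longlongrightarrow> 0) (at_right (0::real))"
      proof (rule Lim_null_comparison)
        show "\<forall>\<^sub>F x in at_right (0::real). cmod ((K (s + of_real x * u) (t + of_real x * cnj u) - K s (t + of_real x * cnj u)
          - of_real x * u * K1 s (t + of_real x * cnj u)) / of_real x) \<le> C * x"
          using ev_s ev_t pos
        proof eventually_elim
          case (elim x)
          show ?case
            using taylor[OF s elim(1,2)] elim(3) u by (simp add: norm_divide norm_mult field_simps power2_eq_square)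
        qed
        show "((\<lambda>x. C * x) \<longlongrightarrow> 0) (at_right 0)" by (auto intro!: tendsto_eq_intros)
      qed
      have "isCont (K1 s) t"
        using holomorphic_on_imp_continuous_on[OF K1_hol[OF s]] t by (simp add: continuous_on_eq_continuous_at)
      then have 2: "((\<lambda>x. K1 s (t + of_real x * cnj u)) \<longlongrightarrow> K1 s t) (at_right (0::real))"
        using tt by (rule isCont_tendsto_compose)
      have "(K s has_field_derivative L) (at t)"
        unfolding L_def using ht[OF sr] t by (intro holomorphic_derivI) auto
      then have "((\<lambda>h. (K s (t + h) - K s t) / h) \<longlongrightarrow> L) (at 0)"
        by (simp add: DERIV_def)
      moreover have "filterlim (\<lambda>x. of_real x * cnj u) (at 0) (at_right (0::real))"
        unfolding filterlim_at
      proof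
        show "((\<lambda>x. of_real x * cnj u) \<longlongrightarrow> 0) (at_right (0::real))" by (rule x0')
        show "\<forall>\<^sub>F x in at_right (0::real). of_real x * cnj u \<in> UNIV \<and> of_real x * cnj u \<noteq> 0"
          using pos by eventually_elim (use u in auto)
      qed
      ultimately have 3: "((\<lambda>x. (K s (t + of_real x * cnj u) - K s t) / (of_real x * cnj u)) \<longlongrightarrow> L) (at_right (0::real))"
        by (rule filterlim_compose)
      have "((\<lambda>x. (K (s + of_real x * u) (t + of_real x * cnj u) - K s (t + of_real x * cnj u)
          - of_real x * u * K1 s (t + of_real x * cnj u)) / of_real x
          + u * K1 s (t + of_real x * cnj u)
          + cnj u * ((K s (t + of_real x * cnj u) - K s t) / (of_real x * cnj u)))
          \<longlongrightarrow> 0 + u * K1 s t + cnj u * L) (at_right (0::real))"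
        by (intro tendsto_intros 1 2 3)
      moreover have "\<forall>\<^sub>F x in at_right (0::real). (K (s + of_real x * u) (t + of_real x * cnj u) - K s (t + of_real x * cnj u)
          - of_real x * u * K1 s (t + of_real x * cnj u)) / of_real x
          + u * K1 s (t + of_real x * cnj u)
          + cnj u * ((K s (t + of_real x * cnj u) - K s t) / (of_real x * cnj u)) = 0"
        using ev_s pos
      proof eventually_elim
        case (elim x)
        have "K (s + of_real x * u) (t + of_real x * cnj u) = 0"
          using K0[of "s + of_real x * u"] elim r by (auto simp: t_def)
        moreover have "K s t = 0" using K0[OF sr] by (simp add: t_def)
        moreover have "u \<noteq> 0" using u by auto
        ultimately show ?case using elim by (simp add: field_simps)
      qed
      ultimately have "((\<lambda>x. 0) \<longlongrightarrow> 0 + u * K1 s t + cnj u * L) (at_right (0::real))"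
        by (rule Lim_transform_eventually)
      then show ?thesis using tendsto_unique[OF _ _ tendsto_const] by force
    qed
    \<comment> \<open>The directions 1 and \<i> give \<open>K1 + L = 0\<close> and
      \<open>K1 - L = 0\<close>: the antidiagonal is totally real, so its two real directions
      determine both complex partial derivatives.\<close>
    have "K1 s t = 0" using dir[of 1] dir[of \<i>] by (simp add: algebra_simps)
    then show ?thesis by (simp add: t_def)
  qed
  have "K1 s holomorphic_on ball b (r / 2)" if "s \<in> ball a (r / 2)" for s
    using K1_hol[OF that] by (rule holomorphic_on_subset) (use r in auto)
  moreover have "(\<lambda>s. K1 s t) holomorphic_on UNIV" if "t \<in> ball b (r / 2)" for t
    unfolding K1_def using hs[of t] that r by (intro holomorphic_deriv) auto
  moreover have "\<exists>M. \<forall>s\<in>ball a (r / 2). \<forall>t\<in>ball b (r / 2). cmod (K1 s t) \<le> M"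
    using cauchy[of _ _ 1] r by (intro exI[of _ "fact 1 * M / (r / 2) ^ 1"]) (auto simp: K1_def)
  ultimately show ?thesis using r K1_diag
    unfolding bounded_sep_hol_def K1_def[symmetric] b_def[symmetric] by auto
qed

text \<open>The induction varies \<open>K\<close> and \<open>r\<close> while \<open>a\<close> stays
  fixed, since each differentiation changes the function and halves the radius. The slice is entire,
  so a vanishing jet at \<open>a\<close> kills it for every \<open>s\<close>, not only near
  \<open>a\<close>.\<close>

lemma bounded_sep_hol_slice_zero:
  assumes "bounded_sep_hol K a r"
  shows "K s (cnj a) = 0"
proof -
  have "bounded_sep_hol K a r \<Longrightarrow> (deriv ^^ n) (\<lambda>s. K s (cnj a)) a = 0" for n K r
  proof (induction n arbitrary: K r)
    case 0
    then show ?case by (simp add: bounded_sep_hol_def)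
  next
    case (Suc n)
    show ?case
      using Suc.IH[OF bounded_sep_hol_deriv[OF Suc.prems]] by (simp add: funpow_Suc_right del: funpow.simps)
  qed
  note derivs = this[OF assms]
  show ?thesis
    by (rule holomorphic_fun_eq_0_on_connected[of "\<lambda>s. K s (cnj a)" UNIV a])
      (use assms derivs in \<open>auto simp: bounded_sep_hol_def\<close>)
qed

text \<open>No joint continuity is assumed: Baire's theorem yields a polydisc on which \<open>K\<close> is bounded.\<close>

lemma separately_holomorphic_antidiagonal_zero:
  fixes K :: "complex \<Rightarrow> complex \<Rightarrow> complex"
  assumes hs: "\<And>t. (\<lambda>s. K s t) holomorphic_on UNIV"
    and ht: "\<And>s. K s holomorphic_on UNIV"
    and K0: "\<And>s. K s (cnj s) = 0"
  shows "K s t = 0"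
proof -
  \<comment> \<open>The disc for \<open>s\<close> has radius \<open>k + 1\<close> rather than
    \<open>k\<close>, so that it still contains a small disc about \<open>cnj t\<close> when
    \<open>cmod t \<le> k\<close>.\<close>
  define E where "E k m = cball 0 (real k) \<inter> {t. \<forall>s\<in>cball 0 (real k + 1). cmod (K s t) \<le> real m}" for k m :: nat
  \<comment> \<open>For each fixed \<open>s\<close> the condition is closed in \<open>t\<close>;
    separate continuity is enough.\<close>
  have closed_E: "closed (E k m)" for k m
  proof -
    have "E k m = cball 0 (real k) \<inter> (\<Inter>s\<in>cball 0 (real k + 1). {t. cmod (K s t) \<le> real m})"
      by (auto simp: E_def)
    moreover have "closed {t. cmod (K s t) \<le> real m}" for s
      by (intro closed_Collect_le continuous_intros holomorphic_on_imp_continuous_on[OF ht])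
    ultimately show ?thesis by (simp add: closed_INT closed_Int)
  qed
  have "(\<Union>(case_prod E ` UNIV)) = UNIV"
  proof (rule UNIV_eq_I[symmetric])
    fix t :: complex
    obtain k where k: "cmod t \<le> real k" using real_arch_simple by blast
    have "compact ((\<lambda>s. K s t) ` cball 0 (real k + 1))"
      by (intro compact_continuous_image compact_cball continuous_on_subset[OF holomorphic_on_imp_continuous_on[OF hs]]) auto
    then obtain B where B: "\<And>s. s \<in> cball 0 (real k + 1) \<Longrightarrow> cmod (K s t) \<le> B"
      using compact_imp_bounded bounded_iff by (metis imageI)
    obtain m where "B \<le> real m" using real_arch_simple by blast
    then have "t \<in> E k m" using k B by (force simp: E_def)
    then show "t \<in> \<Union>(case_prod E ` UNIV)" by auto
  qed
  moreover have "\<exists>k m. interior (E k m) \<noteq> {}"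
  proof (rule ccontr)
    assume *: "\<not> ?thesis"
    have "euclidean interior_of \<Union>(case_prod E ` UNIV) = {}"
      using closed_E * completely_metrizable_space_euclidean by (intro Baire_category_alt) auto
    then show False using calculation by simp
  qed
  ultimately obtain k m b where "b \<in> interior (E k m)" by blast
  then obtain d where d: "0 < d" "ball b d \<subseteq> E k m" using mem_interior by blast
  \<comment> \<open>Half of \<open>d\<close> keeps a disc of radius \<open>r\<close> about any point
    of \<open>ball b r\<close> inside \<open>E k m\<close>; the cap at \<open>1 / 2\<close> keeps
    \<open>s\<close> within the disc of radius \<open>k + 1\<close>.\<close>
  define r where "r = min d 1 / 2"
  have r: "0 < r" "2 * r \<le> d" "r \<le> 1 / 2" using d by (auto simp: r_def)
  \<comment> \<open>The bound found near \<open>b\<close> holds for all \<open>s\<close> of modulus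
    at most \<open>k + 1\<close>, hence also around the diagonal point \<open>(cnj t, t)\<close>,
    where the local result is applied.\<close>
  have slice: "K s t = 0" if t: "t \<in> ball b r" for s t
  proof -
    have sub: "ball t r \<subseteq> E k m"
    proof
      fix z assume "z \<in> ball t r"
      then have "z \<in> ball b d" using t r dist_triangle[of b z t] by (auto simp: dist_commute)
      then show "z \<in> E k m" using d by blast
    qed
    have tk: "cmod t \<le> real k" using sub r by (force simp: E_def)
    have "bounded_sep_hol K (cnj t) r"
      unfolding bounded_sep_hol_def
    proof (intro conjI ballI exI[of _ "real m"])
      fix s t' assume s: "s \<in> ball (cnj t) r" and t': "t' \<in> ball (cnj (cnj t)) r"
      have "cmod s \<le> cmod t + r"
        using s norm_triangle_ineq[of "cnj t" "s - cnj t"] by (auto simp: dist_norm norm_minus_commute)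
      then have "s \<in> cball 0 (real k + 1)" using tk r by simp
      then show "cmod (K s t') \<le> real m" using sub t' by (auto simp: E_def)
    qed (use r hs K0 holomorphic_on_subset[OF ht] in auto)
    from bounded_sep_hol_slice_zero[OF this, of s] show ?thesis by simp
  qed
  \<comment> \<open>Now the second variable is continued: \<open>K s\<close> is entire and vanishes
    on \<open>ball b r\<close>.\<close>
  have "K s t = (\<lambda>_. 0) t"
    by (rule analytic_continuation_open[of "ball b r" UNIV "K s" "\<lambda>_. 0"]) (use slice r ht in auto)
  then show ?thesis by simp
qed

section \<open>Reduction from several variables to a complex line\<close>

lemma holomorphic_Cn_line:
  assumes "holomorphic_Cn f"
  shows "(\<lambda>s. f (z + s *s v)) holomorphic_on UNIV"
proof -
  have "(\<lambda>s. f (z + s *s v)) field_differentiable at s" for s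
  proof -
    obtain D where D: "(f has_derivative D) (at (z + s *s v))" "\<And>c v. D (c *s v) = c * D v"
      using assms unfolding holomorphic_Cn_def by blast
    have "linear (\<lambda>s. s *s v)"
      by (rule linearI) (simp_all add: vec_eq_iff algebra_simps)
    then have "bounded_linear (\<lambda>s. s *s v)" by (simp add: linear_conv_bounded_linear)
    then have "((\<lambda>s. z + s *s v) has_derivative (\<lambda>h. h *s v)) (at s)"
      by (auto intro!: derivative_eq_intros bounded_linear_imp_has_derivative)
    from has_derivative_compose[OF this D(1)]
    have "((\<lambda>s. f (z + s *s v)) has_derivative (\<lambda>h. D v * h)) (at s)"
      by (simp add: D(2) mult.commute)
    then show ?thesis
      unfolding field_differentiable_def has_field_derivative_def by blast
  qed
  then show ?thesis by (simp add: holomorphic_on_def field_differentiable_at_within)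
qed

lemma holomorphic_Cn_diff:
  assumes "holomorphic_Cn f" "holomorphic_Cn g"
  shows "holomorphic_Cn (\<lambda>z. f z - g z)"
  unfolding holomorphic_Cn_def
proof
  fix z
  obtain D E where "(f has_derivative D) (at z)" "\<forall>c v. D (c *s v) = c * D v"
    "(g has_derivative E) (at z)" "\<forall>c v. E (c *s v) = c * E v"
    using assms unfolding holomorphic_Cn_def by metis
  then show "\<exists>D. ((\<lambda>z. f z - g z) has_derivative D) (at z) \<and> (\<forall>c v. D (c *s v) = c * D v)"
    by (intro exI[of _ "\<lambda>h. D h - E h"]) (auto intro: has_derivative_diff simp: algebra_simps)
qed

text \<open>The complex line through two points \<open>z\<close> and \<open>w\<close> reduces the claim to dimension one.\<close>

lemma sesquiholomorphic_unique:
  fixes F G :: "(complex ^ 'n::finite) \<times> (complex ^ 'n) \<Rightarrow> complex"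
  assumes "\<And>w. holomorphic_Cn (\<lambda>z. F (z, w))" "\<And>z. antiholomorphic_Cn (\<lambda>w. F (z, w))"
    and "\<And>w. holomorphic_Cn (\<lambda>z. G (z, w))" "\<And>z. antiholomorphic_Cn (\<lambda>w. G (z, w))"
    and diag: "\<And>z. F (z, z) = G (z, z)"
  shows "F = G"
proof
  fix x :: "(complex ^ 'n) \<times> (complex ^ 'n)"
  obtain z w where x: "x = (z, w)" by (cases x)
  define D where "D x = F x - G x" for x
  have D1: "holomorphic_Cn (\<lambda>z. D (z, w))" for w
    unfolding D_def by (intro holomorphic_Cn_diff assms)
  have D2: "holomorphic_Cn (\<lambda>w. cnj (D (z, w)))" for z
    using holomorphic_Cn_diff[OF assms(2,4)[unfolded antiholomorphic_Cn_def], of z z] by (simp add: D_def)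
  \<comment> \<open>Conjugating \<open>t\<close> makes \<open>K\<close> holomorphic in it and places
    the diagonal at \<open>t = cnj s\<close>; the pair \<open>(0, 1)\<close> corresponds to
    \<open>(z, w)\<close>.\<close>
  define K where "K s t = D (z + s *s (w - z), z + cnj t *s (w - z))" for s t
  have "K 0 1 = 0"
  proof (rule separately_holomorphic_antidiagonal_zero[of K])
    show "(\<lambda>s. K s t) holomorphic_on UNIV" for t
      unfolding K_def by (rule holomorphic_Cn_line[OF D1])
    have "(cnj \<circ> (\<lambda>t. cnj (D (z + s *s (w - z), z + t *s (w - z)))) \<circ> cnj) holomorphic_on UNIV" for s
      using holomorphic_on_subset[OF holomorphic_Cn_line[OF D2] subset_UNIV]
      by (rule holomorphic_on_compose_cnj_cnj) simp
    then show "K s holomorphic_on UNIV" for s unfolding K_def by (simp add: o_def)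
    show "K s (cnj s) = 0" for s by (simp add: K_def D_def diag)
  qed
  then show "F x = G x" by (simp add: x K_def D_def)
qed

section \<open>Power series in several variables\<close>

lemma mabs_zero [simp]: "mabs 0 = 0"
  by (simp add: mabs_def)

lemma mabs_add: "mabs (R + S) = mabs R + mabs S"
  by (simp add: mabs_def sum.distrib)

lemma mabs_axis [simp]: "mabs (axis i n) = n"
  by (simp add: mabs_def axis_def)

lemma mabs_eq_0_iff: "mabs R = 0 \<longleftrightarrow> R = 0"
  by (auto simp: mabs_def vec_eq_iff)

lemma mabs_eq_1D: "mabs R = 1 \<Longrightarrow> \<exists>i. R = axis i 1"
proof -
  assume "mabs R = 1"
  then obtain i where i: "R $ i = 1" "\<forall>j. j \<noteq> i \<longrightarrow> R $ j = 0"
    unfolding mabs_def by (subst (asm) sum_eq_1_iff) auto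
  then have "R = axis i 1" by (auto simp: vec_eq_iff axis_def)
  then show ?thesis ..
qed

lemma mpow_zero [simp]: "mpow z 0 = 1"
  by (simp add: mpow_def)

lemma mpow_add: "mpow z (R + S) = mpow z R * mpow z S"
  by (simp add: mpow_def power_add prod.distrib)

lemma mpow_axis [simp]: "mpow z (axis i 1) = z $ i"
proof -
  have "mpow z (axis i 1) = (\<Prod>j\<in>UNIV. if j = i then z $ i else 1)"
    unfolding mpow_def by (rule prod.cong) (auto simp: axis_def)
  then show ?thesis by simp
qed

lemma mpow_const: "mpow (\<chi> i. c) R = c ^ mabs R"
  by (simp add: mpow_def mabs_def power_sum)

lemma mpow_at_zero: "mpow (0 :: 'a::comm_semiring_1 ^ 'k::finite) R = (if R = 0 then 1 else 0)"
proof (cases "R = 0")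
  case False
  then obtain i where "R $ i \<noteq> 0" by (auto simp: vec_eq_iff)
  then have "mpow (0 :: 'a ^ 'k) R = 0" unfolding mpow_def
    by (intro prod_zero bexI[of _ i]) (auto simp: power_0_left)
  then show ?thesis using False by simp
qed simp

lemma mpow_scale: "mpow (\<chi> i. c i * z i) R = mpow (\<chi> i. c i) R * mpow (\<chi> i. z i) R"
  by (simp add: mpow_def power_mult_distrib prod.distrib)

lemma mpow_of_real: "mpow (\<chi> i. of_real (x $ i)) R = (of_real (mpow x R) :: 'a::{real_algebra_1,comm_semiring_1})"
  by (simp add: mpow_def of_real_prod)

lemma norm_mpow_le:
  fixes z :: "complex ^ 'k::finite"
  assumes "\<And>i. cmod (z $ i) \<le> r"
  shows "cmod (mpow z R) \<le> r ^ mabs R"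
proof -
  have "cmod (mpow z R) = (\<Prod>i\<in>UNIV. cmod (z $ i) ^ (R $ i))"
    by (simp add: mpow_def prod_norm[symmetric] norm_power)
  also have "\<dots> \<le> (\<Prod>i\<in>UNIV. r ^ (R $ i))"
    by (intro prod_mono) (auto intro: power_mono assms)
  finally show ?thesis by (simp add: mabs_def power_sum)
qed

lemma mfact_zero [simp]: "mfact 0 = 1"
  by (simp add: mfact_def)

lemma mfact_pos [simp]: "mfact R > 0"
  by (simp add: mfact_def)

lemma mfact_neq_0 [simp]: "mfact R \<noteq> 0"
  using mfact_pos[of R] by linarith

lemma mfact_axis [simp]: "mfact (axis i 1) = 1"
proof -
  have "mfact (axis i 1) = (\<Prod>j\<in>(UNIV :: 'a set). 1)"
    unfolding mfact_def by (rule prod.cong) (auto simp: axis_def)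
  then show ?thesis by simp
qed

lemma bij_betw_atMost_mindex:
  "bij_betw vec_nth {..R :: 'k::finite mindex} (PiE UNIV (\<lambda>i. {..R $ i}))"
proof (rule bij_betwI[where g = "\<lambda>f. \<chi> i. f i"])
  show "vec_nth \<in> {..R} \<rightarrow> PiE UNIV (\<lambda>i. {..R $ i})" by (auto simp: less_eq_vec_def)
  show "(\<lambda>f. \<chi> i. f i) \<in> PiE UNIV (\<lambda>i. {..R $ i}) \<rightarrow> {..R}"
    by (auto simp: less_eq_vec_def PiE_iff)
qed (auto simp: vec_eq_iff)

lemma finite_atMost_mindex [simp]: "finite {..R :: 'k::finite mindex}"
  using bij_betw_finite[OF bij_betw_atMost_mindex[of R]] by (simp add: finite_PiE)

text \<open>The set \<open>{..R}\<close> is a box, so sums of products over it factor; multivariate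
  identities reduce to one variable.\<close>

lemma prod_sum_atMost_mindex:
  fixes f :: "'k::finite \<Rightarrow> nat \<Rightarrow> 'a::comm_semiring_1"
  shows "(\<Sum>I\<in>{..R :: 'k mindex}. \<Prod>i\<in>UNIV. f i (I $ i)) = (\<Prod>i\<in>UNIV. \<Sum>k\<le>R $ i. f i k)"
proof -
  have "(\<Sum>I\<in>{..R}. \<Prod>i\<in>UNIV. f i (I $ i)) = (\<Sum>g\<in>PiE UNIV (\<lambda>i. {..R $ i}). \<Prod>i\<in>UNIV. f i (g i))"
    by (rule sum.reindex_bij_betw[OF bij_betw_atMost_mindex])
  then show ?thesis by (subst prod_sum_PiE) auto
qed

text \<open>The multivariate binomial theorem with equal variables, which evaluates the inner sums
  of the seminorm recursion on geometric bounds.\<close>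

lemma mbinomial_sum:
  fixes a :: "'a::comm_semiring_1"
  shows "(\<Sum>I\<in>{..R :: 'k::finite mindex}. of_nat (mbinom R I) * a ^ mabs I) = (1 + a) ^ mabs R"
proof -
  have "(\<Sum>I\<in>{..R}. of_nat (mbinom R I) * a ^ mabs I)
      = (\<Sum>I\<in>{..R}. \<Prod>i\<in>UNIV. of_nat (R $ i choose I $ i) * a ^ (I $ i))"
    by (simp add: mbinom_def mabs_def power_sum prod.distrib)
  also have "\<dots> = (\<Prod>i\<in>UNIV. (1 + a) ^ (R $ i))"
    by (subst prod_sum_atMost_mindex) (simp add: binomial_ring add.commute[of 1])
  finally show ?thesis by (simp add: mabs_def power_sum)
qed

text \<open>With divided powers the binomial theorem becomes a convolution without coefficients
  (\<open>mterm_add\<close>).\<close>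

definition mterm :: "'a::field_char_0 ^ 'k::finite \<Rightarrow> 'k mindex \<Rightarrow> 'a"
  where "mterm x K = mpow x K / of_nat (mfact K)"

lemma mterm_zero_index [simp]: "mterm x 0 = 1"
  by (simp add: mterm_def)

lemma mterm_axis [simp]: "mterm x (axis i 1) = x $ i"
  by (simp add: mterm_def del: One_nat_def)

lemma mterm_add: "(\<Sum>I\<in>{..K}. mterm x I * mterm y (K - I)) = mterm (x + y) K"
proof -
  have one: "(\<Sum>k\<le>n. a ^ k / fact k * (b ^ (n - k) / fact (n - k))) = (a + b) ^ n / fact n"
    for a b :: 'a and n
    by (simp add: binomial_ring sum_divide_distrib binomial_fact field_simps cong: sum.cong_simp)
  have prod: "mterm z K = (\<Prod>i\<in>UNIV. (z $ i) ^ (K $ i) / fact (K $ i))" for z :: "'a ^ 'b" and K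
    by (simp add: mterm_def mpow_def mfact_def prod_dividef)
  have "(\<Sum>I\<in>{..K}. mterm x I * mterm y (K - I))
      = (\<Sum>I\<in>{..K}. \<Prod>i\<in>UNIV. (x $ i) ^ (I $ i) / fact (I $ i) * ((y $ i) ^ (K $ i - I $ i) / fact (K $ i - I $ i)))"
    by (simp add: prod flip: prod.distrib)
  also have "\<dots> = (\<Prod>i\<in>UNIV. (x $ i + y $ i) ^ (K $ i) / fact (K $ i))"
    by (subst prod_sum_atMost_mindex) (simp only: one)
  finally show ?thesis by (simp add: prod)
qed

lemma cmod_mterm_le:
  assumes "\<And>i. cmod (z $ i) \<le> r"
  shows "cmod (mterm z K) \<le> r ^ mabs K / mfact K"
  using norm_mpow_le[OF assms, of K] by (simp add: mterm_def norm_divide divide_right_mono)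

text \<open>Every finite set of multiindices lies in a box, over which the sum is a product of
  partial sums in one variable.\<close>

lemma summable_on_prod_mindex:
  fixes g :: "nat \<Rightarrow> real"
  assumes "\<And>n. 0 \<le> g n" "summable g"
  shows "(\<lambda>K :: 'k::finite mindex. \<Prod>i\<in>UNIV. g (K $ i)) summable_on UNIV"
proof (rule nonneg_bdd_above_summable_on)
  show "bdd_above (sum (\<lambda>K :: 'k mindex. \<Prod>i\<in>UNIV. g (K $ i)) ` {F. F \<subseteq> UNIV \<and> finite F})"
  proof (rule bdd_aboveI2)
    fix F :: "'k mindex set" assume "F \<in> {F. F \<subseteq> UNIV \<and> finite F}"
    then have F: "finite F" by simp
    \<comment> \<open>Entries are natural numbers, so the sum of all members dominates each of
      them.\<close>
    define R :: "'k mindex" where "R = (\<Sum>K\<in>F. K)"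
    have "K \<le> R" if "K \<in> F" for K
      unfolding less_eq_vec_def R_def sum_component using that F by (auto intro: member_le_sum)
    then have "(\<Sum>K\<in>F. \<Prod>i\<in>UNIV. g (K $ i)) \<le> (\<Sum>K\<in>{..R}. \<Prod>i\<in>UNIV. g (K $ i))"
      using assms(1) by (intro sum_mono2) (auto intro: prod_nonneg)
    also have "\<dots> = (\<Prod>i\<in>UNIV. \<Sum>k\<le>R $ i. g k)" by (rule prod_sum_atMost_mindex)
    also have "\<dots> \<le> (\<Prod>i\<in>(UNIV :: 'k set). suminf g)"
      using assms by (intro prod_mono conjI sum_nonneg sum_le_suminf) auto
    finally show "(\<Sum>K\<in>F. \<Prod>i\<in>UNIV. g (K $ i)) \<le> suminf g ^ CARD('k)" by simp
  qed
qed (use assms in \<open>auto intro: prod_nonneg\<close>)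

lemma summable_on_mterm_const:
  fixes r :: real
  assumes "0 \<le> r"
  shows "(\<lambda>K :: 'k::finite mindex. r ^ mabs K / mfact K) summable_on UNIV"
proof -
  have "(\<lambda>K :: 'k mindex. \<Prod>i\<in>UNIV. r ^ (K $ i) / fact (K $ i)) summable_on UNIV"
    using assms summable_exp[of r] by (intro summable_on_prod_mindex) (auto simp: field_simps)
  then show ?thesis by (simp add: prod_dividef mfact_def mabs_def power_sum)
qed

lemma summable_on_power_mabs:
  fixes r :: real
  assumes "0 \<le> r" "r < 1"
  shows "(\<lambda>K :: 'k::finite mindex. r ^ mabs K) summable_on UNIV"
proof -
  have "(\<lambda>K :: 'k mindex. \<Prod>i\<in>UNIV. r ^ (K $ i)) summable_on UNIV"
    using assms by (intro summable_on_prod_mindex) (auto intro: summable_geometric)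
  then show ?thesis by (simp add: mabs_def power_sum)
qed

lemma has_sum_fibres:
  fixes f :: "'a \<Rightarrow> complex"
  assumes "(f has_sum s) UNIV"
  shows "((\<lambda>y. infsum f {x. \<phi> x = y}) has_sum s) UNIV"
proof -
  have *: "((\<lambda>(y, x). f x) has_sum s) (Sigma UNIV (\<lambda>y. {x. \<phi> x = y}))"
    using assms by (subst has_sum_reindex_bij_witness[where i = "\<lambda>x. (\<phi> x, x)" and j = snd
          and h = f and T = UNIV and s' = s]) auto
  have "(f has_sum infsum f {x. \<phi> x = y}) {x. \<phi> x = y}" for y
    using summable_on_subset_banach[OF has_sum_imp_summable[OF assms], of "{x. \<phi> x = y}"] by simp
  then show ?thesis by (intro has_sum_SigmaD[OF *]) auto
qed

text \<open>Coefficients are normalised as derivatives at the centre, so that differentiation and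
  recentring act on them by shifts.\<close>

definition egf :: "('k::finite mindex \<Rightarrow> complex) \<Rightarrow> complex ^ 'k \<Rightarrow> complex"
  where "egf a x = (\<Sum>\<^sub>\<infinity>K. a K * mterm x K)"

text \<open>Absolute convergence at the corner \<open>(r, ..., r)\<close>, which dominates every
  point of the closed polydisc of polyradius \<open>r\<close>.\<close>

definition egf_summable :: "('k::finite mindex \<Rightarrow> complex) \<Rightarrow> real \<Rightarrow> bool"
  where "egf_summable a r \<longleftrightarrow> (\<lambda>K. cmod (a K) * (r ^ mabs K / mfact K)) summable_on UNIV"

definition shift :: "'k::finite mindex \<Rightarrow> ('k mindex \<Rightarrow> complex) \<Rightarrow> 'k mindex \<Rightarrow> complex"
  where "shift I a = (\<lambda>K. a (I + K))"

lemma shift_zero [simp]: "shift 0 a = a"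
  by (simp add: shift_def)

lemma shift_shift: "shift I (shift J a) = shift (I + J) a"
  by (simp add: shift_def add_ac fun_eq_iff)

lemma egf_summable_abs_summable:
  assumes "egf_summable a r" "\<And>i. cmod (x $ i) \<le> r"
  shows "(\<lambda>K. cmod (a K * mterm x K)) summable_on UNIV"
  using assms(1) unfolding egf_summable_def
proof (rule summable_on_comparison_test)
  show "cmod (a K * mterm x K) \<le> cmod (a K) * (r ^ mabs K / mfact K)" for K
    unfolding norm_mult by (intro mult_left_mono cmod_mterm_le assms(2)) auto
qed auto

lemma egf_summable_has_sum:
  assumes "egf_summable a r" "\<And>i. cmod (x $ i) \<le> r"
  shows "((\<lambda>K. a K * mterm x K) has_sum egf a x) UNIV"
  unfolding egf_def using abs_summable_summable[OF egf_summable_abs_summable[OF assms]] by simp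

lemma egf_summable_mono:
  assumes "egf_summable a r" "0 \<le> s" "s \<le> r"
  shows "egf_summable a s"
  using assms(1) unfolding egf_summable_def
  by (rule summable_on_comparison_test)
    (use assms in \<open>auto intro!: mult_left_mono divide_right_mono power_mono\<close>)

lemma egf_at_zero: "egf a 0 = a 0"
proof -
  have "((\<lambda>K. a K * mterm 0 K) has_sum a 0) UNIV"
    by (rule has_sum_finite_neutralI[of "{0}"]) (auto simp: mterm_def mpow_at_zero)
  then show ?thesis by (simp add: egf_def infsumI)
qed

section \<open>Double series and recentring\<close>

lemma bij_betw_mindex_pairs:
  "bij_betw (\<lambda>(I, M). (I + M, I)) UNIV (Sigma UNIV (\<lambda>K :: 'k::finite mindex. {..K}))"
  by (rule bij_betwI[where g = "\<lambda>(K, I). (I, K - I)"])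
    (auto simp: less_eq_vec_def vec_eq_iff)

text \<open>By the binomial theorem for constant vectors, the terms with \<open>I + M = K\<close>
  add up to the \<open>K\<close>-th term at radius \<open>s + t\<close>. This nonnegative double
  series is the majorant for all rearrangements below.\<close>

lemma egf_summable_pair_summable:
  assumes a: "egf_summable a (s + t)" and "0 \<le> s" "0 \<le> t"
  shows "(\<lambda>(I, M). cmod (a (I + M)) * (s ^ mabs I / mfact I) * (t ^ mabs M / mfact M)) summable_on UNIV"
proof -
  define h where "h = (\<lambda>(K, I). cmod (a K) * (mterm (\<chi> i. s) I * mterm (\<chi> i. t) (K - I)))"
  have "h summable_on Sigma UNIV (\<lambda>K. {..K})"
  proof (rule summable_on_SigmaI)
    show "((\<lambda>I. h (K, I)) has_sum cmod (a K) * mterm (\<chi> i. s + t) K) {..K}" for K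
      using mterm_add[where x = "\<chi> i. s" and y = "\<chi> i. t" and K = K]
      by (intro has_sum_finiteI) (auto simp: h_def sum_distrib_left[symmetric] plus_vec_def)
    show "(\<lambda>K. cmod (a K) * mterm (\<chi> i. s + t) K) summable_on UNIV"
      using a by (simp add: egf_summable_def mterm_def mpow_const)
  qed (use assms in \<open>auto simp: h_def mterm_def mpow_const\<close>)
  then have "(\<lambda>x. h (case x of (I, M) \<Rightarrow> (I + M, I))) summable_on UNIV"
    by (subst summable_on_reindex_bij_betw[OF bij_betw_mindex_pairs])
  then show ?thesis
    by (simp add: h_def case_prod_unfold mterm_def mpow_const mult.assoc)
qed

text \<open>Row \<open>I\<close> of the majorant with \<open>s = r - t\<close> is the majorant of
  the shifted series times a factor that is positive because \<open>t < r\<close>.\<close>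

lemma egf_summable_shift_pos:
  assumes a: "egf_summable a r" and st: "0 \<le> t" "t < r"
  shows "egf_summable (shift I a) t"
proof -
  have "(\<lambda>(I, M). cmod (a (I + M)) * ((r - t) ^ mabs I / mfact I) * (t ^ mabs M / mfact M)) summable_on (Sigma UNIV (\<lambda>_. UNIV))"
    using egf_summable_pair_summable[of a "r - t" t] assms by simp
  from summable_on_SigmaD1[OF this, of I]
  have "(\<lambda>M. ((r - t) ^ mabs I / mfact I) * (cmod (a (I + M)) * (t ^ mabs M / mfact M))) summable_on UNIV"
    by (simp add: mult_ac)
  then show ?thesis
    using st unfolding egf_summable_def shift_def
    by (subst (asm) summable_on_cmult_right') auto
qed

text \<open>The double series is summed along \<open>I + M = K\<close>, where the binomial theorem
  restores the powers of \<open>x + y\<close>; domination by the majorant leaves the order of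
  summation free.\<close>

lemma egf_summable_add:
  assumes a: "egf_summable a (s + t)" and st: "0 \<le> s" "0 \<le> t"
    and x: "\<And>i. cmod (x $ i) \<le> s" and y: "\<And>i. cmod (y $ i) \<le> t"
  shows "((\<lambda>(I, M). a (I + M) * mterm x I * mterm y M) has_sum egf a (x + y)) UNIV"
proof -
  define h where "h = (\<lambda>(K, I). a K * (mterm x I * mterm y (K - I)))"
  have "(\<lambda>p. cmod (h (case p of (I, M) \<Rightarrow> (I + M, I)))) summable_on UNIV"
    using egf_summable_pair_summable[OF a st]
  proof (rule summable_on_comparison_test)
    fix p :: "'a mindex \<times> 'a mindex"
    obtain I M where p: "p = (I, M)" by (cases p)
    have "cmod (mterm x I) * cmod (mterm y M) \<le> (s ^ mabs I / mfact I) * (t ^ mabs M / mfact M)"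
      using st by (intro mult_mono cmod_mterm_le x y) auto
    then have "cmod (a (I + M)) * (cmod (mterm x I) * cmod (mterm y M))
        \<le> cmod (a (I + M)) * ((s ^ mabs I / mfact I) * (t ^ mabs M / mfact M))"
      by (rule mult_left_mono) simp
    then show "cmod (h (case p of (I, M) \<Rightarrow> (I + M, I)))
      \<le> (case p of (I, M) \<Rightarrow> cmod (a (I + M)) * (s ^ mabs I / mfact I) * (t ^ mabs M / mfact M))"
      by (simp add: p h_def norm_mult mult.assoc)
  qed auto
  then have sm: "h summable_on Sigma UNIV (\<lambda>K. {..K})"
    by (subst summable_on_reindex_bij_betw[OF bij_betw_mindex_pairs, symmetric]) (rule abs_summable_summable)
  have "(h has_sum egf a (x + y)) (Sigma UNIV (\<lambda>K. {..K}))"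
  proof (rule has_sum_SigmaI[OF _ _ sm])
    show "((\<lambda>I. h (K, I)) has_sum a K * mterm (x + y) K) {..K}" for K
      by (intro has_sum_finiteI) (auto simp: h_def sum_distrib_left[symmetric] mterm_add)
    have "cmod ((x + y) $ i) \<le> s + t" for i
      using x[of i] y[of i] norm_triangle_ineq[of "x $ i" "y $ i"] by simp
    then show "((\<lambda>K. a K * mterm (x + y) K) has_sum egf a (x + y)) UNIV"
      by (rule egf_summable_has_sum[OF a])
  qed
  then have "((\<lambda>x. h (case x of (I, M) \<Rightarrow> (I + M, I))) has_sum egf a (x + y)) UNIV"
    by (subst has_sum_reindex_bij_betw[OF bij_betw_mindex_pairs])
  then show ?thesis
    by (simp add: h_def case_prod_unfold mult.assoc)
qed

text \<open>The same double series, summed over \<open>M\<close> first. The new coefficients are the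
  shifted series at \<open>y\<close>, that is, the derivatives at the new centre.\<close>

lemma egf_summable_recentre:
  assumes a: "egf_summable a (s + t)" and st: "0 < s" "0 \<le> t" and y: "\<And>i. cmod (y $ i) \<le> t"
  shows "egf_summable (\<lambda>I. egf (shift I a) y) s"
    and "(\<And>i. cmod (x $ i) \<le> s) \<Longrightarrow> egf a (x + y) = egf (\<lambda>I. egf (shift I a) y) x"
proof -
  have sh: "egf_summable (shift I a) t" for I using egf_summable_shift_pos[OF a] st by simp
  have "(\<lambda>(I, M). cmod (a (I + M)) * (s ^ mabs I / mfact I) * (t ^ mabs M / mfact M)) summable_on Sigma UNIV (\<lambda>_. UNIV)"
    using egf_summable_pair_summable[of a s t] a st by simp
  then have "(\<lambda>I. \<Sum>\<^sub>\<infinity>M. cmod (a (I + M)) * (s ^ mabs I / mfact I) * (t ^ mabs M / mfact M)) summable_on UNIV"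
    using summable_on_Sigma_banach by force
  then have "(\<lambda>I. (\<Sum>\<^sub>\<infinity>M. cmod (a (I + M)) * (t ^ mabs M / mfact M)) * (s ^ mabs I / mfact I)) summable_on UNIV"
    by (subst infsum_cmult_left'[symmetric]) (simp add: mult_ac)
  then show "egf_summable (\<lambda>I. egf (shift I a) y) s"
    unfolding egf_summable_def
  proof (rule summable_on_comparison_test)
    fix I
    have "cmod (egf (shift I a) y) \<le> (\<Sum>\<^sub>\<infinity>M. cmod (shift I a M * mterm y M))"
      unfolding egf_def by (rule norm_infsum_bound[OF egf_summable_abs_summable[OF sh y]])
    also have "\<dots> \<le> (\<Sum>\<^sub>\<infinity>M. cmod (a (I + M)) * (t ^ mabs M / mfact M))"
    proof (rule infsum_mono)
      show "(\<lambda>M. cmod (shift I a M * mterm y M)) summable_on UNIV"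
        by (rule egf_summable_abs_summable[OF sh y])
      show "(\<lambda>M. cmod (a (I + M)) * (t ^ mabs M / mfact M)) summable_on UNIV"
        using sh[of I] by (simp add: egf_summable_def shift_def)
        show "cmod (shift I a M * mterm y M) \<le> cmod (a (I + M)) * (t ^ mabs M / mfact M)" for M
        unfolding norm_mult shift_def by (intro mult_left_mono cmod_mterm_le y) auto
    qed
    finally show "cmod (egf (shift I a) y) * (s ^ mabs I / mfact I)
        \<le> (\<Sum>\<^sub>\<infinity>M. cmod (a (I + M)) * (t ^ mabs M / mfact M)) * (s ^ mabs I / mfact I)"
      using st by (intro mult_right_mono) auto
  qed (use st in auto)
  assume x: "\<And>i. cmod (x $ i) \<le> s"
  have "((\<lambda>(I, M). a (I + M) * mterm x I * mterm y M) has_sum egf a (x + y)) (Sigma UNIV (\<lambda>_. UNIV))"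
    using egf_summable_add[OF a _ st(2) x y] st by simp
  then have "((\<lambda>I. mterm x I * egf (shift I a) y) has_sum egf a (x + y)) UNIV"
  proof (rule has_sum_SigmaD)
    fix I
    have "((\<lambda>M. mterm x I * (shift I a M * mterm y M)) has_sum mterm x I * egf (shift I a) y) UNIV"
      by (intro has_sum_cmult_right egf_summable_has_sum[OF sh y])
    then show "((\<lambda>M. case (I, M) of (I, M) \<Rightarrow> a (I + M) * mterm x I * mterm y M) has_sum mterm x I * egf (shift I a) y) UNIV"
      by (simp add: shift_def mult_ac)
  qed
  then show "egf a (x + y) = egf (\<lambda>I. egf (shift I a) y) x"
    unfolding egf_def[of "\<lambda>I. egf (shift I a) y"] by (simp add: infsumI mult.commute)
qed

section \<open>Termwise differentiation\<close>

text \<open>A term of degree at least two is at most \<open>(norm x / r)\<^sup>2\<close> times its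
  majorant at radius \<open>r\<close>, so the remainder after the linear part is quadratic in
  \<open>norm x\<close>.\<close>

lemma has_derivative_egf_at_zero:
  assumes a: "egf_summable a r" and r: "0 < r"
  shows "(egf a has_derivative (\<lambda>h. \<Sum>i\<in>UNIV. a (axis i 1) * h $ i)) (at 0)"
proof -
  define B where "B = (\<Sum>\<^sub>\<infinity>K. cmod (a K) * (r ^ mabs K / mfact K))"
  have bl: "bounded_linear (\<lambda>h. \<Sum>i\<in>UNIV. a (axis i 1) * h $ i)"
    by (intro bounded_linear_sum bounded_linear_mult_right[THEN bounded_linear_compose] bounded_linear_vec_nth)
  have bound: "cmod (egf a x - egf a 0 - (\<Sum>i\<in>UNIV. a (axis i 1) * x $ i)) \<le> B / r\<^sup>2 * (norm x)\<^sup>2"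
    if x: "norm x \<le> r" for x
  proof -
    have xi: "cmod (x $ i) \<le> norm x" for i by (rule Finite_Cartesian_Product.norm_nth_le)
    then have xr: "cmod (x $ i) \<le> r" for i using x order_trans by blast
    \<comment> \<open>The indices of degree at most one, which carry the constant and the linear
      part.\<close>
    define L where "L = insert 0 (range (\<lambda>i. axis i 1 :: 'a mindex))"
    have inj: "inj (\<lambda>i. axis i 1 :: 'a mindex)" by (auto simp: inj_on_def axis_eq_axis)
    have "0 \<notin> range (\<lambda>i. axis i 1 :: 'a mindex)" using mabs_axis mabs_zero by (metis imageE zero_neq_one)
    then have "(\<Sum>K\<in>L. a K * mterm x K) = a 0 + (\<Sum>i\<in>UNIV. a (axis i 1) * x $ i)"
      by (simp add: L_def sum.reindex[OF inj] del: One_nat_def)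
    then have hs: "((\<lambda>K. a K * mterm x K) has_sum (egf a x - (a 0 + (\<Sum>i\<in>UNIV. a (axis i 1) * x $ i)))) (UNIV - L)"
      by (intro has_sum_Diff[OF egf_summable_has_sum[OF a xr]] has_sum_finiteI) (auto simp: L_def)
    have sm: "(\<lambda>K. cmod (a K * mterm x K)) summable_on UNIV - L"
      using egf_summable_abs_summable[OF a xr] by (rule summable_on_subset_banach) auto
    have "cmod (egf a x - (a 0 + (\<Sum>i\<in>UNIV. a (axis i 1) * x $ i)))
        \<le> (\<Sum>\<^sub>\<infinity>K\<in>UNIV - L. cmod (a K * mterm x K))"
      using norm_infsum_bound[OF sm] unfolding infsumI[OF hs] .
    also have "\<dots> \<le> (\<Sum>\<^sub>\<infinity>K\<in>UNIV. (norm x / r)\<^sup>2 * (cmod (a K) * (r ^ mabs K / mfact K)))"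
    proof (rule infsum_mono_neutral)
      show "(\<lambda>K. cmod (a K * mterm x K)) summable_on UNIV - L" by (rule sm)
      show "(\<lambda>K. (norm x / r)\<^sup>2 * (cmod (a K) * (r ^ mabs K / mfact K))) summable_on UNIV"
        using a unfolding egf_summable_def by (rule summable_on_cmult_right)
    next
      fix K assume "K \<in> (UNIV - L) \<inter> UNIV"
      then have "mabs K \<noteq> 0" "mabs K \<noteq> 1" using mabs_eq_1D[of K] by (auto simp: L_def mabs_eq_0_iff)
      then obtain n where n: "mabs K = 2 + n" by (metis One_nat_def Suc_1 add_2_eq_Suc less_2_cases linorder_not_less nat_le_iff_add)
      have "norm x ^ mabs K = (norm x)\<^sup>2 * norm x ^ n" unfolding n by (rule power_add)
      also have "\<dots> \<le> (norm x)\<^sup>2 * r ^ n" using x by (intro mult_left_mono power_mono) auto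
      also have "\<dots> = (norm x / r)\<^sup>2 * r ^ mabs K"
        unfolding n power_add power_divide using r by simp
      finally have "norm x ^ mabs K / mfact K \<le> (norm x / r)\<^sup>2 * (r ^ mabs K / mfact K)"
        by (simp add: divide_right_mono)
      then have "cmod (mterm x K) \<le> (norm x / r)\<^sup>2 * (r ^ mabs K / mfact K)"
        using cmod_mterm_le[of x "norm x" K] xi by simp
      then have "cmod (a K) * cmod (mterm x K) \<le> cmod (a K) * ((norm x / r)\<^sup>2 * (r ^ mabs K / mfact K))"
        by (rule mult_left_mono) simp
      then show "cmod (a K * mterm x K) \<le> (norm x / r)\<^sup>2 * (cmod (a K) * (r ^ mabs K / mfact K))"
        by (simp add: norm_mult mult_ac)
    qed (use r in auto)
    also have "\<dots> = B / r\<^sup>2 * (norm x)\<^sup>2"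
      unfolding B_def infsum_cmult_right' by (simp add: power_divide)
    finally show ?thesis by (simp add: egf_at_zero diff_diff_eq)
  qed
  show ?thesis
    unfolding has_derivative_at
  proof (intro conjI bl)
    show "(\<lambda>h. norm (egf a (0 + h) - egf a 0 - (\<Sum>i\<in>UNIV. a (axis i 1) * h $ i)) / norm h) \<midarrow>0\<rightarrow> 0"
    proof (rule Lim_null_comparison)
      have "\<forall>\<^sub>F h in at (0 :: complex ^ 'a). norm h < r"
        using r by (auto simp: eventually_at intro!: exI[of _ r])
      then show "\<forall>\<^sub>F h in at 0. norm (norm (egf a (0 + h) - egf a 0 - (\<Sum>i\<in>UNIV. a (axis i 1) * h $ i)) / norm h)
          \<le> B / r\<^sup>2 * norm h"
      proof eventually_elim
        case (elim h)
        then show ?case using bound[of h] by (cases "h = 0") (auto simp: divide_simps power2_eq_square)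
      qed
      show "((\<lambda>h. B / r\<^sup>2 * norm h) \<longlongrightarrow> 0) (at (0 :: complex ^ 'a))"
        by (intro tendsto_mult_right_zero tendsto_norm_zero tendsto_ident_at)
    qed
  qed
qed

lemma has_derivative_egf:
  assumes a: "egf_summable a r" and y: "\<And>i. cmod (y $ i) < r"
  shows "(egf a has_derivative (\<lambda>h. \<Sum>i\<in>UNIV. egf (shift (axis i 1) a) y * h $ i)) (at y)"
proof -
  \<comment> \<open>Finitely many coordinates below \<open>r\<close> have a common bound
    \<open>t < r\<close>; the gap \<open>s\<close> is a radius available around \<open>y\<close>,
    which becomes the new centre.\<close>
  define t where "t = Max (range (\<lambda>i. cmod (y $ i)))"
  have yt: "cmod (y $ i) \<le> t" for i unfolding t_def by (rule Max_ge) auto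
  have tr: "t < r" unfolding t_def using y by (subst Max_less_iff) auto
  have t0: "0 \<le> t" using yt[of undefined] norm_ge_zero order_trans by blast
  define s where "s = r - t"
  have s: "0 < s" "egf_summable a (s + t)" using tr a by (auto simp: s_def)
  define b where "b = (\<lambda>I. egf (shift I a) y)"
  have b: "egf_summable b s" unfolding b_def by (rule egf_summable_recentre(1)[OF s(2,1) t0 yt])
  have "((\<lambda>z. z - y) has_derivative (\<lambda>h. h)) (at y)" by (auto intro!: derivative_eq_intros)
  moreover have "(egf b has_derivative (\<lambda>h. \<Sum>i\<in>UNIV. b (axis i 1) * h $ i)) (at (y - y))"
    using has_derivative_egf_at_zero[OF b s(1)] by simp
  ultimately have "((\<lambda>z. egf b (z - y)) has_derivative (\<lambda>h. \<Sum>i\<in>UNIV. b (axis i 1) * h $ i)) (at y)"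
    by (rule has_derivative_compose)
  then have "(egf a has_derivative (\<lambda>h. \<Sum>i\<in>UNIV. b (axis i 1) * h $ i)) (at y)"
  proof (rule has_derivative_transform_within_open)
    show "open (ball y s)" "y \<in> ball y s" using s(1) by auto
    fix z assume z: "z \<in> ball y s"
    have "cmod ((z - y) $ i) \<le> s" for i
      using z Finite_Cartesian_Product.norm_nth_le[of "z - y" i] by (simp add: dist_norm norm_minus_commute)
    from egf_summable_recentre(2)[OF s(2,1) t0 yt this] show "egf b (z - y) = egf a z" by (simp add: b_def)
  qed
  then show ?thesis by (simp add: b_def)
qed

section \<open>Smooth functions and Wirtinger derivatives\<close>

lemma mindex_induct [case_names zero add_axis]:
  fixes R :: "'k::finite mindex"
  assumes "P 0" and "\<And>R j. P R \<Longrightarrow> P (R + axis j 1)"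
  shows "P R"
proof (induction "mabs R" arbitrary: R)
  case 0
  then show ?case using assms(1) mabs_eq_0_iff[of R] by simp
next
  case (Suc n)
  then obtain j where j: "R $ j \<noteq> 0" by (metis mabs_eq_0_iff nat.distinct(1) vec_eq_iff zero_index)
  have R: "R = (R - axis j 1) + axis j 1" using j by (auto simp: vec_eq_iff axis_def)
  have "n = mabs (R - axis j 1)" using Suc.hyps(2) by (subst (asm) R) (simp add: mabs_add del: One_nat_def)
  then have "P (R - axis j 1)" by (rule Suc.hyps(1))
  then show ?case using assms(2)[of "R - axis j 1" j] R by simp
qed

lemma axis_Basis_complex [simp]: "axis j 1 \<in> (Basis :: (complex ^ 'n::finite) set)"
  "axis j \<i> \<in> (Basis :: (complex ^ 'n::finite) set)"
  by (auto simp: Basis_vec_def Basis_complex_def)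

lemma Basis_complex_cases:
  assumes "b \<in> (Basis :: (complex ^ 'n::finite) set)"
  obtains j where "b = axis j 1" | j where "b = axis j \<i>"
  using assms by (auto simp: Basis_vec_def Basis_complex_def)

lemma pdiff_eq: "(f has_derivative D) (at z) \<Longrightarrow> pdiff b f z = D b"
  unfolding pdiff_def using frechet_derivative_at[of f D z] by simp

lemma pdiff_lincomb:
  assumes "f differentiable at z" "g differentiable at z"
  shows "pdiff b (\<lambda>z. c * f z + d * g z) z = c * pdiff b f z + d * pdiff b g z"
proof -
  have "((\<lambda>z. c * f z + d * g z) has_derivative
      (\<lambda>h. c * frechet_derivative f (at z) h + d * frechet_derivative g (at z) h)) (at z)"
    using assms unfolding frechet_derivative_works by (intro has_derivative_add has_derivative_mult_right)
  then show ?thesis using pdiff_eq by (fastforce simp: pdiff_def)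
qed

lemma smooth_differentiable: "smooth f \<Longrightarrow> f differentiable at z"
  unfolding smooth_def by (metis foldr_Nil id_apply lists.Nil)

lemma smooth_isCont: "smooth f \<Longrightarrow> isCont f z"
  by (rule differentiable_imp_continuous_within[OF smooth_differentiable])

lemma smooth_pdiff:
  fixes f :: "complex ^ 'n::finite \<Rightarrow> complex"
  shows "smooth f \<Longrightarrow> b \<in> Basis \<Longrightarrow> smooth (pdiff b f)"
  unfolding smooth_def
proof (intro ballI allI)
  fix bs :: "(complex ^ 'n) list" and z
  assume *: "\<forall>bs\<in>lists Basis. \<forall>z. foldr pdiff bs f differentiable at z" "b \<in> Basis" "bs \<in> lists Basis"
  then have "bs @ [b] \<in> lists Basis" by auto
  then have "foldr pdiff (bs @ [b]) f differentiable at z" using * by blast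
  then show "foldr pdiff bs (pdiff b f) differentiable at z" by simp
qed

lemma smoothI:
  assumes "P f" "\<And>f. P f \<Longrightarrow> \<forall>z. f differentiable at z" "\<And>f b. P f \<Longrightarrow> b \<in> Basis \<Longrightarrow> P (pdiff b f)"
  shows "smooth f"
proof -
  have "P (foldr pdiff bs f)" if "bs \<in> lists Basis" for bs
    using that by (induction bs) (auto intro: assms)
  then show ?thesis using assms(2) by (auto simp: smooth_def)
qed

lemma foldr_pdiff_lincomb:
  assumes "smooth f" "smooth g" "bs \<in> lists Basis"
  shows "foldr pdiff bs (\<lambda>z. c * f z + d * g z) = (\<lambda>z. c * foldr pdiff bs f z + d * foldr pdiff bs g z)"
  using assms(3)
proof (induction bs)
  case (Cons b bs)
  have "foldr pdiff bs f differentiable at z" "foldr pdiff bs g differentiable at z" for z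
    using assms Cons unfolding smooth_def by auto
  then show ?case using Cons by (auto simp: pdiff_lincomb)
qed simp

lemma smooth_lincomb:
  assumes "smooth f" "smooth g"
  shows "smooth (\<lambda>z. c * f z + d * g z)"
  unfolding smooth_def
proof (intro ballI allI)
  fix bs z assume bs: "bs \<in> lists (Basis :: (complex ^ 'a) set)"
  have "foldr pdiff bs f differentiable at z" "foldr pdiff bs g differentiable at z"
    using assms bs unfolding smooth_def by auto
  then show "foldr pdiff bs (\<lambda>z. c * f z + d * g z) differentiable at z"
    by (simp add: foldr_pdiff_lincomb[OF assms bs])
qed

section \<open>Symmetry of second derivatives\<close>

text \<open>Schwarz's argument: the second difference over the parallelogram spanned by
  \<open>h b\<close> and \<open>h c\<close> is \<open>h\<^sup>2\<close> times either mixed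
  derivative at some interior point, and continuity at \<open>z\<close> compares the two as
  \<open>h\<close> shrinks.\<close>

lemma mixed_partials_real:
  fixes u :: "'a::real_normed_vector \<Rightarrow> real"
  assumes ub: "\<And>z. ((\<lambda>t. u (z + t *\<^sub>R b)) has_real_derivative ub z) (at 0)"
    and uc: "\<And>z. ((\<lambda>t. u (z + t *\<^sub>R c)) has_real_derivative uc z) (at 0)"
    and ubc: "\<And>z. ((\<lambda>t. ub (z + t *\<^sub>R c)) has_real_derivative ubc z) (at 0)"
    and ucb: "\<And>z. ((\<lambda>t. uc (z + t *\<^sub>R b)) has_real_derivative ucb z) (at 0)"
    and cont: "isCont ubc z" "isCont ucb z"
  shows "ubc z = ucb z"
proof -
  have line: "((\<lambda>t. v (w + t *\<^sub>R e)) has_real_derivative v' (w + t *\<^sub>R e)) (at t)"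
    if "\<And>z. ((\<lambda>t. v (z + t *\<^sub>R e)) has_real_derivative v' z) (at 0)" for v v' :: "'a \<Rightarrow> real" and e w t
  proof -
    have "((\<lambda>s. v ((w + t *\<^sub>R e) + s *\<^sub>R e)) has_real_derivative v' (w + t *\<^sub>R e)) (at (t - t))"
      using that by simp
    then have "((\<lambda>x. v ((w + t *\<^sub>R e) + (x - t) *\<^sub>R e)) has_real_derivative v' (w + t *\<^sub>R e)) (at t)"
      using DERIV_shift[of "\<lambda>s. v ((w + t *\<^sub>R e) + s *\<^sub>R e)" _ t "-t"] by simp
    then show ?thesis by (simp add: scaleR_diff_left)
  qed
  \<comment> \<open>Two applications of the mean value theorem. The directions are kept general
    because the statement is used in both orders.\<close>
  have key: "\<exists>s t. 0 < s \<and> s < h \<and> 0 < t \<and> t < h \<and>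
      u (z + h *\<^sub>R b + h *\<^sub>R c) - u (z + h *\<^sub>R b) - u (z + h *\<^sub>R c) + u z = h * h * vbc (z + s *\<^sub>R b + t *\<^sub>R c)"
    if h: "0 < h" and vb: "\<And>z. ((\<lambda>t. u (z + t *\<^sub>R b)) has_real_derivative vb z) (at 0)"
      and vbc: "\<And>z. ((\<lambda>t. vb (z + t *\<^sub>R c)) has_real_derivative vbc z) (at 0)"
    for h b c and vb vbc :: "'a \<Rightarrow> real"
  proof -
    have "\<exists>s. 0 < s \<and> s < h \<and> (u ((z + h *\<^sub>R c) + h *\<^sub>R b) - u (z + h *\<^sub>R b)) - (u ((z + h *\<^sub>R c) + 0 *\<^sub>R b) - u (z + 0 *\<^sub>R b))
        = (h - 0) * (vb ((z + h *\<^sub>R c) + s *\<^sub>R b) - vb (z + s *\<^sub>R b))"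
      using h by (intro MVT2 DERIV_diff line[OF vb])
    then obtain s where s: "0 < s" "s < h"
      "u (z + h *\<^sub>R b + h *\<^sub>R c) - u (z + h *\<^sub>R b) - u (z + h *\<^sub>R c) + u z
        = h * (vb ((z + s *\<^sub>R b) + h *\<^sub>R c) - vb ((z + s *\<^sub>R b) + 0 *\<^sub>R c))" by (auto simp: add_ac)
    have "\<exists>t. 0 < t \<and> t < h \<and> vb ((z + s *\<^sub>R b) + h *\<^sub>R c) - vb ((z + s *\<^sub>R b) + 0 *\<^sub>R c)
        = (h - 0) * vbc ((z + s *\<^sub>R b) + t *\<^sub>R c)"
      using h by (intro MVT2 line[OF vbc])
    then show ?thesis using s by (auto simp: mult.assoc)
  qed
  have "\<bar>ubc z - ucb z\<bar> \<le> e" if e: "0 < e" for e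
  proof -
    obtain d1 where d1: "0 < d1" "\<And>w. dist w z < d1 \<Longrightarrow> dist (ubc w) (ubc z) < e / 2"
      using cont(1) e unfolding continuous_at_eps_delta by (meson half_gt_zero)
    obtain d2 where d2: "0 < d2" "\<And>w. dist w z < d2 \<Longrightarrow> dist (ucb w) (ucb z) < e / 2"
      using cont(2) e unfolding continuous_at_eps_delta by (meson half_gt_zero)
    define N where "N = norm b + norm c + 1"
    have N: "0 < N" by (simp add: N_def add_nonneg_pos)
    define h where "h = min d1 d2 / (2 * N)"
    have h: "0 < h" using d1 d2 N by (simp add: h_def)
    have near: "dist (z + s *\<^sub>R b + t *\<^sub>R c) z < min d1 d2" if "0 < s" "s < h" "0 < t" "t < h" for s t
    proof -
      have "dist (z + s *\<^sub>R b + t *\<^sub>R c) z = norm (s *\<^sub>R b + t *\<^sub>R c)" by (simp add: dist_norm)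
      also have "\<dots> \<le> s * norm b + t * norm c" using that norm_triangle_ineq[of "s *\<^sub>R b" "t *\<^sub>R c"] by simp
      also have "\<dots> \<le> h * norm b + h * norm c" using that by (intro add_mono mult_right_mono) auto
      also have "\<dots> \<le> h * N" using h by (simp add: N_def algebra_simps)
      also have "\<dots> = min d1 d2 / 2" using N by (simp add: h_def)
      also have "\<dots> < min d1 d2" using d1(1) d2(1) by (simp add: min_def)
      finally show ?thesis .
    qed
    obtain s t where st: "0 < s" "s < h" "0 < t" "t < h"
      "u (z + h *\<^sub>R b + h *\<^sub>R c) - u (z + h *\<^sub>R b) - u (z + h *\<^sub>R c) + u z = h * h * ubc (z + s *\<^sub>R b + t *\<^sub>R c)"
      using key[OF h ub ubc] by blast
    obtain s' t' where st': "0 < s'" "s' < h" "0 < t'" "t' < h"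
      "u (z + h *\<^sub>R c + h *\<^sub>R b) - u (z + h *\<^sub>R c) - u (z + h *\<^sub>R b) + u z = h * h * ucb (z + s' *\<^sub>R c + t' *\<^sub>R b)"
      using key[OF h uc ucb] by blast
    have "h * h * ubc (z + s *\<^sub>R b + t *\<^sub>R c) = h * h * ucb (z + t' *\<^sub>R b + s' *\<^sub>R c)"
    proof -
      have *: "z + h *\<^sub>R c + h *\<^sub>R b = z + h *\<^sub>R b + h *\<^sub>R c"
        "z + s' *\<^sub>R c + t' *\<^sub>R b = z + t' *\<^sub>R b + s' *\<^sub>R c" by (simp_all add: add_ac)
      show ?thesis using st(5) st'(5)[unfolded *] by linarith
    qed
    then have "ubc (z + s *\<^sub>R b + t *\<^sub>R c) = ucb (z + t' *\<^sub>R b + s' *\<^sub>R c)" using h by simp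
    moreover have "dist (ubc (z + s *\<^sub>R b + t *\<^sub>R c)) (ubc z) < e / 2" using d1(2) near st by simp
    moreover have "dist (ucb (z + t' *\<^sub>R b + s' *\<^sub>R c)) (ucb z) < e / 2" using d2(2) near st' by simp
    ultimately show ?thesis unfolding dist_real_def by linarith
  qed
  then show ?thesis using field_le_epsilon[of "\<bar>ubc z - ucb z\<bar>" 0] by simp
qed

lemma smooth_directional:
  assumes "smooth f"
  shows "((\<lambda>t. f (z + t *\<^sub>R b)) has_vector_derivative pdiff b f z) (at 0)"
proof -
  have "((\<lambda>t::real. z + t *\<^sub>R b) has_derivative (\<lambda>t. t *\<^sub>R b)) (at 0)"
    by (auto intro!: derivative_eq_intros)
  moreover have D: "(f has_derivative frechet_derivative f (at z)) (at (z + 0 *\<^sub>R b))"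
    using smooth_differentiable[OF assms, of z] by (simp add: frechet_derivative_works)
  ultimately have "((\<lambda>t. f (z + t *\<^sub>R b)) has_derivative (\<lambda>t. frechet_derivative f (at z) (t *\<^sub>R b))) (at 0)"
    by (rule has_derivative_compose)
  moreover have "linear (frechet_derivative f (at z))" using D has_derivative_linear by blast
  ultimately show ?thesis by (simp add: has_vector_derivative_def pdiff_def linear_cmul)
qed

text \<open>Real and imaginary parts are treated separately, since the mean value theorem fails for
  complex values.\<close>

lemma pdiff_commute:
  assumes f: "smooth f" and b: "b \<in> Basis" and c: "c \<in> Basis"
  shows "pdiff b (pdiff c f) = pdiff c (pdiff b f)"
proof
  fix z
  note sm = smooth_pdiff[OF f b] smooth_pdiff[OF f c]
  note sm2 = smooth_pdiff[OF sm(1) c] smooth_pdiff[OF sm(2) b]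
  have re: "((\<lambda>t. Re (g (z + t *\<^sub>R b))) has_real_derivative Re (pdiff b g z)) (at 0)"
    "((\<lambda>t. Im (g (z + t *\<^sub>R b))) has_real_derivative Im (pdiff b g z)) (at 0)" if "smooth g" for g z b
    using bounded_linear.has_vector_derivative[OF bounded_linear_Re smooth_directional[OF that]]
      bounded_linear.has_vector_derivative[OF bounded_linear_Im smooth_directional[OF that]]
    by (auto simp: has_real_derivative_iff_has_vector_derivative)
  have "Re (pdiff c (pdiff b f) z) = Re (pdiff b (pdiff c f) z)"
    using re(1)[OF f] re(1)[OF sm(1)] re(1)[OF sm(2)] smooth_isCont[OF sm2(1)] smooth_isCont[OF sm2(2)]
    by (intro mixed_partials_real[where u = "\<lambda>z. Re (f z)" and b = b and c = c
          and ub = "\<lambda>z. Re (pdiff b f z)" and uc = "\<lambda>z. Re (pdiff c f z)"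
          and ubc = "\<lambda>z. Re (pdiff c (pdiff b f) z)" and ucb = "\<lambda>z. Re (pdiff b (pdiff c f) z)"]
        isCont_Re) auto
  moreover have "Im (pdiff c (pdiff b f) z) = Im (pdiff b (pdiff c f) z)"
    using re(2)[OF f] re(2)[OF sm(1)] re(2)[OF sm(2)] smooth_isCont[OF sm2(1)] smooth_isCont[OF sm2(2)]
    by (intro mixed_partials_real[where u = "\<lambda>z. Im (f z)" and b = b and c = c
          and ub = "\<lambda>z. Im (pdiff b f z)" and uc = "\<lambda>z. Im (pdiff c f z)"
          and ubc = "\<lambda>z. Im (pdiff c (pdiff b f) z)" and ucb = "\<lambda>z. Im (pdiff b (pdiff c f) z)"]
        isCont_Im) auto
  ultimately show "pdiff b (pdiff c f) z = pdiff c (pdiff b f) z" by (simp add: complex_eq_iff)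
qed

section \<open>Iterated derivatives for commuting families\<close>

text \<open>\<open>iter_deriv\<close> follows an arbitrary enumeration of the coordinates;
  commutation on an invariant set \<open>S\<close> makes the result insensitive to it. The instances
  take the smooth functions for \<open>S\<close>.\<close>

locale commuting_derivations =
  fixes S :: "(complex ^ 'n::finite \<Rightarrow> complex) set"
    and D :: "'n \<Rightarrow> (complex ^ 'n \<Rightarrow> complex) \<Rightarrow> complex ^ 'n \<Rightarrow> complex"
  assumes closed: "f \<in> S \<Longrightarrow> D j f \<in> S"
    and commute: "f \<in> S \<Longrightarrow> D i (D j f) = D j (D i f)"
begin

lemma closed_funpow: "f \<in> S \<Longrightarrow> (D j ^^ n) f \<in> S"
  by (induction n) (auto intro: closed)

lemma closed_foldr: "f \<in> S \<Longrightarrow> foldr (\<lambda>j. D j ^^ (R $ j)) js f \<in> S"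
  by (induction js) (auto intro: closed_funpow)

lemma closed_iter: "f \<in> S \<Longrightarrow> iter_deriv D R f \<in> S"
  unfolding iter_deriv_def by (rule closed_foldr)

lemma iter_zero: "iter_deriv D 0 f = f"
proof -
  have "foldr (\<lambda>j. D j ^^ ((0 :: 'n mindex) $ j)) js f = f" for js by (induction js) auto
  then show ?thesis by (simp add: iter_deriv_def)
qed

text \<open>\<open>E\<close> may also belong to another family of operators, so that holomorphic and
  antiholomorphic derivatives can be exchanged.\<close>

lemma funpow_commute:
  assumes "f \<in> S" "\<And>f. f \<in> S \<Longrightarrow> E (D j f) = D j (E f)"
  shows "(D j ^^ n) (E f) = E ((D j ^^ n) f)"
  by (induction n) (auto simp: assms closed_funpow)

lemma foldr_commute:
  assumes "f \<in> S" "\<And>f j. f \<in> S \<Longrightarrow> E (D j f) = D j (E f)"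
  shows "foldr (\<lambda>j. D j ^^ (R $ j)) js (E f) = E (foldr (\<lambda>j. D j ^^ (R $ j)) js f)"
  by (induction js) (auto simp: assms funpow_commute closed_foldr)

lemma iter_commute:
  assumes "f \<in> S" "\<And>f j. f \<in> S \<Longrightarrow> E (D j f) = D j (E f)"
  shows "iter_deriv D R (E f) = E (iter_deriv D R f)"
  unfolding iter_deriv_def by (rule foldr_commute[OF assms])

text \<open>The additional derivative occurs where \<open>j\<close> stands in the enumeration,
  exactly once as the list is distinct, and is commuted outwards past the operators before
  it.\<close>

lemma iter_add_axis:
  assumes f: "f \<in> S"
  shows "iter_deriv D (R + axis j 1) f = D j (iter_deriv D R f)"
proof -
  have notin: "foldr (\<lambda>j. D j ^^ ((R + axis i 1) $ j)) js f = foldr (\<lambda>j. D j ^^ (R $ j)) js f"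
    if "i \<notin> set js" for i js
    using that by (induction js) (auto simp: axis_def)
  have "foldr (\<lambda>j. D j ^^ ((R + axis i 1) $ j)) js f = D i (foldr (\<lambda>j. D j ^^ (R $ j)) js f)"
    if "distinct js" "i \<in> set js" for i js
    using that
  proof (induction js)
    case (Cons j js)
    show ?case
    proof (cases "i = j")
      case True
      then show ?thesis using Cons.prems notin[of j js] by (simp add: axis_def)
    next
      case False
      then have "foldr (\<lambda>j. D j ^^ ((R + axis i 1) $ j)) (j # js) f
          = (D j ^^ (R $ j)) (D i (foldr (\<lambda>j. D j ^^ (R $ j)) js f))"
        using Cons by (simp add: axis_def)
      also have "\<dots> = D i ((D j ^^ (R $ j)) (foldr (\<lambda>j. D j ^^ (R $ j)) js f))"
        by (rule funpow_commute) (auto intro: commute closed_foldr f)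
      finally show ?thesis by simp
    qed
  qed simp
  moreover have "\<exists>js. distinct js \<and> set js = (UNIV :: 'n set)"
    using finite_distinct_list[of "UNIV :: 'n set"] by auto
  note someI_ex[OF this]
  ultimately show ?thesis unfolding iter_deriv_def by auto
qed

end

section \<open>Wirtinger operators\<close>

lemma wirt_lincomb: "wirt j f = (\<lambda>z. (1/2) * pdiff (axis j 1) f z + (-\<i>/2) * pdiff (axis j \<i>) f z)"
  by (auto simp: wirt_def diff_divide_distrib)

lemma wirt_bar_lincomb: "wirt_bar j f = (\<lambda>z. (1/2) * pdiff (axis j 1) f z + (\<i>/2) * pdiff (axis j \<i>) f z)"
  by (auto simp: wirt_bar_def add_divide_distrib)

lemma smooth_wirt: "smooth f \<Longrightarrow> smooth (wirt j f)"
  unfolding wirt_lincomb by (intro smooth_lincomb smooth_pdiff) auto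

lemma smooth_wirt_bar: "smooth f \<Longrightarrow> smooth (wirt_bar j f)"
  unfolding wirt_bar_lincomb by (intro smooth_lincomb smooth_pdiff) auto

text \<open>General coefficients let all three commutation rules for Wirtinger operators be
  instances.\<close>

lemma pdiff_lincomb_commute:
  assumes "smooth f" "{b, b', d, d'} \<subseteq> Basis"
  shows "(\<lambda>z. c * pdiff b (\<lambda>z. e * pdiff d f z + e' * pdiff d' f z) z
      + c' * pdiff b' (\<lambda>z. e * pdiff d f z + e' * pdiff d' f z) z)
    = (\<lambda>z. e * pdiff d (\<lambda>z. c * pdiff b f z + c' * pdiff b' f z) z
      + e' * pdiff d' (\<lambda>z. c * pdiff b f z + c' * pdiff b' f z) z)"
proof -
  have l: "pdiff x (\<lambda>z. k * pdiff y f z + k' * pdiff y' f z) z = k * pdiff x (pdiff y f) z + k' * pdiff x (pdiff y' f) z"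
    if "y \<in> Basis" "y' \<in> Basis" for x y y' k k' z
    using that assms by (intro pdiff_lincomb smooth_differentiable smooth_pdiff)
  have "pdiff x (pdiff y f) = pdiff y (pdiff x f)" if "x \<in> Basis" "y \<in> Basis" for x y
    using pdiff_commute[OF assms(1)] that by blast
  note c = this[of b d] this[of b d'] this[of b' d] this[of b' d']
  show ?thesis using assms(2) by (intro ext) (simp add: l c algebra_simps)
qed

lemma wirt_commute: "smooth f \<Longrightarrow> wirt i (wirt j f) = wirt j (wirt i f)"
  unfolding wirt_lincomb by (rule pdiff_lincomb_commute) auto

lemma wirt_bar_commute: "smooth f \<Longrightarrow> wirt_bar i (wirt_bar j f) = wirt_bar j (wirt_bar i f)"
  unfolding wirt_bar_lincomb by (rule pdiff_lincomb_commute) auto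

lemma wirt_wirt_bar_commute: "smooth f \<Longrightarrow> wirt i (wirt_bar j f) = wirt_bar j (wirt i f)"
  unfolding wirt_lincomb wirt_bar_lincomb by (rule pdiff_lincomb_commute) auto

interpretation wirt: commuting_derivations "Collect smooth" wirt
  by unfold_locales (auto intro: smooth_wirt wirt_commute)

interpretation wirt_bar: commuting_derivations "Collect smooth" wirt_bar
  by unfold_locales (auto intro: smooth_wirt_bar wirt_bar_commute)

lemma wirtinger_zero: "wirtinger 0 0 f = f"
  by (simp add: wirtinger_def wirt.iter_zero wirt_bar.iter_zero)

lemma smooth_wirtinger: "smooth f \<Longrightarrow> smooth (wirtinger R S f)"
  using wirt.closed_iter[of "iter_deriv wirt_bar S f"] wirt_bar.closed_iter[of f] by (simp add: wirtinger_def)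

lemma wirtinger_add_axis:
  assumes "smooth f"
  shows "wirtinger (R + axis j 1) S f = wirt j (wirtinger R S f)"
  using wirt.iter_add_axis[of "iter_deriv wirt_bar S f"] wirt_bar.closed_iter[of f] assms
  by (simp add: wirtinger_def)

lemma wirtinger_add_axis_bar:
  assumes "smooth f"
  shows "wirtinger R (S + axis j 1) f = wirt_bar j (wirtinger R S f)"
proof -
  have "wirtinger R (S + axis j 1) f = iter_deriv wirt R (wirt_bar j (iter_deriv wirt_bar S f))"
    using wirt_bar.iter_add_axis[of f] assms by (simp add: wirtinger_def)
  also have "\<dots> = wirt_bar j (iter_deriv wirt R (iter_deriv wirt_bar S f))"
    using wirt_bar.closed_iter[of f] assms by (intro wirt.iter_commute) (auto simp: wirt_wirt_bar_commute)
  finally show ?thesis by (simp add: wirtinger_def)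
qed

lemma wirtinger_induct [consumes 1, case_names zero wirt wirt_bar]:
  assumes "smooth f" and "P 0 0 f"
    and "\<And>R S g j. smooth g \<Longrightarrow> P R S g \<Longrightarrow> P (R + axis j 1) S (wirt j g)"
    and "\<And>R S g j. smooth g \<Longrightarrow> P R S g \<Longrightarrow> P R (S + axis j 1) (wirt_bar j g)"
  shows "P R S (wirtinger R S f)"
proof (induction R rule: mindex_induct)
  case zero
  show ?case
  proof (induction S rule: mindex_induct)
    case zero
    then show ?case using assms by (simp add: wirtinger_zero)
  next
    case (add_axis S j)
    then show ?case
      unfolding wirtinger_add_axis_bar[OF assms(1)] by (intro assms(4) smooth_wirtinger assms(1))
  qed
next
  case (add_axis R j)
  then show ?case
    unfolding wirtinger_add_axis[OF assms(1)] by (intro assms(3) smooth_wirtinger assms(1))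
qed

lemma wirt_of_lincomb:
  assumes "smooth f" "smooth g"
  shows "wirt j (\<lambda>z. c * f z + d * g z) = (\<lambda>z. c * wirt j f z + d * wirt j g z)"
  using assms by (intro ext) (simp add: wirt_def pdiff_lincomb smooth_differentiable field_simps)

lemma wirt_bar_of_lincomb:
  assumes "smooth f" "smooth g"
  shows "wirt_bar j (\<lambda>z. c * f z + d * g z) = (\<lambda>z. c * wirt_bar j f z + d * wirt_bar j g z)"
  using assms by (intro ext) (simp add: wirt_bar_def pdiff_lincomb smooth_differentiable field_simps)

lemma wirtinger_lincomb:
  assumes f: "smooth f" and g: "smooth g"
  shows "wirtinger R S (\<lambda>z. c * f z + d * g z) = (\<lambda>z. c * wirtinger R S f z + d * wirtinger R S g z)"
proof -
  note sm = smooth_lincomb[OF f g, of c d]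
  show ?thesis
  proof (induction R rule: mindex_induct)
    case zero
    show ?case
    proof (induction S rule: mindex_induct)
      case (add_axis S j)
      then show ?case
        by (simp add: wirtinger_add_axis_bar f g sm wirt_bar_of_lincomb smooth_wirtinger del: One_nat_def)
    qed (simp add: wirtinger_zero)
  next
    case (add_axis R j)
    then show ?case by (simp add: wirtinger_add_axis f g sm wirt_of_lincomb smooth_wirtinger del: One_nat_def)
  qed
qed

section \<open>Flatness in terms of Wirtinger derivatives\<close>

lemma flat_at_pdiff:
  assumes "f \<in> flat_at p" "b \<in> Basis"
  shows "pdiff b f \<in> flat_at p"
proof -
  have "foldr pdiff bs (pdiff b f) p = 0" if "bs \<in> lists Basis" for bs
  proof -
    have "bs @ [b] \<in> lists Basis" using assms that by auto
    then have "foldr pdiff (bs @ [b]) f p = 0" using assms unfolding flat_at_def by blast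
    then show ?thesis by simp
  qed
  then show ?thesis using assms smooth_pdiff by (auto simp: flat_at_def)
qed

lemma flat_at_lincomb: "f \<in> flat_at p \<Longrightarrow> g \<in> flat_at p \<Longrightarrow> (\<lambda>z. c * f z + d * g z) \<in> flat_at p"
  by (auto simp: flat_at_def smooth_lincomb foldr_pdiff_lincomb)

lemma flat_at_value: "f \<in> flat_at p \<Longrightarrow> f p = 0"
  unfolding flat_at_def by (auto dest: bspec[of _ _ "[]"])

text \<open>Real partial and Wirtinger derivatives are linear combinations of each other. For the
  converse the innermost partial derivative is peeled off: the jets of \<open>wirt j f\<close> and
  \<open>wirt_bar j f\<close> are shifted jets of \<open>f\<close>, so vanishing passes to
  \<open>pdiff b f\<close>.\<close>

lemma flat_at_iff_wirtinger:
  assumes "smooth f"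
  shows "f \<in> flat_at p \<longleftrightarrow> (\<forall>R S. wirtinger R S f p = 0)"
proof
  assume f: "f \<in> flat_at p"
  have "wirtinger R S f \<in> flat_at p" for R S
  proof (rule wirtinger_induct[OF assms, where P = "\<lambda>_ _ g. g \<in> flat_at p"])
    show "wirt j g \<in> flat_at p" "wirt_bar j g \<in> flat_at p" if "g \<in> flat_at p" for g j
      unfolding wirt_lincomb wirt_bar_lincomb using that by (intro flat_at_lincomb flat_at_pdiff; simp)+
  qed (rule f)
  then show "\<forall>R S. wirtinger R S f p = 0" using flat_at_value by blast
next
  assume *: "\<forall>R S. wirtinger R S f p = 0"
  have "foldr pdiff bs f p = 0" if "bs \<in> lists Basis" for bs
    using that assms *
  proof (induction bs arbitrary: f rule: rev_induct)
    case Nil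
    then show ?case using wirtinger_zero by (metis foldr_Nil id_apply)
  next
    case (snoc b bs)
    note f = snoc.prems(2)
    have b: "b \<in> Basis" and bs: "bs \<in> lists Basis" using snoc.prems(1) by auto
    have w: "wirtinger R S (wirt j f) p = 0" for R S j
    proof -
      have "wirtinger R S (wirt j f) = wirtinger (R + axis j 1) S f"
      proof -
        have "iter_deriv wirt_bar S (wirt j f) = wirt j (iter_deriv wirt_bar S f)"
          using f by (intro wirt_bar.iter_commute) (auto simp: wirt_wirt_bar_commute)
        moreover have "iter_deriv wirt R (wirt j (iter_deriv wirt_bar S f)) = wirt j (iter_deriv wirt R (iter_deriv wirt_bar S f))"
          using wirt_bar.closed_iter[of f] f by (intro wirt.iter_commute) (auto simp: wirt_commute)
        ultimately show ?thesis using wirtinger_add_axis[OF f] by (simp add: wirtinger_def)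
      qed
      then show ?thesis using snoc.prems by simp
    qed
    have w': "wirtinger R S (wirt_bar j f) p = 0" for R S j
    proof -
      have "iter_deriv wirt_bar S (wirt_bar j f) = wirt_bar j (iter_deriv wirt_bar S f)"
        using f by (intro wirt_bar.iter_commute) (auto simp: wirt_bar_commute)
      then have "wirtinger R S (wirt_bar j f) = wirtinger R (S + axis j 1) f"
        using wirt_bar.iter_add_axis[of f] f by (simp add: wirtinger_def)
      then show ?thesis using snoc.prems by simp
    qed
    have "wirtinger R S (pdiff b f) p = 0" for R S
      using b
    proof (cases rule: Basis_complex_cases)
      case (1 j)
      have "pdiff b f = (\<lambda>z. 1 * wirt j f z + 1 * wirt_bar j f z)"
        by (auto simp: 1 wirt_def wirt_bar_def field_simps)
      then show ?thesis using wirtinger_lincomb[OF smooth_wirt[OF f] smooth_wirt_bar[OF f], of R S 1 j 1 j] w w' by simp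
    next
      case (2 j)
      have "pdiff b f = (\<lambda>z. \<i> * wirt j f z + (- \<i>) * wirt_bar j f z)"
        by (auto simp: 2 wirt_def wirt_bar_def field_simps)
      then show ?thesis using wirtinger_lincomb[OF smooth_wirt[OF f] smooth_wirt_bar[OF f], of R S \<i> j "- \<i>" j] w w' by simp
    qed
    then show ?case using snoc.IH[OF bs smooth_pdiff[OF f b]] by simp
  qed
  then show "f \<in> flat_at p" using assms by (auto simp: flat_at_def)
qed

section \<open>Real-analytic functions\<close>

definition vjoin :: "'a ^ 'n::finite \<Rightarrow> 'a ^ 'm::finite \<Rightarrow> 'a ^ ('n + 'm)"
  where "vjoin u v = (\<chi> i. case i of Inl j \<Rightarrow> u $ j | Inr j \<Rightarrow> v $ j)"

lemma vjoin_component [simp]: "vjoin u v $ Inl i = u $ i" "vjoin u v $ Inr j = v $ j"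
  by (simp_all add: vjoin_def)

lemma vjoin_eq_iff: "vjoin u v = x \<longleftrightarrow> (\<forall>i. u $ i = x $ Inl i) \<and> (\<forall>j. v $ j = x $ Inr j)"
  by (auto simp: vec_eq_iff vjoin_def split: sum.split)

lemma vjoin_inject [simp]: "vjoin u v = vjoin u' v' \<longleftrightarrow> u = u' \<and> v = v'"
  unfolding vjoin_eq_iff by (simp add: vec_eq_iff)

lemma vjoin_add: "vjoin u v + vjoin u' v' = vjoin (u + u') (v + v')"
  by (rule sym) (simp add: vjoin_eq_iff)

lemma vjoin_zero [simp]: "vjoin 0 0 = 0"
  by (simp add: vjoin_eq_iff)

lemma vjoin_axis: "vjoin (axis j n) 0 = axis (Inl j) n" "vjoin 0 (axis j n) = axis (Inr j) n"
  by (auto simp: vjoin_eq_iff axis_def)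

lemma bij_vjoin: "bij_betw (\<lambda>(K, L). vjoin K L) UNIV UNIV"
  by (rule bij_betwI[where g = "\<lambda>K. (\<chi> j. K $ Inl j, \<chi> j. K $ Inr j)"])
    (auto simp: vjoin_eq_iff)

lemma vjoin_cases: obtains u v where "x = vjoin u v"
  using that[of "\<chi> j. x $ Inl j" "\<chi> j. x $ Inr j"] vjoin_eq_iff[of _ _ x] by (metis vec_lambda_beta)

lemma prod_sum_type: "(\<Prod>i\<in>(UNIV :: ('n::finite + 'm::finite) set). g i) = (\<Prod>j\<in>UNIV. g (Inl j)) * (\<Prod>j\<in>UNIV. g (Inr j))"
  by (subst UNIV_Plus_UNIV[symmetric], subst prod.Plus) (auto simp: o_def)

lemma sum_sum_type: "(\<Sum>i\<in>(UNIV :: ('n::finite + 'm::finite) set). g i) = (\<Sum>j\<in>UNIV. g (Inl j)) + (\<Sum>j\<in>UNIV. g (Inr j))"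
  by (subst UNIV_Plus_UNIV[symmetric], subst sum.Plus) (auto simp: o_def)

lemma mpow_vjoin: "mpow (vjoin u v) (vjoin K L) = mpow u K * mpow v L"
  by (simp add: mpow_def prod_sum_type)

lemma mfact_vjoin: "mfact (vjoin K L) = mfact K * mfact L"
  by (simp add: mfact_def prod_sum_type)

lemma mabs_vjoin: "mabs (vjoin K L) = mabs K + mabs L"
  by (simp add: mabs_def sum_sum_type)

text \<open>A function on \<open>\<complex>\<^sup>n\<close> is expanded either in the real coordinates \<open>(x, y)\<close> or in
  \<open>(z, cnj z)\<close>; both are power series in \<open>2 n\<close> complex variables, evaluated at the following vectors.\<close>

definition real_coords :: "complex ^ 'n::finite \<Rightarrow> complex ^ ('n + 'n)"
  where "real_coords h = vjoin (\<chi> j. of_real (Re (h $ j))) (\<chi> j. of_real (Im (h $ j)))"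

definition cnj_coords :: "complex ^ 'n::finite \<Rightarrow> complex ^ ('n + 'n)"
  where "cnj_coords h = vjoin h (\<chi> j. cnj (h $ j))"

lemma real_coords_bound: "cmod (real_coords h $ i) \<le> norm h"
proof -
  have "cmod (real_coords h $ i) \<le> cmod (h $ (case i of Inl j \<Rightarrow> j | Inr j \<Rightarrow> j))"
    by (cases i) (auto simp: real_coords_def abs_Re_le_cmod abs_Im_le_cmod)
  also have "\<dots> \<le> norm h" by (rule Finite_Cartesian_Product.norm_nth_le)
  finally show ?thesis .
qed

lemma linear_real_coords: "linear real_coords"
  by (rule linearI) (auto simp: real_coords_def vec_eq_iff vjoin_def complex_eq_iff split: sum.split)

lemma linear_cnj_coords: "linear cnj_coords"
  by (rule linearI) (auto simp: cnj_coords_def vec_eq_iff vjoin_def complex_eq_iff split: sum.split)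

lemma has_derivative_coords:
  fixes T :: "complex ^ 'n::finite \<Rightarrow> complex ^ 'm::finite"
  assumes "linear T"
  shows "((\<lambda>z. T (z - q)) has_derivative T) (at z)"
proof -
  have "bounded_linear T" using assms linear_conv_bounded_linear by blast
  moreover have "((\<lambda>z. z - q) has_derivative (\<lambda>h. h)) (at z)" by (auto intro!: derivative_eq_intros)
  ultimately show ?thesis by (rule bounded_linear.has_derivative)
qed

section \<open>Local power series in real coordinates\<close>

text \<open>Unordered summability in the complex numbers is absolute. Convergence at one point with
  equal positive real coordinates thus yields \<open>egf_summable\<close> on a smaller ball. The
  converse reindexes by \<open>vjoin\<close> and moves the factorials.\<close>

lemma real_analytic_iff_egf:
  "real_analytic f \<longleftrightarrow>
    (\<forall>q. \<exists>a e. 0 < e \<and> egf_summable a e \<and> (\<forall>z\<in>ball q e. f z = egf a (real_coords (z - q))))"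
proof -
  have coords: "a * of_real (mpow (\<chi> j. Re (z $ j - q $ j)) K) * of_real (mpow (\<chi> j. Im (z $ j - q $ j)) L)
      = (a * of_nat (mfact (vjoin K L))) * mterm (real_coords (z - q)) (vjoin K L)"
    for a :: complex and z q and K L :: "'a mindex"
    by (simp add: real_coords_def mterm_def mpow_vjoin mpow_of_real[where 'a = complex, symmetric])
  show ?thesis
  proof
    assume f: "real_analytic f"
    show "\<forall>q. \<exists>a e. 0 < e \<and> egf_summable a e \<and> (\<forall>z\<in>ball q e. f z = egf a (real_coords (z - q)))"
    proof
      fix q :: "complex ^ 'a"
      obtain a e where e: "0 < e" and hs: "\<And>z. z \<in> ball q e \<Longrightarrow>
        ((\<lambda>(K, L). a K L * of_real (mpow (\<chi> j. Re (z $ j - q $ j)) K) * of_real (mpow (\<chi> j. Im (z $ j - q $ j)) L)) has_sum f z) UNIV"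
        using f unfolding real_analytic_def by blast
      define b where "b K = a (\<chi> j. K $ Inl j) (\<chi> j. K $ Inr j) * mfact K" for K
      have hs': "((\<lambda>K. b K * mterm (real_coords (z - q)) K) has_sum f z) UNIV" if "z \<in> ball q e" for z
      proof -
        have "((\<lambda>x. (\<lambda>K. b K * mterm (real_coords (z - q)) K) (case x of (K, L) \<Rightarrow> vjoin K L)) has_sum f z) UNIV"
        proof (rule has_sum_cong[THEN iffD1, OF _ hs[OF that]])
          fix x :: "'a mindex \<times> 'a mindex"
          show "(case x of (K, L) \<Rightarrow> a K L * of_real (mpow (\<chi> j. Re (z $ j - q $ j)) K) * of_real (mpow (\<chi> j. Im (z $ j - q $ j)) L))
            = (\<lambda>K. b K * mterm (real_coords (z - q)) K) (case x of (K, L) \<Rightarrow> vjoin K L)"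
            by (cases x) (simp only: prod.case coords b_def vjoin_component vec_nth_inverse vec_lambda_eta)
        qed
        then show ?thesis by (subst (asm) has_sum_reindex_bij_betw[OF bij_vjoin])
      qed
      \<comment> \<open>The displacement of \<open>w\<close> below has \<open>CARD('a)\<close>
        entries of modulus at most \<open>2 * r\<close>, so its norm is at most
        \<open>e / 2\<close>.\<close>
      define r where "r = e / (4 * CARD('a))"
      have r: "0 < r" using e by (simp add: r_def)
      \<comment> \<open>All real coordinates of \<open>w - q\<close> equal \<open>r\<close>:
        convergence at this point is summability at polyradius \<open>r\<close>.\<close>
      define w where "w = q + (\<chi> j. Complex r r)"
      have "norm (\<chi> j. Complex r r :: complex ^ 'a) \<le> (\<Sum>j\<in>(UNIV :: 'a set). cmod ((\<chi> j. Complex r r) $ j))"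
        unfolding norm_vec_def by (rule L2_set_le_sum) auto
      also have "\<dots> \<le> (\<Sum>j\<in>(UNIV :: 'a set). 2 * r)"
        using r cmod_le[of "Complex r r"] by (intro sum_mono) auto
      also have "\<dots> < e" using e by (simp add: r_def)
      finally have w: "w \<in> ball q e" by (simp add: w_def dist_norm)
      have "(\<lambda>K. cmod (b K * mterm (real_coords (w - q)) K)) summable_on UNIV"
        using has_sum_imp_summable[OF hs'[OF w]] by (simp add: summable_on_iff_abs_summable_on_complex)
      moreover have "real_coords (w - q) = (\<chi> i. of_real r)"
        by (auto simp: real_coords_def w_def vjoin_eq_iff)
      ultimately have "egf_summable b r"
        using r by (simp add: egf_summable_def mterm_def mpow_const norm_mult norm_divide norm_power)
      moreover have "r \<le> e"
      proof -
        have "1 \<le> 4 * real CARD('a)" using zero_less_card_finite[where 'a='a] by linarith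
        then show ?thesis using e by (simp add: r_def divide_le_eq)
      qed
      moreover have "f z = egf b (real_coords (z - q))" if "z \<in> ball q e" for z
        using hs'[OF that] by (simp add: egf_def infsumI)
      ultimately show "\<exists>a e. 0 < e \<and> egf_summable a e \<and> (\<forall>z\<in>ball q e. f z = egf a (real_coords (z - q)))"
        using r by (intro exI[of _ b] exI[of _ r]) auto
    qed
  next
    assume *: "\<forall>q. \<exists>a e. 0 < e \<and> egf_summable a e \<and> (\<forall>z\<in>ball q e. f z = egf a (real_coords (z - q)))"
    show "real_analytic f"
      unfolding real_analytic_def
    proof
      fix q
      obtain a e where ae: "0 < e" "egf_summable a e" "\<And>z. z \<in> ball q e \<Longrightarrow> f z = egf a (real_coords (z - q))"
        using * by blast
      have "((\<lambda>(K, L). a (vjoin K L) / mfact (vjoin K L) * of_real (mpow (\<chi> j. Re (z $ j - q $ j)) K) * of_real (mpow (\<chi> j. Im (z $ j - q $ j)) L)) has_sum f z) UNIV"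
        if z: "z \<in> ball q e" for z
      proof -
        have "cmod (real_coords (z - q) $ i) \<le> e" for i
          using real_coords_bound[of "z - q" i] z by (simp add: dist_norm norm_minus_commute)
        from egf_summable_has_sum[OF ae(2) this]
        have "((\<lambda>K. a K * mterm (real_coords (z - q)) K) has_sum f z) UNIV" using ae(3)[OF z] by simp
        then have "((\<lambda>x. (\<lambda>K. a K * mterm (real_coords (z - q)) K) (case x of (K, L) \<Rightarrow> vjoin K L)) has_sum f z) UNIV"
          by (subst has_sum_reindex_bij_betw[OF bij_vjoin])
        then show ?thesis
          by (rule has_sum_cong[THEN iffD1, rotated]) (auto simp only: prod.case coords, simp)
      qed
      then show "\<exists>a e. 0 < e \<and> (\<forall>z\<in>ball q e. ((\<lambda>(K, L). a K L * of_real (mpow (\<chi> j. Re (z $ j - q $ j)) K)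
          * of_real (mpow (\<chi> j. Im (z $ j - q $ j)) L)) has_sum f z) UNIV)"
        using ae(1) by (intro exI[of _ "\<lambda>K L. a (vjoin K L) / mfact (vjoin K L)"] exI[of _ e]) auto
    qed
  qed
qed

lemma egf_diff:
  assumes "0 \<le> r" "egf_summable a r" "egf_summable b r"
  shows "egf_summable (\<lambda>K. a K - b K) r"
    and "(\<And>i. cmod (x $ i) \<le> r) \<Longrightarrow> egf (\<lambda>K. a K - b K) x = egf a x - egf b x"
proof -
  show "egf_summable (\<lambda>K. a K - b K) r"
  proof -
    have "(\<lambda>K. cmod (a K) * (r ^ mabs K / mfact K) + cmod (b K) * (r ^ mabs K / mfact K)) summable_on UNIV"
      using assms(2,3) unfolding egf_summable_def by (rule summable_on_add)
    then show ?thesis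
      unfolding egf_summable_def
    proof (rule summable_on_comparison_test)
      show "cmod (a K - b K) * (r ^ mabs K / mfact K)
          \<le> cmod (a K) * (r ^ mabs K / mfact K) + cmod (b K) * (r ^ mabs K / mfact K)" for K
        unfolding distrib_right[symmetric] using assms(1) by (intro mult_right_mono norm_triangle_ineq4) auto
    qed (use assms(1) in auto)
  qed
  assume x: "\<And>i. cmod (x $ i) \<le> r"
  have "((\<lambda>K. a K * mterm x K + - (b K * mterm x K)) has_sum (egf a x + - egf b x)) UNIV"
    by (intro has_sum_add has_sum_uminusI egf_summable_has_sum[OF assms(2) x] egf_summable_has_sum[OF assms(3) x])
  then show "egf (\<lambda>K. a K - b K) x = egf a x - egf b x"
    unfolding egf_def[of "\<lambda>K. a K - b K"] by (simp add: infsumI left_diff_distrib)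
qed

lemma real_analytic_diff:
  assumes "real_analytic f" "real_analytic g"
  shows "real_analytic (\<lambda>z. f z - g z)"
  unfolding real_analytic_iff_egf
proof
  fix q
  obtain a d where a: "0 < d" "egf_summable a d" "\<And>z. z \<in> ball q d \<Longrightarrow> f z = egf a (real_coords (z - q))"
    using assms(1) unfolding real_analytic_iff_egf by blast
  obtain b e where b: "0 < e" "egf_summable b e" "\<And>z. z \<in> ball q e \<Longrightarrow> g z = egf b (real_coords (z - q))"
    using assms(2) unfolding real_analytic_iff_egf by blast
  define r where "r = min d e"
  have r: "0 < r" "r \<le> d" "r \<le> e" using a b by (auto simp: r_def)
  have ps: "egf_summable a r" "egf_summable b r" using egf_summable_mono a b r by force+
  have "f z - g z = egf (\<lambda>K. a K - b K) (real_coords (z - q))" if z: "z \<in> ball q r" for z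
  proof -
    have "cmod (real_coords (z - q) $ i) \<le> r" for i
      using real_coords_bound[of "z - q" i] z by (simp add: dist_norm norm_minus_commute)
    from egf_diff(2)[OF _ ps this] show ?thesis using a(3)[of z] b(3)[of z] z r by simp
  qed
  then show "\<exists>a e. 0 < e \<and> egf_summable a e \<and> (\<forall>z\<in>ball q e. f z - g z = egf a (real_coords (z - q)))"
    using egf_diff(1)[OF _ ps] r by (intro exI[of _ "\<lambda>K. a K - b K"] exI[of _ r]) auto
qed

lemma egf_coords_has_derivative:
  fixes T :: "complex ^ 'n::finite \<Rightarrow> complex ^ 'm::finite"
  assumes "linear T" "egf_summable a e" "\<And>i. cmod (T (z - q) $ i) < e"
  shows "((\<lambda>z. egf a (T (z - q))) has_derivative
    (\<lambda>h. \<Sum>i\<in>UNIV. egf (shift (axis i 1) a) (T (z - q)) * T h $ i)) (at z)"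
  by (rule has_derivative_compose[OF has_derivative_coords[OF assms(1)] has_derivative_egf[OF assms(2,3)]])

lemma real_analytic_local_derivative:
  assumes a: "egf_summable a e" and f: "\<And>z. z \<in> ball q e \<Longrightarrow> f z = egf a (real_coords (z - q))"
    and z: "z \<in> ball q e"
  shows "f differentiable at z"
    and "pdiff (axis j 1) f z = egf (shift (axis (Inl j) 1) a) (real_coords (z - q))"
    and "pdiff (axis j \<i>) f z = egf (shift (axis (Inr j) 1) a) (real_coords (z - q))"
proof -
  have "cmod (real_coords (z - q) $ i) < e" for i
    using real_coords_bound[of "z - q" i] z by (simp add: dist_norm norm_minus_commute)
  from egf_coords_has_derivative[OF linear_real_coords a this]
  have D: "(f has_derivative (\<lambda>h. \<Sum>i\<in>UNIV. egf (shift (axis i 1) a) (real_coords (z - q)) * real_coords h $ i)) (at z)"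
    by (rule has_derivative_transform_within_open[OF _ open_ball z]) (simp add: f)
  then show "f differentiable at z" by (rule differentiableI)
  have single: "(\<Sum>i\<in>UNIV. g i * axis k (1::complex) $ i) = g k" for k and g :: "'a + 'a \<Rightarrow> complex"
    by (simp add: axis_def if_distrib cong: if_cong)
  have "real_coords (axis j 1) = axis (Inl j) 1" "real_coords (axis j \<i>) = axis (Inr j) 1"
    by (auto simp: real_coords_def vjoin_eq_iff axis_def)
  then show "pdiff (axis j 1) f z = egf (shift (axis (Inl j) 1) a) (real_coords (z - q))"
    "pdiff (axis j \<i>) f z = egf (shift (axis (Inr j) 1) a) (real_coords (z - q))"
    using pdiff_eq[OF D] by (simp_all only: single)
qed

lemma real_analytic_differentiable: "real_analytic f \<Longrightarrow> f differentiable at z"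
  unfolding real_analytic_iff_egf using real_analytic_local_derivative(1)[of _ _ z f z] by (metis centre_in_ball)

lemma real_analytic_pdiff:
  assumes f: "real_analytic f" and b: "b \<in> Basis"
  shows "real_analytic (pdiff b f)"
  unfolding real_analytic_iff_egf
proof
  fix q
  obtain a e where e: "0 < e" and a: "egf_summable a e" and fe: "\<And>z. z \<in> ball q e \<Longrightarrow> f z = egf a (real_coords (z - q))"
    using f unfolding real_analytic_iff_egf by blast
  note D = real_analytic_local_derivative(2,3)[OF a fe]
  have "\<exists>i. \<forall>z\<in>ball q e. pdiff b f z = egf (shift (axis i 1) a) (real_coords (z - q))"
    using b by (cases rule: Basis_complex_cases) (auto simp only: D)
  then obtain i where i: "\<And>z. z \<in> ball q e \<Longrightarrow> pdiff b f z = egf (shift (axis i 1) a) (real_coords (z - q))"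
    by blast
  have "egf_summable (shift (axis i 1) a) (e / 2)" using e by (intro egf_summable_shift_pos[OF a]) auto
  then show "\<exists>a e. 0 < e \<and> egf_summable a e \<and> (\<forall>z\<in>ball q e. pdiff b f z = egf a (real_coords (z - q)))"
    using e i by (intro exI[of _ "shift (axis i 1) a"] exI[of _ "e / 2"]) auto
qed

lemma real_analytic_smooth: "real_analytic f \<Longrightarrow> smooth f"
  by (rule smoothI[of real_analytic]) (auto intro: real_analytic_differentiable real_analytic_pdiff)

section \<open>The identity theorem for real-analytic functions\<close>

text \<open>Shifting the coefficients by a unit index corresponds to a partial derivative, which is
  again flat. Hence the induction varies \<open>a\<close>, \<open>f\<close> and also
  \<open>e\<close>, as a shift costs some radius.\<close>

lemma flat_coefficients_zero:
  assumes "0 < e" "egf_summable a e" "\<And>z. z \<in> ball q e \<Longrightarrow> f z = egf a (real_coords (z - q))"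
    and "f \<in> flat_at q"
  shows "a K = 0"
  using assms
proof (induction K arbitrary: a e f rule: mindex_induct)
  case zero
  have "real_coords 0 = (0 :: complex ^ ('a + 'a))" using linear_real_coords by (rule linear_0)
  then have "f q = a 0" using zero.prems(1,3) by (simp add: egf_at_zero)
  then show ?case using flat_at_value[OF zero.prems(4)] by simp
next
  case (add_axis K i)
  note D = real_analytic_local_derivative(2,3)[OF add_axis.prems(2,3)]
  have "shift (axis i 1) a K = 0"
  proof (cases i)
    case (Inl j)
    show ?thesis
    proof (rule add_axis.IH)
      show "egf_summable (shift (axis i 1) a) (e / 2)" using add_axis.prems(1) by (intro egf_summable_shift_pos[OF add_axis.prems(2)]) auto
      show "pdiff (axis j 1) f \<in> flat_at q" by (intro flat_at_pdiff add_axis.prems) auto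
      show "pdiff (axis j 1) f z = egf (shift (axis i 1) a) (real_coords (z - q))" if "z \<in> ball q (e / 2)" for z
        unfolding Inl using that add_axis.prems(1) by (intro D) auto
    qed (use add_axis.prems(1) in auto)
  next
    case (Inr j)
    show ?thesis
    proof (rule add_axis.IH)
      show "egf_summable (shift (axis i 1) a) (e / 2)" using add_axis.prems(1) by (intro egf_summable_shift_pos[OF add_axis.prems(2)]) auto
      show "pdiff (axis j \<i>) f \<in> flat_at q" by (intro flat_at_pdiff add_axis.prems) auto
      show "pdiff (axis j \<i>) f z = egf (shift (axis i 1) a) (real_coords (z - q))" if "z \<in> ball q (e / 2)" for z
        unfolding Inr using that add_axis.prems(1) by (intro D) auto
    qed (use add_axis.prems(1) in auto)
  qed
  then show ?case by (simp add: shift_def add.commute)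
qed

lemma real_analytic_flat_locally_zero:
  assumes "real_analytic f" "f \<in> flat_at q"
  shows "\<exists>e>0. \<forall>z\<in>ball q e. f z = 0"
proof -
  obtain a e where e: "0 < e" and a: "egf_summable a e" and fe: "\<And>z. z \<in> ball q e \<Longrightarrow> f z = egf a (real_coords (z - q))"
    using assms(1) unfolding real_analytic_iff_egf by blast
  have "a = (\<lambda>_. 0)" using flat_coefficients_zero[OF e a fe assms(2)] by blast
  then show ?thesis using e fe by (auto simp: egf_def)
qed

text \<open>Connectedness: the set \<open>S\<close> of points near which \<open>f\<close> vanishes
  is open. By continuity all derivatives vanish on its closure, and there the local series forces
  \<open>f\<close> to vanish nearby, so \<open>S\<close> is closed.\<close>

lemma real_analytic_flat_zero:
  assumes f: "real_analytic f" and p: "f \<in> flat_at p"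
  shows "f = (\<lambda>_. 0)"
proof -
  define S where "S = {q. \<exists>e>0. \<forall>z\<in>ball q e. f z = 0}"
  have "open S"
    unfolding open_contains_ball
  proof
    fix q assume "q \<in> S"
    then obtain e where e: "0 < e" "\<forall>z\<in>ball q e. f z = 0" by (auto simp: S_def)
    have "ball q e \<subseteq> S"
    proof
      fix z assume "z \<in> ball q e"
      then obtain d where "0 < d" "ball z d \<subseteq> ball q e" using openE[OF open_ball] by blast
      then show "z \<in> S" using e by (auto simp: S_def)
    qed
    then show "\<exists>e>0. ball q e \<subseteq> S" using e by blast
  qed
  have deriv_zero: "foldr pdiff bs f z = 0" if "z \<in> S" for bs z
    using that
  proof (induction bs arbitrary: z)
    case Nil
    then show ?case by (auto simp: S_def)
  next
    case (Cons b bs)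
    have "(foldr pdiff bs f has_derivative (\<lambda>_. 0)) (at z)"
      by (rule has_derivative_transform_within_open[OF _ \<open>open S\<close> Cons.prems, where f = "\<lambda>_. 0"])
        (auto simp: Cons.IH)
    then show ?case using pdiff_eq by fastforce
  qed
  have sm: "smooth f" by (rule real_analytic_smooth[OF f])
  have "q \<in> S" if q: "q \<in> closure S" for q
  proof -
    have "foldr pdiff bs f q = 0" if "bs \<in> lists Basis" for bs
    proof -
      have "continuous_on UNIV (foldr pdiff bs f)"
        using sm that unfolding smooth_def
        by (auto intro!: continuous_at_imp_continuous_on differentiable_imp_continuous_within)
      then have "closed {z. foldr pdiff bs f z = 0}" by (intro closed_Collect_eq) auto
      moreover have "S \<subseteq> {z. foldr pdiff bs f z = 0}" using deriv_zero by auto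
      ultimately have "closure S \<subseteq> {z. foldr pdiff bs f z = 0}" by (rule closure_minimal[rotated])
      then show ?thesis using q by auto
    qed
    then have "f \<in> flat_at q" using sm by (simp add: flat_at_def)
    then show ?thesis using real_analytic_flat_locally_zero[OF f] by (simp add: S_def)
  qed
  then have "closed S" using closure_subset_eq by blast
  moreover have "p \<in> S" using real_analytic_flat_locally_zero[OF f p] by (simp add: S_def)
  ultimately have "S = UNIV" using \<open>open S\<close> clopen by blast
  then show ?thesis using deriv_zero[of _ "[]"] by auto
qed

section \<open>Entire series in z and its conjugate\<close>

definition entire_coeffs :: "('k::finite mindex \<Rightarrow> complex) \<Rightarrow> bool"
  where "entire_coeffs a \<longleftrightarrow> (\<forall>r\<ge>0. egf_summable a r)"

lemma entire_coeffs_shift: "entire_coeffs a \<Longrightarrow> entire_coeffs (shift I a)"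
  unfolding entire_coeffs_def
proof (intro allI impI)
  fix r :: real assume "\<forall>r\<ge>0. egf_summable a r" "0 \<le> r"
  then show "egf_summable (shift I a) r" by (intro egf_summable_shift_pos[of a "r + 1"]) auto
qed

lemma entire_coeffs_finite_support:
  assumes "finite {K. a K \<noteq> 0}"
  shows "entire_coeffs a"
  unfolding entire_coeffs_def egf_summable_def
  by (intro allI impI finite_nonzero_values_imp_summable_on finite_subset[OF _ assms]) auto

text \<open>By the inequality of arithmetic and geometric means,
  \<open>\<bar>a K\<bar> r\<^sup>k / K! \<le> \<bar>a K\<bar>\<^sup>2 q\<^sup>k / K! + (r\<^sup>2 / q)\<^sup>k / K!\<close> where \<open>k = \<bar>K\<bar>\<close> and \<open>q = 1 / (2 d)\<close>.\<close>

lemma entire_coeffs_growth: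
  fixes C d :: real
  assumes d: "0 < d" and a: "\<And>K. (cmod (a K))\<^sup>2 \<le> C * d ^ mabs K * mfact K"
  shows "entire_coeffs a"
  unfolding entire_coeffs_def egf_summable_def
proof (intro allI impI)
  fix r :: real assume r: "0 \<le> r"
  \<comment> \<open>With this \<open>q\<close> the hypothesis bounds the first summand by
    \<open>C * (1 / 2) ^ k\<close>; the second is summable for every positive \<open>q\<close>
    because of the factorial.\<close>
  define q where "q = 1 / (2 * d)"
  have q: "0 < q" using d by (simp add: q_def)
  have "(\<lambda>K. C * (1 / 2) ^ mabs K + (r\<^sup>2 / q) ^ mabs K / mfact K) summable_on UNIV"
    using q by (intro summable_on_add summable_on_cmult_right summable_on_power_mabs summable_on_mterm_const) auto
  then show "(\<lambda>K. cmod (a K) * (r ^ mabs K / mfact K)) summable_on UNIV"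
  proof (rule summable_on_comparison_test)
    fix K
    define x where "x = cmod (a K)"
    define k where "k = mabs K"
    have "x * r ^ k \<le> x\<^sup>2 * q ^ k + (r ^ k)\<^sup>2 / q ^ k"
    proof -
      define s where "s = sqrt (q ^ k)"
      have s: "s\<^sup>2 = q ^ k" "0 < s" using q by (auto simp: s_def)
      have "2 * ((x * s) * (r ^ k / s)) \<le> (x * s)\<^sup>2 + (r ^ k / s)\<^sup>2" by (rule sum_squares_bound[of "x * s" "r ^ k / s", simplified mult.assoc[of 2]])
      then have "2 * (x * r ^ k) \<le> x\<^sup>2 * q ^ k + (r ^ k)\<^sup>2 / q ^ k"
        using s by (simp add: power_mult_distrib power_divide)
      moreover have "0 \<le> x * r ^ k" using r by (simp add: x_def)
      ultimately show ?thesis by linarith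
    qed
    then have "x * r ^ k / mfact K \<le> (x\<^sup>2 * q ^ k + (r ^ k)\<^sup>2 / q ^ k) / mfact K"
      by (rule divide_right_mono) simp
    also have "\<dots> = x\<^sup>2 * (q ^ k / mfact K) + (r\<^sup>2 / q) ^ k / mfact K"
      by (simp add: add_divide_distrib power_divide mult.commute flip: power_mult)
    also have "x\<^sup>2 * (q ^ k / mfact K) \<le> (C * d ^ k * mfact K) * (q ^ k / mfact K)"
      using a[of K] q by (intro mult_right_mono) (auto simp: x_def k_def)
    also have "\<dots> = C * (1 / 2) ^ k"
      using d by (simp add: q_def power_divide power_mult_distrib)
    finally show "cmod (a K) * (r ^ mabs K / mfact K) \<le> C * (1 / 2) ^ mabs K + (r\<^sup>2 / q) ^ mabs K / mfact K"
      by (simp add: x_def k_def)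
  qed (use r in auto)
qed

lemma cnj_coords_bound: "cmod (cnj_coords h $ i) \<le> norm h"
  by (cases i) (auto simp: cnj_coords_def Finite_Cartesian_Product.norm_nth_le)

text \<open>The direction \<open>axis j c\<close> moves \<open>z $ j\<close> by \<open>c\<close> and
  its conjugate by \<open>cnj c\<close>. The Wirtinger combinations of \<open>c = 1\<close> and
  \<open>c = \<i>\<close> isolate one of the two shifts.\<close>

lemma wirt_cnj_series:
  assumes a: "entire_coeffs a"
  shows "wirt j (\<lambda>z. egf a (cnj_coords (z - p))) = (\<lambda>z. egf (shift (axis (Inl j) 1) a) (cnj_coords (z - p)))"
    and "wirt_bar j (\<lambda>z. egf a (cnj_coords (z - p))) = (\<lambda>z. egf (shift (axis (Inr j) 1) a) (cnj_coords (z - p)))"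
proof -
  have D: "((\<lambda>z. egf a (cnj_coords (z - p))) has_derivative
    (\<lambda>h. \<Sum>i\<in>UNIV. egf (shift (axis i 1) a) (cnj_coords (z - p)) * cnj_coords h $ i)) (at z)" for z
  proof (rule egf_coords_has_derivative[OF linear_cnj_coords])
    show "egf_summable a (norm (z - p) + 1)" using a by (simp add: entire_coeffs_def)
    show "cmod (cnj_coords (z - p) $ i) < norm (z - p) + 1" for i
      using cnj_coords_bound[of "z - p" i] by linarith
  qed
  have single: "(\<Sum>i\<in>UNIV. g i * cnj_coords (axis k c) $ i) = g (Inl k) * c + g (Inr k) * cnj c"
    for k c and g :: "'a + 'a \<Rightarrow> complex"
    unfolding sum_sum_type
    by (simp add: cnj_coords_def axis_def if_distrib[of cnj] if_distrib[of "(*) x" for x] cong: if_cong)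
  have pd: "pdiff (axis j c) (\<lambda>z. egf a (cnj_coords (z - p))) z = egf (shift (axis (Inl j) 1) a) (cnj_coords (z - p)) * c
      + egf (shift (axis (Inr j) 1) a) (cnj_coords (z - p)) * cnj c" for c z
    unfolding pdiff_eq[OF D] single ..
  show "wirt j (\<lambda>z. egf a (cnj_coords (z - p))) = (\<lambda>z. egf (shift (axis (Inl j) 1) a) (cnj_coords (z - p)))"
    "wirt_bar j (\<lambda>z. egf a (cnj_coords (z - p))) = (\<lambda>z. egf (shift (axis (Inr j) 1) a) (cnj_coords (z - p)))"
    by (auto simp: wirt_def wirt_bar_def pd field_simps)
qed

text \<open>After recentring at \<open>q\<close>, the argument \<open>(h, cnj h)\<close> is split
  into \<open>(x, x)\<close> and \<open>(\<i> y, -\<i> y)\<close>. The addition formula expands the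
  series in both, and equal powers of \<open>x\<close> and \<open>y\<close> are collected.\<close>

lemma real_analytic_cnj_series:
  fixes p :: "complex ^ 'n::finite"
  assumes a: "entire_coeffs a"
  shows "real_analytic (\<lambda>z. egf a (cnj_coords (z - p)))"
  unfolding real_analytic_def
proof
  fix q :: "complex ^ 'n"
  define y where "y = cnj_coords (q - p)"
  define b where "b = (\<lambda>I. egf (shift I a) y)"
  have yn: "cmod (y $ i) \<le> norm (q - p)" for i unfolding y_def by (rule cnj_coords_bound)
  have b: "egf_summable b s" if "0 < s" for s
    unfolding b_def using a that by (intro egf_summable_recentre(1)[OF _ that _ yn]) (auto simp: entire_coeffs_def)
  define lft rgt :: "('n + 'n) mindex \<Rightarrow> 'n mindex" where "lft K = (\<chi> j. K $ Inl j)" and "rgt K = (\<chi> j. K $ Inr j)" for K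
  have K_eq: "vjoin (lft K) (rgt K) = K" for K by (simp add: vjoin_eq_iff lft_def rgt_def)
  \<comment> \<open>\<open>\<phi>\<close> records the exponents of \<open>x\<close> and
    \<open>y\<close>: both halves of \<open>I\<close> count for \<open>x\<close>, both halves of
    \<open>M\<close> for \<open>y\<close>. The powers of the imaginary unit go into
    \<open>c\<close>.\<close>
  define \<phi> where "\<phi> = (\<lambda>(I, M). (lft I + rgt I, lft M + rgt M))"
  define c where "c = (\<lambda>(I, M). b (I + M) * (\<i> ^ mabs (lft M) * (- \<i>) ^ mabs (rgt M)) / (mfact I * mfact M))"
  define A where "A K L = infsum c {x. \<phi> x = (K, L)}" for K L
  \<comment> \<open>The coefficients \<open>A\<close> are independent of \<open>z\<close> and the
    identity holds everywhere, so the radius 1 chosen at the end is arbitrary.\<close>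
  have "((\<lambda>(K, L). A K L * of_real (mpow (\<chi> j. Re (z $ j - q $ j)) K) * of_real (mpow (\<chi> j. Im (z $ j - q $ j)) L))
      has_sum egf a (cnj_coords (z - p))) UNIV" for z
  proof -
    define h where "h = z - q"
    define u v :: "complex ^ 'n" where "u = (\<chi> j. of_real (Re (h $ j)))" and "v = (\<chi> j. of_real (Im (h $ j)))"
    define X where "X = vjoin u u"
    define Y where "Y = vjoin (\<chi> j. \<i> * v $ j) (\<chi> j. (- \<i>) * v $ j)"
    define s where "s = norm h + 1"
    have s: "0 < s" by (simp add: s_def add_nonneg_pos)
    have uv: "cmod (u $ j) \<le> s" "cmod (v $ j) \<le> s" for j
    proof -
      have "cmod (u $ j) \<le> cmod (h $ j)" "cmod (v $ j) \<le> cmod (h $ j)"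
        by (auto simp: u_def v_def abs_Re_le_cmod abs_Im_le_cmod)
      moreover have "cmod (h $ j) \<le> norm h" by (rule Finite_Cartesian_Product.norm_nth_le)
      ultimately show "cmod (u $ j) \<le> s" "cmod (v $ j) \<le> s" by (auto simp: s_def)
    qed
    have XY: "X + Y = cnj_coords h"
      by (auto simp: X_def Y_def u_def v_def cnj_coords_def vec_eq_iff vjoin_def complex_eq_iff split: sum.split)
    have X: "cmod (X $ i) \<le> s" for i by (cases i) (auto simp: X_def uv)
    have Y: "cmod (Y $ i) \<le> s" for i by (cases i) (auto simp: Y_def uv norm_mult)
    have "egf_summable a (norm h + norm (q - p) + 1)" using a by (simp add: entire_coeffs_def)
    then have "egf_summable a (s + norm (q - p))" by (simp add: s_def add_ac)
    then have "egf a (cnj_coords h + y) = egf b (cnj_coords h)"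
      unfolding b_def
    proof (rule egf_summable_recentre(2)[OF _ s _ yn])
      show "cmod (cnj_coords h $ i) \<le> s" for i using cnj_coords_bound[of h i] by (simp add: s_def)
    qed auto
    moreover have "cnj_coords h + y = cnj_coords (z - p)"
      using linear_add[OF linear_cnj_coords, of h "q - p"] by (simp add: y_def h_def)
    moreover have hs: "((\<lambda>(I, M). b (I + M) * mterm X I * mterm Y M) has_sum egf b (X + Y)) UNIV"
      using s by (intro egf_summable_add[of b s s] b X Y) auto
    have "(case x of (I, M) \<Rightarrow> b (I + M) * mterm X I * mterm Y M)
        = (case \<phi> x of (K, L) \<Rightarrow> c x * (mpow u K * mpow v L))" for x
    proof -
      obtain I M where x: "x = (I, M)" by (cases x)
      have "mpow X I = mpow u (lft I) * mpow u (rgt I)"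
        by (subst K_eq[of I, symmetric]) (simp only: X_def mpow_vjoin)
      moreover have "mpow Y M = (\<i> ^ mabs (lft M) * mpow v (lft M)) * ((- \<i>) ^ mabs (rgt M) * mpow v (rgt M))"
        by (subst K_eq[of M, symmetric]) (simp only: Y_def mpow_vjoin mpow_scale mpow_const vec_lambda_eta)
      ultimately show ?thesis by (simp add: x \<phi>_def c_def mterm_def mpow_add)
    qed
    from has_sum_cong[THEN iffD1, OF this hs]
    have "((\<lambda>x. case \<phi> x of (K, L) \<Rightarrow> c x * (mpow u K * mpow v L)) has_sum egf b (X + Y)) UNIV" .
    ultimately have "((\<lambda>x. case \<phi> x of (K, L) \<Rightarrow> c x * (mpow u K * mpow v L)) has_sum egf a (cnj_coords (z - p))) UNIV"
      using XY by simp
    from has_sum_fibres[OF this, of \<phi>]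
    have "((\<lambda>(K, L). \<Sum>\<^sub>\<infinity>x\<in>{x. \<phi> x = (K, L)}. c x * (mpow u K * mpow v L)) has_sum egf a (cnj_coords (z - p))) UNIV"
      by (rule has_sum_cong[THEN iffD1, rotated]) (auto intro!: infsum_cong)
    moreover have "mpow u K = of_real (mpow (\<chi> j. Re (z $ j - q $ j)) K)"
      "mpow v K = of_real (mpow (\<chi> j. Im (z $ j - q $ j)) K)" for K
      by (simp_all add: u_def v_def h_def mpow_of_real[where 'a = complex, symmetric])
    ultimately show ?thesis
      by (simp add: infsum_cmult_left' A_def mult.assoc)
  qed
  then show "\<exists>A e. 0 < e \<and> (\<forall>z\<in>ball q e. ((\<lambda>(K, L). A K L * of_real (mpow (\<chi> j. Re (z $ j - q $ j)) K)
      * of_real (mpow (\<chi> j. Im (z $ j - q $ j)) L)) has_sum egf a (cnj_coords (z - p))) UNIV)"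
    by (intro exI[of _ A] exI[of _ 1]) auto
qed

lemma wirtinger_cnj_series:
  assumes a: "entire_coeffs a"
  shows "wirtinger R S (\<lambda>z. egf a (cnj_coords (z - p))) = (\<lambda>z. egf (shift (vjoin R S) a) (cnj_coords (z - p)))"
proof -
  have sm: "smooth (\<lambda>z. egf a (cnj_coords (z - p)))"
    by (rule real_analytic_smooth[OF real_analytic_cnj_series[OF a]])
  have add: "axis (Inl j) 1 + vjoin R S = vjoin (R + axis j 1) S" "axis (Inr j) 1 + vjoin R S = vjoin R (S + axis j 1)"
    for R S :: "'a mindex" and j
    by (simp_all add: vjoin_axis(1,2)[symmetric] vjoin_add add.commute del: One_nat_def)
  show ?thesis
  proof (induction R rule: mindex_induct)
    case zero
    show ?case
    proof (induction S rule: mindex_induct)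
      case (add_axis S j)
      show ?case
        unfolding wirtinger_add_axis_bar[OF sm] add_axis wirt_cnj_series(2)[OF entire_coeffs_shift[OF a]] shift_shift add ..
    qed (simp add: wirtinger_zero)
  next
    case (add_axis R j)
    show ?case
      unfolding wirtinger_add_axis[OF sm] add_axis wirt_cnj_series(1)[OF entire_coeffs_shift[OF a]] shift_shift add ..
  qed
qed

lemma wirtinger_cnj_series_centre:
  "entire_coeffs a \<Longrightarrow> wirtinger R S (\<lambda>z. egf a (cnj_coords (z - p))) p = a (vjoin R S)"
  by (simp add: wirtinger_cnj_series linear_0[OF linear_cnj_coords] egf_at_zero shift_def)

text \<open>The derivative of the outer series is complex linear. The first slot enters linearly,
  the second through a conjugation that is undone by conjugating the value.\<close>

lemma sesquiholomorphic_series: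
  fixes p :: "complex ^ 'n::finite"
  assumes a: "entire_coeffs a"
  shows "holomorphic_Cn (\<lambda>z. egf a (vjoin (z - p) (\<chi> j. cnj ((w - p) $ j))))"
    and "antiholomorphic_Cn (\<lambda>w. egf a (vjoin (z - p) (\<chi> j. cnj ((w - p) $ j))))"
proof -
  have D: "(egf a has_derivative (\<lambda>h. \<Sum>i\<in>UNIV. egf (shift (axis i 1) a) y * h $ i)) (at y)" for y
  proof (rule has_derivative_egf)
    show "egf_summable a (norm y + 1)" using a by (simp add: entire_coeffs_def)
    show "cmod (y $ i) < norm y + 1" for i
      using Finite_Cartesian_Product.norm_nth_le[of y i] by linarith
  qed
  show "holomorphic_Cn (\<lambda>z. egf a (vjoin (z - p) (\<chi> j. cnj ((w - p) $ j))))"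
    unfolding holomorphic_Cn_def
  proof
    fix z
    let ?y = "vjoin (z - p) (\<chi> j. cnj ((w - p) $ j))"
    have "linear (\<lambda>h :: complex ^ 'n. vjoin h (0 :: complex ^ 'n))"
      by (rule linearI) (auto simp: vec_eq_iff vjoin_def split: sum.split)
    from has_derivative_add[OF has_derivative_coords[OF this, of p z] has_derivative_const[of "vjoin 0 (\<chi> j. cnj ((w - p) $ j))"]]
    have "((\<lambda>z. vjoin (z - p) (\<chi> j. cnj ((w - p) $ j))) has_derivative (\<lambda>h. vjoin h 0)) (at z)"
      by (simp add: vjoin_add)
    from has_derivative_compose[OF this D]
    show "\<exists>D. ((\<lambda>z. egf a (vjoin (z - p) (\<chi> j. cnj ((w - p) $ j)))) has_derivative D) (at z) \<and> (\<forall>c v. D (c *s v) = c * D v)"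
      by (intro exI conjI) (assumption, simp add: sum_sum_type sum_distrib_left mult_ac)
  qed
  show "antiholomorphic_Cn (\<lambda>w. egf a (vjoin (z - p) (\<chi> j. cnj ((w - p) $ j))))"
    unfolding antiholomorphic_Cn_def holomorphic_Cn_def
  proof
    fix w
    have "linear (\<lambda>h :: complex ^ 'n. vjoin (0 :: complex ^ 'n) (\<chi> j. cnj (h $ j)))"
      by (rule linearI) (auto simp: vec_eq_iff vjoin_def complex_eq_iff split: sum.split)
    from has_derivative_add[OF has_derivative_coords[OF this, of p w] has_derivative_const[of "vjoin (z - p) 0"]]
    have "((\<lambda>w. vjoin (z - p) (\<chi> j. cnj ((w - p) $ j))) has_derivative (\<lambda>h. vjoin 0 (\<chi> j. cnj (h $ j)))) (at w)"
      by (simp add: vjoin_add)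
    from has_derivative_cnj[OF has_derivative_compose[OF this D]]
    show "\<exists>D. ((\<lambda>w. cnj (egf a (vjoin (z - p) (\<chi> j. cnj ((w - p) $ j))))) has_derivative D) (at w) \<and> (\<forall>c v. D (c *s v) = c * D v)"
      by (intro exI conjI) (assumption, simp add: sum_sum_type sum_distrib_left mult_ac)
  qed
qed

section \<open>The seminorms\<close>

lemma infsum_cmult_ennreal: "(\<Sum>\<^sub>\<infinity>x\<in>A. c * f x) = c * (\<Sum>\<^sub>\<infinity>x\<in>A. f x :: ennreal)"
  by (simp add: nonneg_infsum_complete sum_distrib_left[symmetric] SUP_mult_left_ennreal)

lemma infsum_add_ennreal: "(\<Sum>\<^sub>\<infinity>x\<in>A. f x + g x) = (\<Sum>\<^sub>\<infinity>x\<in>A. f x) + (\<Sum>\<^sub>\<infinity>x\<in>A. g x :: ennreal)"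
  by (intro infsum_add nonneg_summable_on_complete) auto

lemma infsum_ennreal:
  fixes f :: "'a \<Rightarrow> real"
  assumes "f summable_on A" "\<And>x. x \<in> A \<Longrightarrow> 0 \<le> f x"
  shows "(\<Sum>\<^sub>\<infinity>x\<in>A. ennreal (f x)) = ennreal (infsum f A)"
proof -
  have "(\<Sum>\<^sub>\<infinity>x\<in>A. ennreal (f x)) = (SUP F\<in>{F. finite F \<and> F \<subseteq> A}. \<Sum>x\<in>F. ennreal (f x))"
    by (rule nonneg_infsum_complete) auto
  also have "\<dots> = (SUP F\<in>{F. finite F \<and> F \<subseteq> A}. ennreal (sum f F))"
    using assms(2) by (intro SUP_cong) (auto intro!: sum_ennreal)
  finally show ?thesis using infsum_nonneg_is_SUPREMUM_ennreal[OF assms] by simp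
qed

lemma le_infsum_ennreal: "f x \<le> (\<Sum>\<^sub>\<infinity>x. f x :: ennreal)"
  by (subst nonneg_infsum_complete) (auto intro!: SUP_upper2[of "{x}"])

lemma infsum_exp_ennreal_less_top:
  assumes "x < (\<infinity> :: ennreal)"
  shows "(\<Sum>\<^sub>\<infinity>N :: 'k::finite mindex. x ^ mabs N / of_nat (mfact N)) < \<infinity>"
proof -
  obtain r where r: "0 \<le> r" "x = ennreal r" using assms by (cases x) auto
  have "x ^ mabs N / of_nat (mfact N) = ennreal (r ^ mabs N / mfact N)" for N :: "'k mindex"
    using r by (simp add: ennreal_power divide_ennreal ennreal_of_nat_eq_real_of_nat)
  moreover have "(\<lambda>N :: 'k mindex. r ^ mabs N / mfact N) summable_on UNIV" by (rule summable_on_mterm_const[OF r(1)])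
  ultimately show ?thesis using r by (simp add: infsum_ennreal)
qed

lemma ennreal_square_convex:
  fixes a b :: ennreal
  assumes t: "0 < t" "t < 1"
  shows "(ennreal (1 - t) * a + ennreal t * b)\<^sup>2 \<le> ennreal (1 - t) * a\<^sup>2 + ennreal t * b\<^sup>2"
proof (cases "a = \<infinity> \<or> b = \<infinity>")
  case True
  then show ?thesis using t by (auto simp: ennreal_mult_top)
next
  case False
  then obtain x y where xy: "0 \<le> x" "a = ennreal x" "0 \<le> y" "b = ennreal y"
    by (cases a; cases b) auto
  have "(1 - t) * x\<^sup>2 + t * y\<^sup>2 - ((1 - t) * x + t * y)\<^sup>2 = t * (1 - t) * (x - y)\<^sup>2"
    by (simp add: power2_eq_square algebra_simps)
  moreover have "0 \<le> t * (1 - t) * (x - y)\<^sup>2" using t by simp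
  ultimately have "((1 - t) * x + t * y)\<^sup>2 \<le> (1 - t) * x\<^sup>2 + t * y\<^sup>2" by linarith
  then have "ennreal (((1 - t) * x + t * y)\<^sup>2) \<le> ennreal ((1 - t) * x\<^sup>2 + t * y\<^sup>2)" by (rule ennreal_leI)
  then show ?thesis using xy t by (simp add: ennreal_mult flip: ennreal_power)
qed

section \<open>Convexity, homogeneity and the triangle inequality\<close>

text \<open>The function enters the recursion only at level 0 and only through its jet; this makes
  the seminorms well defined on classes.\<close>

lemma hfun_cong:
  assumes "\<And>R S. wirtinger R S f p = wirtinger R S g p"
  shows "hfun p hb f m = hfun p hb g m"
  by (induction m) (simp_all add: assms cong: if_cong)

text \<open>Each level takes sums with nonnegative weights, then a square, which is convex and
  increasing on [0, infinity], then again a weighted sum; convexity survives all three.\<close>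

lemma hfun_convex:
  assumes f: "smooth f" and g: "smooth g" and t: "0 < t" "t < 1" and hb: "0 < hb"
  shows "hfun p hb (\<lambda>z. of_real (1 - t) * f z + of_real t * g z) m l R S
    \<le> ennreal (1 - t) * hfun p hb f m l R S + ennreal t * hfun p hb g m l R S"
proof (induction m arbitrary: l R S)
  case 0
  have base: "ennreal (k * (cmod (of_real (1 - t) * u + of_real t * v))\<^sup>2)
      \<le> ennreal (1 - t) * ennreal (k * (cmod u)\<^sup>2) + ennreal t * ennreal (k * (cmod v)\<^sup>2)" if "0 \<le> k" for u v k
  proof -
    have "cmod (of_real (1 - t) * u + of_real t * v) \<le> (1 - t) * cmod u + t * cmod v"
      using norm_triangle_ineq[of "of_real (1 - t) * u" "of_real t * v"] t by (simp add: norm_mult del: of_real_diff)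
    then have "(cmod (of_real (1 - t) * u + of_real t * v))\<^sup>2 \<le> ((1 - t) * cmod u + t * cmod v)\<^sup>2"
      by (rule power_mono) simp
    also have "\<dots> \<le> (1 - t) * (cmod u)\<^sup>2 + t * (cmod v)\<^sup>2"
    proof -
      have "(1 - t) * (cmod u)\<^sup>2 + t * (cmod v)\<^sup>2 - ((1 - t) * cmod u + t * cmod v)\<^sup>2 = t * (1 - t) * (cmod u - cmod v)\<^sup>2"
        by (simp add: power2_eq_square algebra_simps)
      moreover have "0 \<le> t * (1 - t) * (cmod u - cmod v)\<^sup>2" using t by simp
      ultimately show ?thesis by linarith
    qed
    finally have "k * (cmod (of_real (1 - t) * u + of_real t * v))\<^sup>2 \<le> k * ((1 - t) * (cmod u)\<^sup>2 + t * (cmod v)\<^sup>2)"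
      using that by (rule mult_left_mono)
    also have "\<dots> = (1 - t) * (k * (cmod u)\<^sup>2) + t * (k * (cmod v)\<^sup>2)" by (simp add: algebra_simps)
    finally show ?thesis using that t by (simp add: ennreal_leI flip: ennreal_mult ennreal_plus)
  qed
  have "hfun p hb (\<lambda>z. of_real (1 - t) * f z + of_real t * g z) 0 l R S
      \<le> (\<Sum>\<^sub>\<infinity>N. ennreal (1 - t) * ennreal ((2 * hb) ^ (mabs R + mabs S + mabs N) / real (mfact N) * (cmod (wirtinger R (N + S) f p))\<^sup>2)
        + ennreal t * ennreal ((2 * hb) ^ (mabs R + mabs S + mabs N) / real (mfact N) * (cmod (wirtinger R (N + S) g p))\<^sup>2))"
    unfolding hfun.simps wirtinger_lincomb[OF f g] by (intro infsum_mono base nonneg_summable_on_complete) (use hb in simp_all)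
  then show ?case by (simp only: hfun.simps infsum_add_ennreal infsum_cmult_ennreal)
next
  case (Suc m)
  define H where "H f I J = (if even l then hfun p hb f m (l div 2) I J else hfun p hb f m (l div 2) J I)" for f I J
  define K where "K f N = (\<Sum>I\<in>{..R}. \<Sum>J\<in>{..N + S}. of_nat (mbinom R I) * of_nat (mbinom (N + S) J) * H f I J)" for f N
  have hS: "hfun p hb f (Suc m) l R S = (\<Sum>\<^sub>\<infinity>N. inverse (of_nat (mfact N)) * (K f N)\<^sup>2)" for f
    by (simp add: K_def H_def divide_ennreal_def mult.commute)
  let ?c = "\<lambda>z. of_real (1 - t) * f z + of_real t * g z"
  have "H ?c I J \<le> ennreal (1 - t) * H f I J + ennreal t * H g I J" for I J
    unfolding H_def using Suc.IH by auto
  then have K: "K ?c N \<le> ennreal (1 - t) * K f N + ennreal t * K g N" for N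
  proof -
    assume H: "\<And>I J. H ?c I J \<le> ennreal (1 - t) * H f I J + ennreal t * H g I J"
    have "K ?c N \<le> (\<Sum>I\<in>{..R}. \<Sum>J\<in>{..N + S}. of_nat (mbinom R I) * of_nat (mbinom (N + S) J) *
        (ennreal (1 - t) * H f I J + ennreal t * H g I J))"
      unfolding K_def by (intro sum_mono mult_left_mono H) auto
    also have "\<dots> = ennreal (1 - t) * K f N + ennreal t * K g N"
      unfolding K_def by (simp add: sum.distrib sum_distrib_left distrib_left mult_ac)
    finally show ?thesis .
  qed
  have "(K ?c N)\<^sup>2 \<le> ennreal (1 - t) * (K f N)\<^sup>2 + ennreal t * (K g N)\<^sup>2" for N
    by (rule order_trans[OF power_mono[OF K] ennreal_square_convex[OF t]]) auto
  then have "hfun p hb ?c (Suc m) l R S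
      \<le> (\<Sum>\<^sub>\<infinity>N. inverse (of_nat (mfact N)) * (ennreal (1 - t) * (K f N)\<^sup>2 + ennreal t * (K g N)\<^sup>2))"
    unfolding hS by (intro infsum_mono mult_left_mono nonneg_summable_on_complete) auto
  also have "\<dots> = (\<Sum>\<^sub>\<infinity>N. ennreal (1 - t) * (inverse (of_nat (mfact N)) * (K f N)\<^sup>2)
      + ennreal t * (inverse (of_nat (mfact N)) * (K g N)\<^sup>2))"
    by (intro infsum_cong) (simp add: distrib_left mult_ac)
  also have "\<dots> = ennreal (1 - t) * hfun p hb f (Suc m) l R S + ennreal t * hfun p hb g (Suc m) l R S"
    unfolding hS by (simp only: infsum_add_ennreal infsum_cmult_ennreal)
  finally show ?case .
qed

text \<open>The degree is 2 at level 0 and doubles with the square of every further level.\<close>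

lemma hfun_scale:
  assumes f: "smooth f" and hb: "0 < hb"
  shows "hfun p hb (\<lambda>z. c * f z) m l R S = ennreal (cmod c ^ 2 ^ (m + 1)) * hfun p hb f m l R S"
proof (induction m arbitrary: l R S)
  case 0
  have w: "wirtinger R S (\<lambda>z. c * f z) p = c * wirtinger R S f p" for R S
    using wirtinger_lincomb[OF f f, of R S c 0] by simp
  have base: "ennreal (k * (cmod (c * u))\<^sup>2) = ennreal ((cmod c)\<^sup>2) * ennreal (k * (cmod u)\<^sup>2)" if "0 \<le> k" for k u
    using that by (simp add: norm_mult power_mult_distrib mult_ac flip: ennreal_mult)
  have "hfun p hb (\<lambda>z. c * f z) 0 l R S = (\<Sum>\<^sub>\<infinity>N. ennreal ((cmod c)\<^sup>2) *
      ennreal ((2 * hb) ^ (mabs R + mabs S + mabs N) / real (mfact N) * (cmod (wirtinger R (N + S) f p))\<^sup>2))"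
    unfolding hfun.simps w by (intro infsum_cong base) (use hb in simp)
  then show ?case unfolding infsum_cmult_ennreal by simp
next
  case (Suc m)
  define H where "H f I J = (if even l then hfun p hb f m (l div 2) I J else hfun p hb f m (l div 2) J I)" for f I J
  define K where "K f N = (\<Sum>I\<in>{..R}. \<Sum>J\<in>{..N + S}. of_nat (mbinom R I) * of_nat (mbinom (N + S) J) * H f I J)" for f N
  have hS: "hfun p hb f (Suc m) l R S = (\<Sum>\<^sub>\<infinity>N. inverse (of_nat (mfact N)) * (K f N)\<^sup>2)" for f
    by (simp add: K_def H_def divide_ennreal_def mult.commute)
  define k where "k = cmod c ^ 2 ^ (m + 1)"
  have "H (\<lambda>z. c * f z) I J = ennreal k * H f I J" for I J
    unfolding H_def k_def using Suc.IH by auto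
  then have "K (\<lambda>z. c * f z) N = ennreal k * K f N" for N
    unfolding K_def by (simp add: sum_distrib_left mult_ac)
  then have "hfun p hb (\<lambda>z. c * f z) (Suc m) l R S = (ennreal k)\<^sup>2 * hfun p hb f (Suc m) l R S"
    unfolding hS by (simp add: power_mult_distrib infsum_cmult_ennreal[symmetric] mult_ac)
  moreover have "(ennreal k)\<^sup>2 = ennreal (cmod c ^ 2 ^ (Suc m + 1))"
    by (simp add: k_def ennreal_power flip: power_mult)
  ultimately show ?case by simp
qed

lemma hnorm_finite_iff: "hnorm p hb m l R S f < \<infinity> \<longleftrightarrow> hfun p hb f m l R S < \<infinity>"
  by (simp add: hnorm_def top.not_eq_extremum)

lemma A_tilde_iff: "f \<in> A_tilde p hb \<longleftrightarrow> smooth f \<and> (\<forall>m. \<forall>l<2 ^ m. \<forall>R S. hfun p hb f m l R S < \<infinity>)"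
  unfolding A_tilde_def hnorm_finite_iff by simp

lemma A_tilde_smooth: "f \<in> A_tilde p hb \<Longrightarrow> smooth f"
  by (simp add: A_tilde_iff)

lemma A_tilde_scale:
  assumes "f \<in> A_tilde p hb" "0 < hb"
  shows "(\<lambda>z. c * f z) \<in> A_tilde p hb"
proof -
  have "smooth (\<lambda>z. c * f z)" using smooth_lincomb[of f f c 0] A_tilde_smooth[OF assms(1)] by simp
  then show ?thesis
    using assms unfolding A_tilde_iff by (simp add: hfun_scale ennreal_mult_less_top)
qed

lemma A_tilde_add:
  assumes f: "f \<in> A_tilde p hb" and g: "g \<in> A_tilde p hb" and hb: "0 < hb"
  shows "(\<lambda>z. f z + g z) \<in> A_tilde p hb"
proof -
  \<comment> \<open>Convexity bounds the midpoint of \<open>f\<close> and \<open>g\<close>; scaling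
    by 2 gives the sum.\<close>
  define t :: real where "t = 1 / 2"
  have t: "0 < t" "t < 1" by (auto simp: t_def)
  let ?c = "\<lambda>z. of_real (1 - t) * f z + of_real t * g z"
  note sm = A_tilde_smooth[OF f] A_tilde_smooth[OF g]
  have "hfun p hb ?c m l R S < \<infinity>" if "l < 2 ^ m" for m l R S
  proof -
    have "hfun p hb ?c m l R S \<le> ennreal (1 - t) * hfun p hb f m l R S + ennreal t * hfun p hb g m l R S"
      by (rule hfun_convex[OF sm t hb])
    also have "\<dots> < \<infinity>" using f g that by (simp add: A_tilde_iff ennreal_mult_less_top)
    finally show ?thesis .
  qed
  moreover have "smooth ?c" by (rule smooth_lincomb[OF sm])
  ultimately have "?c \<in> A_tilde p hb" unfolding A_tilde_iff by blast
  from A_tilde_scale[OF this hb, of 2] show ?thesis by (simp add: t_def algebra_simps)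
qed

text \<open>Moves the root to the other side, so that the seminorm properties can be derived from
  \<open>hfun\<close>.\<close>

lemma hnorm_le_iff:
  assumes "hfun p hb f m l R S < \<infinity>" "0 \<le> s"
  shows "enn2real (hnorm p hb m l R S f) \<le> s \<longleftrightarrow> hfun p hb f m l R S \<le> ennreal (s ^ 2 ^ (m + 1))"
proof -
  obtain r where r: "0 \<le> r" "hfun p hb f m l R S = ennreal r"
    using assms(1) by (cases "hfun p hb f m l R S") auto
  have eq: "enn2real (hnorm p hb m l R S f) = root (2 ^ (m + 1)) r"
    using r by (cases "r = 0") (simp_all add: hnorm_def root_powr_inverse)
  have "root (2 ^ (m + 1)) r \<le> s \<longleftrightarrow> root (2 ^ (m + 1)) r \<le> root (2 ^ (m + 1)) (s ^ 2 ^ (m + 1))"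
    using assms(2) real_root_power_cancel[of "2 ^ (m + 1)" s] by simp
  also have "\<dots> \<longleftrightarrow> r \<le> s ^ 2 ^ (m + 1)" by (rule real_root_le_iff) simp
  finally show ?thesis using r assms(2) unfolding eq by simp
qed

text \<open>A convex functional that is homogeneous of degree \<open>k\<close> has a subadditive \<open>k\<close>-th root: its
  unit sublevel set is convex and the root is the gauge of that set.\<close>

lemma hnorm_triangle:
  assumes f: "f \<in> A_tilde p hb" and g: "g \<in> A_tilde p hb" and hb: "0 < hb" and l: "l < 2 ^ m"
  shows "enn2real (hnorm p hb m l R S (\<lambda>z. f z + g z))
    \<le> enn2real (hnorm p hb m l R S f) + enn2real (hnorm p hb m l R S g)"
proof (rule field_le_epsilon)
  fix e :: real assume e: "0 < e"
  define k :: nat where "k = 2 ^ (m + 1)"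
  define q where "q f = enn2real (hnorm p hb m l R S f)" for f
  have unit: "hfun p hb (\<lambda>z. of_real (1 / s) * f z) m l R S \<le> 1"
    if "f \<in> A_tilde p hb" "q f \<le> s" "0 < s" for f s
  proof -
    have "hfun p hb f m l R S \<le> ennreal (s ^ k)"
      using hnorm_le_iff[of p hb f m l R S s] that l by (simp add: A_tilde_iff q_def k_def)
    then have "ennreal ((1 / s) ^ k) * hfun p hb f m l R S \<le> ennreal ((1 / s) ^ k) * ennreal (s ^ k)"
      by (rule mult_left_mono) simp
    also have "\<dots> = ennreal ((1 / s) ^ k * s ^ k)" using that(3) by (intro ennreal_mult[symmetric]) auto
    also have "(1 / s) ^ k * s ^ k = 1" using that(3) by (simp add: power_divide)
    finally show ?thesis
      using hfun_scale[OF A_tilde_smooth[OF that(1)] hb, of p "of_real (1 / s)" m l R S] that(3)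
      by (simp add: k_def norm_divide)
  qed
  \<comment> \<open>The added \<open>e / 2\<close> keeps \<open>s\<close> and \<open>t\<close>
    positive when a seminorm vanishes; together they exceed the sum of the seminorms by
    \<open>e\<close>.\<close>
  define s where "s = q f + e / 2"
  define t where "t = q g + e / 2"
  have st: "0 < s" "0 < t" "q f \<le> s" "q g \<le> t" using e by (auto simp: s_def t_def q_def intro!: add_nonneg_pos)
  define F where "F = (\<lambda>z. of_real (1 / s) * f z)"
  define G where "G = (\<lambda>z. of_real (1 / t) * g z)"
  \<comment> \<open>The weights \<open>1 - u = s / (s + t)\<close> and
    \<open>u = t / (s + t)\<close> make the combination of \<open>F\<close> and \<open>G\<close>
    equal to \<open>(f + g) / (s + t)\<close>.\<close>
  define u where "u = t / (s + t)"
  have u: "0 < u" "u < 1" using st by (auto simp: u_def)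
  have FG: "smooth F" "smooth G" unfolding F_def G_def using A_tilde_smooth[OF A_tilde_scale[OF f hb]] A_tilde_smooth[OF A_tilde_scale[OF g hb]] by blast+
  define h where "h = (\<lambda>z. of_real (1 - u) * F z + of_real u * G z)"
  have "hfun p hb h m l R S \<le> ennreal (1 - u) * hfun p hb F m l R S + ennreal u * hfun p hb G m l R S"
    unfolding h_def by (rule hfun_convex[OF FG u hb])
  also have "\<dots> \<le> ennreal (1 - u) * 1 + ennreal u * 1"
    unfolding F_def G_def using unit f g st by (intro add_mono mult_left_mono) auto
  also have "\<dots> = 1" using u by (simp flip: ennreal_plus)
  finally have h1: "hfun p hb h m l R S \<le> 1" .
  have "f z + g z = of_real (s + t) * h z" for z
  proof -
    have "s + t \<noteq> 0" using st by linarith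
    then have "1 - u = s / (s + t)" by (simp add: u_def divide_simps)
    then have "(s + t) * (1 - u) / s = 1" "(s + t) * u / t = 1"
      using st \<open>s + t \<noteq> 0\<close> by (simp_all add: u_def)
    then have "complex_of_real ((s + t) * (1 - u) / s) = 1" "complex_of_real ((s + t) * u / t) = 1"
      by (metis of_real_1)+
    moreover have "of_real (s + t) * h z = of_real ((s + t) * (1 - u) / s) * f z + of_real ((s + t) * u / t) * g z"
      by (simp add: h_def F_def G_def algebra_simps add_divide_distrib diff_divide_distrib)
    ultimately show ?thesis by simp
  qed
  then have eq: "(\<lambda>z. f z + g z) = (\<lambda>z. of_real (s + t) * h z)" by blast
  have sm: "smooth h" unfolding h_def by (rule smooth_lincomb[OF FG])
  have "hfun p hb (\<lambda>z. f z + g z) m l R S \<le> ennreal ((s + t) ^ k)"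
    unfolding eq hfun_scale[OF sm hb] using mult_left_mono[OF h1, of "ennreal ((s + t) ^ k)"] st
    by (simp add: k_def del: of_real_add)
  then have "q (\<lambda>z. f z + g z) \<le> s + t"
    unfolding q_def k_def using A_tilde_add[OF f g hb] l st
    by (subst hnorm_le_iff) (auto simp: A_tilde_iff)
  then show "enn2real (hnorm p hb m l R S (\<lambda>z. f z + g z))
    \<le> enn2real (hnorm p hb m l R S f) + enn2real (hnorm p hb m l R S g) + e"
    by (simp add: q_def s_def t_def)
qed

text \<open>One inequality for all scalars is enough; the other results from applying it with
  \<open>1 / c\<close> to \<open>c f\<close>.\<close>

lemma hnorm_scale:
  assumes f: "f \<in> A_tilde p hb" and hb: "0 < hb" and l: "l < 2 ^ m"
  shows "enn2real (hnorm p hb m l R S (\<lambda>z. c * f z)) = cmod c * enn2real (hnorm p hb m l R S f)"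
proof -
  have le: "enn2real (hnorm p hb m l R S (\<lambda>z. c * f z)) \<le> cmod c * enn2real (hnorm p hb m l R S f)"
    if "f \<in> A_tilde p hb" for f c
  proof (subst hnorm_le_iff)
    show "hfun p hb (\<lambda>z. c * f z) m l R S < \<infinity>" using A_tilde_scale[OF that hb] l by (simp add: A_tilde_iff)
    have "hfun p hb f m l R S \<le> ennreal (enn2real (hnorm p hb m l R S f) ^ 2 ^ (m + 1))"
      using that l by (subst hnorm_le_iff[symmetric]) (auto simp: A_tilde_iff)
    then show "hfun p hb (\<lambda>z. c * f z) m l R S \<le> ennreal ((cmod c * enn2real (hnorm p hb m l R S f)) ^ 2 ^ (m + 1))"
      unfolding hfun_scale[OF A_tilde_smooth[OF that] hb] power_mult_distrib
      by (subst ennreal_mult) (auto intro: mult_left_mono)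
  qed auto
  show ?thesis
  proof (cases "c = 0")
    case True
    then show ?thesis using le[OF f, of 0] by (simp add: antisym)
  next
    case False
    have "cmod c * enn2real (hnorm p hb m l R S f) \<le> enn2real (hnorm p hb m l R S (\<lambda>z. c * f z))"
      using le[OF A_tilde_scale[OF f hb, of c], of "1 / c"] False by (simp add: norm_divide field_simps)
    then show ?thesis using le[OF f, of c] by simp
  qed
qed

section \<open>Seminorms and the size of the derivatives at p\<close>

text \<open>The term \<open>N = 0\<close> already contains the derivative of order
  \<open>(R, S)\<close>; thus the seminorms of level 0 separate classes.\<close>

lemma hfun_zero_imp_jet_zero:
  assumes hb: "0 < hb" and "hfun p hb f 0 0 R S = 0"
  shows "wirtinger R S f p = 0"
proof -
  define k where "k = (2 * hb) ^ (mabs R + mabs S)"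
  have k: "0 < k" using hb by (simp add: k_def)
  have "ennreal (k * (cmod (wirtinger R S f p))\<^sup>2) \<le> 0"
    using le_infsum_ennreal[of "\<lambda>N. ennreal ((2 * hb) ^ (mabs R + mabs S + mabs N) / real (mfact N) * (cmod (wirtinger R (N + S) f p))\<^sup>2)" 0] assms(2)
    unfolding hfun.simps k_def by simp
  then show ?thesis using k by (simp add: ennreal_eq_0_iff mult_le_0_iff)
qed

text \<open>Since \<open>l = 1\<close> is odd, the indices are swapped and level 1 at
  \<open>R = S = 0\<close> sums the squares of binomial combinations of
  \<open>hfun p hb f 0 0 J 0\<close>, weighted by \<open>1 / N!\<close>. The term
  \<open>N = J = R\<close> bounds the square of \<open>hfun p hb f 0 0 R 0\<close> by
  \<open>C R!\<close>, and the term \<open>N = S\<close> of the latter contains the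
  derivative.\<close>

lemma A_tilde_jet_growth:
  fixes f :: "complex ^ 'n::finite \<Rightarrow> complex"
  assumes f: "f \<in> A_tilde p hb" and hb: "0 < hb"
  shows "\<exists>C. \<forall>R S. (cmod (wirtinger R S f p))\<^sup>2 \<le> C * (1 / (2 * hb)) ^ (mabs R + mabs S) * (mfact R * mfact S)"
proof -
  define C where "C = enn2real (hfun p hb f 1 1 0 0)"
  have "(1 :: nat) < 2 ^ 1" by simp
  then have "hfun p hb f 1 1 0 0 < \<infinity>" using f unfolding A_tilde_iff by blast
  then have C: "0 \<le> C" "hfun p hb f 1 1 0 0 = ennreal C"
    unfolding C_def by (simp_all add: less_top del: One_nat_def hfun.simps)
  have "(cmod (wirtinger R S f p))\<^sup>2 \<le> (1 + C) * (1 / (2 * hb)) ^ (mabs R + mabs S) * (mfact R * mfact S)" for R S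
  proof -
    define x where "x = (2 * hb) ^ (mabs R + mabs S) / mfact S * (cmod (wirtinger R S f p))\<^sup>2"
    have x: "0 \<le> x" using hb by (simp add: x_def)
    have "ennreal x \<le> hfun p hb f 0 0 R 0"
      using le_infsum_ennreal[of "\<lambda>N. ennreal ((2 * hb) ^ (mabs R + mabs (0 :: 'n mindex) + mabs N) / real (mfact N) * (cmod (wirtinger R (N + 0) f p))\<^sup>2)" S]
      by (simp add: x_def)
    also have "hfun p hb f 0 0 R 0 = of_nat (mbinom (R + 0) R) * hfun p hb f 0 0 R 0" by (simp add: mbinom_def)
    also have "\<dots> \<le> (\<Sum>J\<in>{..R + 0}. of_nat (mbinom (R + 0) J) * hfun p hb f 0 0 J 0)"
      by (rule member_le_sum) auto
    also have "\<dots> = (\<Sum>I\<in>{..0 :: 'n mindex}. \<Sum>J\<in>{..R + 0}. of_nat (mbinom 0 I) * of_nat (mbinom (R + 0) J) * hfun p hb f 0 0 J I)"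
    proof -
      have "{..0 :: 'n mindex} = {0}" by (auto simp: less_eq_vec_def vec_eq_iff)
      then show ?thesis by (simp add: mbinom_def)
    qed
    finally have "(ennreal x)\<^sup>2 / of_nat (mfact R)
        \<le> (\<Sum>I\<in>{..0 :: 'n mindex}. \<Sum>J\<in>{..R + 0}. of_nat (mbinom 0 I) * of_nat (mbinom (R + 0) J) * hfun p hb f 0 0 J I)\<^sup>2 / of_nat (mfact R)"
      by (intro divide_right_mono_ennreal power_mono) auto
    also have "\<dots> \<le> hfun p hb f 1 1 0 0"
      using le_infsum_ennreal[of "\<lambda>N. (\<Sum>I\<in>{..0 :: 'n mindex}. \<Sum>J\<in>{..N + 0}. of_nat (mbinom 0 I) * of_nat (mbinom (N + 0) J) * hfun p hb f 0 0 J I)\<^sup>2 / of_nat (mfact N)" R]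
      by (simp del: hfun.simps(1))
    finally have "(ennreal x)\<^sup>2 / of_nat (mfact R) \<le> ennreal C" unfolding C(2) .
    then have "ennreal (x\<^sup>2 / mfact R) \<le> ennreal C"
      using x by (simp add: ennreal_power divide_ennreal ennreal_of_nat_eq_real_of_nat)
    then have "x\<^sup>2 \<le> C * mfact R" using C(1) by (simp add: divide_le_eq)
    \<comment> \<open>Replaces a square root: \<open>x \<le> 1 + C R! \<le> (1 + C) R!\<close> is
      weaker than \<open>sqrt (C R!)\<close> but has the shape required for an entire
      series.\<close>
    moreover have "x \<le> 1 + x\<^sup>2"
    proof -
      have "0 \<le> (x - 1)\<^sup>2 + x" using x by simp
      then show ?thesis by (simp add: power2_eq_square algebra_simps)
    qed
    moreover have "1 \<le> real (mfact R)" using mfact_pos[of R] by linarith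
    ultimately have "x \<le> (1 + C) * mfact R" by (simp add: distrib_right)
    then have *: "x * ((1 / (2 * hb)) ^ (mabs R + mabs S) * mfact S) \<le> (1 + C) * mfact R * ((1 / (2 * hb)) ^ (mabs R + mabs S) * mfact S)"
      using hb by (intro mult_right_mono) auto
    have "x * ((1 / (2 * hb)) ^ (mabs R + mabs S) * mfact S) = (cmod (wirtinger R S f p))\<^sup>2"
      using hb by (simp add: x_def power_divide)
    from *[unfolded this] show ?thesis by (simp only: mult_ac of_nat_mult)
  qed
  then show ?thesis by blast
qed

text \<open>The shape of the bound reproduces itself: the binomial sums turn \<open>A\<close>,
  \<open>B\<close> into \<open>1 + A\<close>, \<open>1 + B\<close>, the square turns these into
  their squares, and the part depending on \<open>N\<close> sums against \<open>1 / N!\<close> to a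
  finite exponential. Odd \<open>l\<close> exchanges \<open>A\<close> and \<open>B\<close>.\<close>

lemma hfun_geometric_bound:
  fixes f :: "complex ^ 'n::finite \<Rightarrow> complex"
  assumes hb: "0 < hb" and ab: "0 \<le> a" "0 \<le> b" "0 \<le> c"
    and w: "\<And>R S. cmod (wirtinger R S f p) \<le> c * a ^ mabs R * b ^ mabs S"
  shows "\<exists>C A B. C < \<infinity> \<and> A < \<infinity> \<and> B < \<infinity> \<and> (\<forall>R S. hfun p hb f m l R S \<le> C * A ^ mabs R * B ^ mabs S)"
proof (induction m arbitrary: l)
  case 0
  \<comment> \<open>Level 0 squares the derivative and weights each order with
    \<open>2 * hb\<close>. The index \<open>N\<close> raises only the order in the conjugate
    variables, so its sum is governed by \<open>\<beta>\<close>.\<close>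
  define \<alpha> \<beta> where "\<alpha> = 2 * hb * a\<^sup>2" and "\<beta> = 2 * hb * b\<^sup>2"
  have \<alpha>\<beta>: "0 \<le> \<alpha>" "0 \<le> \<beta>" using hb by (auto simp: \<alpha>_def \<beta>_def)
  define X where "X = ennreal \<beta>"
  define E where "E = (\<Sum>\<^sub>\<infinity>N :: 'n mindex. X ^ mabs N / of_nat (mfact N))"
  have E: "E < \<infinity>" unfolding E_def by (rule infsum_exp_ennreal_less_top) (simp add: X_def)
  have "hfun p hb f 0 l R S \<le> (ennreal (c\<^sup>2) * E) * ennreal \<alpha> ^ mabs R * X ^ mabs S" for R S
  proof -
    have summand: "ennreal ((2 * hb) ^ (mabs R + mabs S + mabs N) / real (mfact N) * (cmod (wirtinger R (N + S) f p))\<^sup>2)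
        \<le> (ennreal (c\<^sup>2) * ennreal \<alpha> ^ mabs R * X ^ mabs S) * (X ^ mabs N / of_nat (mfact N))" for N
    proof -
      have "(2 * hb) ^ (mabs R + mabs S + mabs N) / real (mfact N) * (cmod (wirtinger R (N + S) f p))\<^sup>2
          \<le> (2 * hb) ^ (mabs R + mabs S + mabs N) / real (mfact N) * (c * a ^ mabs R * b ^ mabs (N + S))\<^sup>2"
        using hb by (intro mult_left_mono power_mono w) auto
      also have "\<dots> = (c\<^sup>2 * \<alpha> ^ mabs R * \<beta> ^ mabs S) * (\<beta> ^ mabs N / mfact N)"
        by (simp add: \<alpha>_def \<beta>_def mabs_add power_add power_mult_distrib power_mult[symmetric] mult_ac)
      finally have "ennreal ((2 * hb) ^ (mabs R + mabs S + mabs N) / real (mfact N) * (cmod (wirtinger R (N + S) f p))\<^sup>2)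
          \<le> ennreal (\<dots>)" by (rule ennreal_leI)
      also have "\<dots> = (ennreal (c\<^sup>2) * ennreal \<alpha> ^ mabs R * X ^ mabs S) * (X ^ mabs N / of_nat (mfact N))"
        using \<alpha>\<beta> by (simp add: X_def ennreal_mult ennreal_power divide_ennreal[symmetric]
            ennreal_of_nat_eq_real_of_nat ennreal_times_divide)
      finally show ?thesis .
    qed
    have "hfun p hb f 0 l R S
        \<le> (\<Sum>\<^sub>\<infinity>N :: 'n mindex. (ennreal (c\<^sup>2) * ennreal \<alpha> ^ mabs R * X ^ mabs S) * (X ^ mabs N / of_nat (mfact N)))"
      unfolding hfun.simps by (intro infsum_mono nonneg_summable_on_complete summand) auto
    then show ?thesis unfolding infsum_cmult_ennreal E_def[symmetric] by (simp only: mult_ac)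
  qed
  then show ?case
    using E by (intro exI[of _ "ennreal (c\<^sup>2) * E"] exI[of _ "ennreal \<alpha>"] exI[of _ X])
      (auto simp: X_def ennreal_mult_less_top)
next
  case (Suc m)
  obtain C0 A0 B0 where 0: "C0 < \<infinity>" "A0 < \<infinity>" "B0 < \<infinity>"
    "\<And>R S. hfun p hb f m (l div 2) R S \<le> C0 * A0 ^ mabs R * B0 ^ mabs S" using Suc.IH[of "l div 2"] by blast
  define A where "A = (if even l then A0 else B0)"
  define B where "B = (if even l then B0 else A0)"
  have fin: "C0 < \<infinity>" "A < \<infinity>" "B < \<infinity>" using 0 by (auto simp: A_def B_def)
  have H: "(if even l then hfun p hb f m (l div 2) I J else hfun p hb f m (l div 2) J I) \<le> C0 * A ^ mabs I * B ^ mabs J" for I J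
    using 0(4)[of I J] 0(4)[of J I] by (auto simp: A_def B_def mult_ac)
  define X where "X = (1 + B)\<^sup>2"
  define E where "E = (\<Sum>\<^sub>\<infinity>N :: 'n mindex. X ^ mabs N / of_nat (mfact N))"
  have X: "X < \<infinity>" using fin by (simp add: X_def power2_eq_square ennreal_mult_less_top)
  have E: "E < \<infinity>" unfolding E_def by (rule infsum_exp_ennreal_less_top[OF X])
  have "hfun p hb f (Suc m) l R S \<le> (C0\<^sup>2 * E) * ((1 + A)\<^sup>2) ^ mabs R * X ^ mabs S" for R S
  proof -
    have summand: "(\<Sum>I\<in>{..R}. \<Sum>J\<in>{..N + S}. of_nat (mbinom R I) * of_nat (mbinom (N + S) J) *
          (if even l then hfun p hb f m (l div 2) I J else hfun p hb f m (l div 2) J I))\<^sup>2 / of_nat (mfact N)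
        \<le> (C0\<^sup>2 * ((1 + A)\<^sup>2) ^ mabs R * X ^ mabs S) * (X ^ mabs N / of_nat (mfact N))" for N
    proof -
      have "(\<Sum>I\<in>{..R}. \<Sum>J\<in>{..N + S}. of_nat (mbinom R I) * of_nat (mbinom (N + S) J) *
          (if even l then hfun p hb f m (l div 2) I J else hfun p hb f m (l div 2) J I))
        \<le> (\<Sum>I\<in>{..R}. \<Sum>J\<in>{..N + S}. of_nat (mbinom R I) * of_nat (mbinom (N + S) J) * (C0 * A ^ mabs I * B ^ mabs J))"
        by (intro sum_mono mult_left_mono H) auto
      also have "\<dots> = C0 * ((\<Sum>I\<in>{..R}. of_nat (mbinom R I) * A ^ mabs I) * (\<Sum>J\<in>{..N + S}. of_nat (mbinom (N + S) J) * B ^ mabs J))"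
        unfolding sum_product by (simp only: sum_distrib_left mult_ac)
      also have "\<dots> = C0 * ((1 + A) ^ mabs R * (1 + B) ^ mabs (N + S))" unfolding mbinomial_sum ..
      finally have "(\<Sum>I\<in>{..R}. \<Sum>J\<in>{..N + S}. of_nat (mbinom R I) * of_nat (mbinom (N + S) J) *
          (if even l then hfun p hb f m (l div 2) I J else hfun p hb f m (l div 2) J I))\<^sup>2 / of_nat (mfact N)
          \<le> (C0 * ((1 + A) ^ mabs R * (1 + B) ^ mabs (N + S)))\<^sup>2 / of_nat (mfact N)"
        by (intro divide_right_mono_ennreal power_mono) auto
      also have "\<dots> = (C0\<^sup>2 * ((1 + A)\<^sup>2) ^ mabs R * X ^ mabs S) * (X ^ mabs N / of_nat (mfact N))"
        by (simp add: X_def mabs_add power_add power_mult_distrib divide_ennreal_def mult_ac flip: power_mult)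
      finally show ?thesis .
    qed
    have "hfun p hb f (Suc m) l R S
        \<le> (\<Sum>\<^sub>\<infinity>N :: 'n mindex. (C0\<^sup>2 * ((1 + A)\<^sup>2) ^ mabs R * X ^ mabs S) * (X ^ mabs N / of_nat (mfact N)))"
      unfolding hfun.simps by (intro infsum_mono nonneg_summable_on_complete summand) auto
    then show ?thesis unfolding infsum_cmult_ennreal E_def[symmetric] by (simp only: mult_ac)
  qed
  then show ?case
    using E X fin by (intro exI[of _ "C0\<^sup>2 * E"] exI[of _ "(1 + A)\<^sup>2"] exI[of _ X])
      (auto simp: power2_eq_square ennreal_mult_less_top)
qed

lemma A_tilde_geometric_bound:
  fixes f :: "complex ^ 'n::finite \<Rightarrow> complex"
  assumes "0 < hb" "smooth f" "0 \<le> a" "0 \<le> b" "0 \<le> c"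
    and "\<And>R S. cmod (wirtinger R S f p) \<le> c * a ^ mabs R * b ^ mabs S"
  shows "f \<in> A_tilde p hb"
proof -
  have "hfun p hb f m l R S < \<infinity>" for m l R S
  proof -
    obtain C A B where "C < \<infinity>" "A < \<infinity>" "B < \<infinity>" "hfun p hb f m l R S \<le> C * A ^ mabs R * B ^ mabs S"
      using hfun_geometric_bound[OF assms(1,3,4,5,6), of m l] by blast
    then show ?thesis by (auto intro: le_less_trans simp: ennreal_mult_less_top power_less_top_ennreal)
  qed
  then show ?thesis using assms(2) by (simp add: A_tilde_iff)
qed

section \<open>The quotient space\<close>

context
  fixes p :: "complex ^ 'n::finite" and hb :: real
  assumes hb: "0 < hb"
begin

section \<open>The quotient as a seminormed vector space\<close>

abbreviation "cls f \<equiv> taylor_rel p hb `` {f}"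

lemma zero_in_A_tilde: "(\<lambda>z. 0) \<in> A_tilde p hb"
proof -
  have "pdiff b (\<lambda>z :: complex ^ 'n. 0 :: complex) = (\<lambda>z. 0)" for b
    by (rule ext) (rule pdiff_eq[OF has_derivative_const])
  then have sm: "smooth (\<lambda>z :: complex ^ 'n. 0 :: complex)"
    by (intro smoothI[of "\<lambda>f. f = (\<lambda>z. 0)"]) auto
  show ?thesis
  proof (rule A_tilde_geometric_bound[OF hb sm, of 0 0 0])
    show "cmod (wirtinger R S (\<lambda>z. 0) p) \<le> 0 * 0 ^ mabs R * 0 ^ mabs S" for R S
      using wirtinger_lincomb[OF sm sm, of R S 0 0] by simp
  qed auto
qed

text \<open>Turns questions about classes into questions about jets, which depend linearly on the
  function.\<close>

lemma taylor_rel_iff: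
  "(f, g) \<in> taylor_rel p hb \<longleftrightarrow> f \<in> A_tilde p hb \<and> g \<in> A_tilde p hb \<and>
    (\<forall>R S. wirtinger R S f p = wirtinger R S g p)"
proof -
  have "(\<lambda>z. f z - g z) \<in> flat_at p \<longleftrightarrow> (\<forall>R S. wirtinger R S f p = wirtinger R S g p)"
    if "f \<in> A_tilde p hb" "g \<in> A_tilde p hb"
  proof -
    note sm = A_tilde_smooth[OF that(1)] A_tilde_smooth[OF that(2)]
    have "wirtinger R S (\<lambda>z. f z - g z) p = wirtinger R S f p - wirtinger R S g p" for R S
      using wirtinger_lincomb[OF sm, of R S 1 "-1"] by simp
    moreover have "smooth (\<lambda>z. f z - g z)" using smooth_lincomb[OF sm, of 1 "-1"] by simp
    ultimately show ?thesis by (simp add: flat_at_iff_wirtinger)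
  qed
  then show ?thesis by (auto simp: taylor_rel_def)
qed

lemma cls_eq_iff:
  assumes "f \<in> A_tilde p hb" "g \<in> A_tilde p hb"
  shows "cls f = cls g \<longleftrightarrow> (\<forall>R S. wirtinger R S f p = wirtinger R S g p)"
proof
  assume "cls f = cls g"
  moreover have "f \<in> cls f" using assms by (simp add: taylor_rel_iff)
  ultimately have "f \<in> cls g" by simp
  then show "\<forall>R S. wirtinger R S f p = wirtinger R S g p" by (simp add: taylor_rel_iff)
qed (use assms in \<open>auto simp: taylor_rel_iff\<close>)

lemma carrier_A: "carrier (A_space p hb) = {cls f | f. f \<in> A_tilde p hb}"
  by (auto simp: A_space_def quotient_def)

lemma carrier_A_cases:
  assumes "X \<in> carrier (A_space p hb)"
  obtains f where "f \<in> A_tilde p hb" "X = cls f"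
  using assms by (auto simp: carrier_A)

lemma cls_in_carrier: "f \<in> A_tilde p hb \<Longrightarrow> cls f \<in> carrier (A_space p hb)"
  by (auto simp: carrier_A)

text \<open>All representatives yield the same class, so the union that defines the sum runs over a
  constant family.\<close>

lemma A_add:
  assumes f: "f \<in> A_tilde p hb" and g: "g \<in> A_tilde p hb"
  shows "cls f \<oplus>\<^bsub>A_space p hb\<^esub> cls g = cls (\<lambda>z. f z + g z)"
proof -
  have *: "cls (\<lambda>z. f' z + g' z) = cls (\<lambda>z. f z + g z)" if "f' \<in> cls f" "g' \<in> cls g" for f' g'
  proof -
    have 1: "f' \<in> A_tilde p hb" "g' \<in> A_tilde p hb" using that by (auto simp: taylor_rel_iff)
    note sm = A_tilde_smooth[OF f] A_tilde_smooth[OF g] A_tilde_smooth[OF 1(1)] A_tilde_smooth[OF 1(2)]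
    have "wirtinger R S (\<lambda>z. f' z + g' z) p = wirtinger R S (\<lambda>z. f z + g z) p" for R S
      using wirtinger_lincomb[OF sm(1,2), of R S 1 1] wirtinger_lincomb[OF sm(3,4), of R S 1 1] that
      by (simp add: taylor_rel_iff)
    then show ?thesis using A_tilde_add[OF 1 hb] A_tilde_add[OF f g hb] by (simp add: cls_eq_iff)
  qed
  have "f \<in> cls f" "g \<in> cls g" using f g by (auto simp: taylor_rel_iff)
  then have "(\<Union>f'\<in>cls f. \<Union>g'\<in>cls g. cls (\<lambda>z. f' z + g' z)) = cls (\<lambda>z. f z + g z)"
    using * by (intro UN_constant_eq[of f] UN_constant_eq[of g] ballI)
  then show ?thesis by (simp add: A_space_def)
qed

lemma A_smult:
  assumes f: "f \<in> A_tilde p hb"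
  shows "c \<odot>\<^bsub>A_space p hb\<^esub> cls f = cls (\<lambda>z. c * f z)"
proof -
  have *: "cls (\<lambda>z. c * f' z) = cls (\<lambda>z. c * f z)" if "f' \<in> cls f" for f'
  proof -
    have 1: "f' \<in> A_tilde p hb" using that by (auto simp: taylor_rel_iff)
    note sm = A_tilde_smooth[OF f] A_tilde_smooth[OF 1]
    have "wirtinger R S (\<lambda>z. c * f' z) p = wirtinger R S (\<lambda>z. c * f z) p" for R S
      using wirtinger_lincomb[OF sm(1,1), of R S c 0] wirtinger_lincomb[OF sm(2,2), of R S c 0] that
      by (simp add: taylor_rel_iff)
    then show ?thesis using A_tilde_scale[OF 1 hb] A_tilde_scale[OF f hb] by (simp add: cls_eq_iff)
  qed
  have "f \<in> cls f" using f by (auto simp: taylor_rel_iff)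
  then have "(\<Union>f'\<in>cls f. cls (\<lambda>z. c * f' z)) = cls (\<lambda>z. c * f z)"
    using * by (intro UN_constant_eq[of f] ballI)
  then show ?thesis by (simp add: A_space_def)
qed

lemma A_zero: "\<zero>\<^bsub>A_space p hb\<^esub> = cls (\<lambda>z. 0)"
  by (simp add: A_space_def)

lemma A_module: "Module.module complex_ring (A_space p hb)"
proof (rule Module.moduleI)
  show "cring complex_ring" by (rule cring_complex_ring)
  show "abelian_group (A_space p hb)"
  proof (rule abelian_groupI)
    fix X assume "X \<in> carrier (A_space p hb)"
    then obtain f where f: "f \<in> A_tilde p hb" "X = cls f" by (rule carrier_A_cases)
    have "cls (\<lambda>z. (-1) * f z) \<oplus>\<^bsub>A_space p hb\<^esub> X = \<zero>\<^bsub>A_space p hb\<^esub>"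
      unfolding f(2) A_zero by (subst A_add[OF A_tilde_scale[OF f(1) hb] f(1)]) simp
    then show "\<exists>Y\<in>carrier (A_space p hb). Y \<oplus>\<^bsub>A_space p hb\<^esub> X = \<zero>\<^bsub>A_space p hb\<^esub>"
      using cls_in_carrier[OF A_tilde_scale[OF f(1) hb]] by blast
    show "\<zero>\<^bsub>A_space p hb\<^esub> \<oplus>\<^bsub>A_space p hb\<^esub> X = X"
      unfolding f(2) A_zero by (simp add: A_add zero_in_A_tilde f)
  qed (auto elim!: carrier_A_cases simp: A_add A_tilde_add hb cls_in_carrier A_zero zero_in_A_tilde add_ac)
qed (auto elim!: carrier_A_cases simp: A_add A_smult A_tilde_add A_tilde_scale hb cls_in_carrier algebra_simps)

lemma A_seminorm_cls:
  assumes "f \<in> A_tilde p hb"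
  shows "A_seminorm p hb m l R S (cls f) = enn2real (hnorm p hb m l R S f)"
proof -
  have "enn2real (hnorm p hb m l R S g) = enn2real (hnorm p hb m l R S f)" if "g \<in> cls f" for g
    using that hfun_cong[of g p f hb m] by (simp add: hnorm_def taylor_rel_iff)
  moreover have "f \<in> cls f" using assms by (auto simp: taylor_rel_iff)
  ultimately have "(\<lambda>g. enn2real (hnorm p hb m l R S g)) ` cls f = {enn2real (hnorm p hb m l R S f)}"
    by blast
  then show ?thesis by (simp add: A_seminorm_def)
qed

lemma A_seminormed_module:
  "seminormed_module (A_space p hb) {A_seminorm p hb m l R S | m l R S. l < 2 ^ m}"
proof (intro seminormed_module.intro A_module seminormed_module_axioms.intro)
  show "{A_seminorm p hb m l R S | m l R S. l < 2 ^ m} \<noteq> {}"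
  proof -
    have "A_seminorm p hb 0 0 0 0 \<in> {A_seminorm p hb m l R S | m l R S. l < 2 ^ m}"
      by (auto intro!: exI[of _ 0])
    then show ?thesis by blast
  qed
next
  fix q X Y
  assume "q \<in> {A_seminorm p hb m l R S | m l R S. l < 2 ^ m}"
    "X \<in> carrier (A_space p hb)" "Y \<in> carrier (A_space p hb)"
  then show "q (X \<oplus>\<^bsub>A_space p hb\<^esub> Y) \<le> q X + q Y"
    by (auto elim!: carrier_A_cases simp: A_add A_seminorm_cls A_tilde_add hb hnorm_triangle)
next
  fix q X c
  assume "q \<in> {A_seminorm p hb m l R S | m l R S. l < 2 ^ m}" "X \<in> carrier (A_space p hb)"
  then show "q (c \<odot>\<^bsub>A_space p hb\<^esub> X) = cmod c * q X"
    by (auto elim!: carrier_A_cases simp: A_smult A_seminorm_cls A_tilde_scale hb hnorm_scale)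
qed

lemma A_locally_convex: "locally_convex_tvs (A_space p hb) (A_topology p hb)"
  unfolding A_topology_def by (rule seminormed_module.locally_convex_tvs_T[OF A_seminormed_module])

lemma A_Hausdorff: "Hausdorff_space (A_topology p hb)"
  unfolding A_topology_def
proof (rule seminormed_module.Hausdorff_space_T[OF A_seminormed_module])
  fix X assume "X \<in> carrier (A_space p hb)"
    and zero: "\<And>q. q \<in> {A_seminorm p hb m l R S | m l R S. l < 2 ^ m} \<Longrightarrow> q X = 0"
  then obtain f where f: "f \<in> A_tilde p hb" "X = cls f" by (elim carrier_A_cases)
  have "wirtinger R S f p = 0" for R S
  proof (rule hfun_zero_imp_jet_zero[OF hb])
    have "(0 :: nat) < 2 ^ 0" by simp
    then have "A_seminorm p hb 0 0 R S X = 0" by (intro zero) blast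
    then have "enn2real (hnorm p hb 0 0 R S f) \<le> 0" by (simp add: f A_seminorm_cls)
    moreover have fin: "hfun p hb f 0 0 R S < \<infinity>" using f(1) unfolding A_tilde_iff by (metis zero_less_power zero_less_numeral)
    ultimately have "hfun p hb f 0 0 R S \<le> ennreal (0 ^ 2 ^ (0 + 1))"
      by (subst (asm) hnorm_le_iff) auto
    then show "hfun p hb f 0 0 R S = 0" by (simp del: hfun.simps)
  qed
  moreover have "wirtinger R S (\<lambda>z. 0) p = 0" for R S
    using wirtinger_lincomb[OF A_tilde_smooth[OF zero_in_A_tilde] A_tilde_smooth[OF zero_in_A_tilde], of R S 0 0] by simp
  ultimately show "X = \<zero>\<^bsub>A_space p hb\<^esub>"
    unfolding f(2) A_zero using f(1) by (simp add: cls_eq_iff zero_in_A_tilde)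
qed

section \<open>Analytic representatives, extensions and polynomials\<close>

definition taylor_coeffs :: "(complex ^ 'n \<Rightarrow> complex) \<Rightarrow> ('n + 'n) mindex \<Rightarrow> complex"
  where "taylor_coeffs f K = wirtinger (\<chi> j. K $ Inl j) (\<chi> j. K $ Inr j) f p"

lemma taylor_coeffs_vjoin: "taylor_coeffs f (vjoin R S) = wirtinger R S f p"
  by (simp add: taylor_coeffs_def)

lemma entire_taylor_coeffs:
  assumes "f \<in> A_tilde p hb"
  shows "entire_coeffs (taylor_coeffs f)"
proof -
  obtain C where C: "\<And>R S. (cmod (wirtinger R S f p))\<^sup>2 \<le> C * (1 / (2 * hb)) ^ (mabs R + mabs S) * (mfact R * mfact S)"
    using A_tilde_jet_growth[OF assms hb] by blast
  show ?thesis
  proof (rule entire_coeffs_growth[of "1 / (2 * hb)" _ C])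
    fix K :: "('n + 'n) mindex"
    obtain R S where "K = vjoin R S" by (rule vjoin_cases)
    then show "(cmod (taylor_coeffs f K))\<^sup>2 \<le> C * (1 / (2 * hb)) ^ mabs K * mfact K"
      using C[of R S] by (simp add: taylor_coeffs_vjoin mabs_vjoin mfact_vjoin)
  qed (use hb in simp)
qed

lemma smooth_same_jets_A_tilde:
  assumes "f \<in> A_tilde p hb" "smooth g" "\<And>R S. wirtinger R S g p = wirtinger R S f p"
  shows "g \<in> A_tilde p hb"
  using assms hfun_cong[of g p f hb] by (simp add: A_tilde_iff)

text \<open>The series has the jet of \<open>f\<close> at \<open>p\<close>, and for smooth functions
  membership in \<open>A_tilde\<close> depends on that jet only.\<close>

lemma taylor_series_in_class:
  assumes f: "f \<in> A_tilde p hb"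
  shows "(\<lambda>z. egf (taylor_coeffs f) (cnj_coords (z - p))) \<in> cls f"
    and "real_analytic (\<lambda>z. egf (taylor_coeffs f) (cnj_coords (z - p)))"
proof -
  note e = entire_taylor_coeffs[OF f]
  show ra: "real_analytic (\<lambda>z. egf (taylor_coeffs f) (cnj_coords (z - p)))"
    by (rule real_analytic_cnj_series[OF e])
  have w: "wirtinger R S (\<lambda>z. egf (taylor_coeffs f) (cnj_coords (z - p))) p = wirtinger R S f p" for R S
    using wirtinger_cnj_series_centre[OF e] by (simp add: taylor_coeffs_vjoin)
  show "(\<lambda>z. egf (taylor_coeffs f) (cnj_coords (z - p))) \<in> cls f"
    using f w smooth_same_jets_A_tilde[OF f real_analytic_smooth[OF ra]] by (simp add: taylor_rel_iff)
qed

lemma real_analytic_representative_unique: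
  assumes "f \<in> cls h" "g \<in> cls h" "real_analytic f" "real_analytic g"
  shows "f = g"
proof -
  have "(f, g) \<in> taylor_rel p hb" using assms(1,2) by (auto simp: taylor_rel_iff)
  then have "(\<lambda>z. f z - g z) \<in> flat_at p" by (simp add: taylor_rel_def)
  then have "(\<lambda>z. f z - g z) = (\<lambda>_. 0)"
    using real_analytic_flat_zero[OF real_analytic_diff[OF assms(3,4)]] by blast
  then show ?thesis by (auto simp: fun_eq_iff)
qed

lemma A_analytic_iff: "f \<in> A_analytic p hb \<longleftrightarrow> real_analytic f \<and> f \<in> A_tilde p hb"
proof -
  have "(\<exists>X\<in>carrier (A_space p hb). f \<in> X) \<longleftrightarrow> f \<in> A_tilde p hb"
  proof
    assume "f \<in> A_tilde p hb"
    then show "\<exists>X\<in>carrier (A_space p hb). f \<in> X"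
      by (intro bexI[of _ "cls f"] cls_in_carrier) (simp_all add: taylor_rel_iff)
  qed (auto simp: carrier_A taylor_rel_iff)
  then show ?thesis by (simp add: A_analytic_def)
qed

lemma A_analytic_extension:
  assumes "f \<in> A_analytic p hb"
  shows "\<exists>!F :: (complex ^ 'n) \<times> (complex ^ 'n) \<Rightarrow> complex.
    (\<forall>w. holomorphic_Cn (\<lambda>z. F (z, w))) \<and> (\<forall>z. antiholomorphic_Cn (\<lambda>w. F (z, w))) \<and>
    f = F \<circ> (\<lambda>z. (z, z))"
proof (rule ex_ex1I)
  have f: "f \<in> A_tilde p hb" "real_analytic f" using assms by (auto simp: A_analytic_iff)
  define a where "a = taylor_coeffs f"
  have a: "entire_coeffs a" unfolding a_def by (rule entire_taylor_coeffs[OF f(1)])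
  \<comment> \<open>By uniqueness of the analytic representative, \<open>f\<close> is the sum of its
    own series; the extension arises by replacing the conjugate of \<open>z\<close> with that of a
    second variable.\<close>
  have "f \<in> cls f" using f by (simp add: taylor_rel_iff)
  from real_analytic_representative_unique[OF this taylor_series_in_class(1)[OF f(1)] f(2) taylor_series_in_class(2)[OF f(1)]]
  have feq: "f = (\<lambda>z. egf a (cnj_coords (z - p)))" by (simp add: a_def)
  show "\<exists>F. (\<forall>w. holomorphic_Cn (\<lambda>z. F (z, w))) \<and> (\<forall>z. antiholomorphic_Cn (\<lambda>w. F (z, w))) \<and> f = F \<circ> (\<lambda>z. (z, z))"
    using sesquiholomorphic_series(1)[OF a, of p] sesquiholomorphic_series(2)[OF a, of _ p]
    by (intro exI[of _ "\<lambda>(z, w). egf a (vjoin (z - p) (\<chi> j. cnj ((w - p) $ j)))"])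
      (simp add: fun_eq_iff feq cnj_coords_def)
next
  fix F G :: "(complex ^ 'n) \<times> (complex ^ 'n) \<Rightarrow> complex"
  assume F: "(\<forall>w. holomorphic_Cn (\<lambda>z. F (z, w))) \<and> (\<forall>z. antiholomorphic_Cn (\<lambda>w. F (z, w))) \<and> f = F \<circ> (\<lambda>z. (z, z))"
    and G: "(\<forall>w. holomorphic_Cn (\<lambda>z. G (z, w))) \<and> (\<forall>z. antiholomorphic_Cn (\<lambda>w. G (z, w))) \<and> f = G \<circ> (\<lambda>z. (z, z))"
  have "F (z, z) = G (z, z)" for z using F G by (metis comp_apply)
  then show "F = G" using F G by (intro sesquiholomorphic_unique) auto
qed

text \<open>Here \<open>R\<close> is the order in the conjugate variables, so \<open>a\<close> and
  \<open>b\<close> change places.\<close>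

lemma geometric_bound_in_A_analytic:
  assumes "real_analytic f" "0 \<le> a" "0 \<le> b" "0 \<le> c"
    and "\<And>R S. cmod (wirtinger S R f p) \<le> c * a ^ mabs R * b ^ mabs S"
  shows "f \<in> A_analytic p hb"
proof -
  have "cmod (wirtinger R S f p) \<le> c * b ^ mabs R * a ^ mabs S" for R S
    using assms(5)[of R S] by (simp add: mult_ac)
  then show ?thesis
    unfolding A_analytic_iff using assms
    by (intro conjI A_tilde_geometric_bound[OF hb real_analytic_smooth, of f b a c]) auto
qed

text \<open>A polynomial is a finitely supported series centred at 0. Only finitely many of its
  derivatives at \<open>p\<close> are nonzero, so they satisfy a geometric bound with both ratios
  equal to 1.\<close>

lemma polynomial_in_A_analytic:
  assumes "f \<in> polynomial_functions"
  shows "f \<in> A_analytic p hb"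
proof -
  obtain F :: "('n mindex \<times> 'n mindex) set" and c where F: "finite F"
    "\<And>z. f z = (\<Sum>(K, L)\<in>F. c K L * mpow z K * mpow (\<chi> j. cnj (z $ j)) L)"
    using assms unfolding polynomial_functions_def by blast
  define a :: "('n + 'n) mindex \<Rightarrow> complex" where
    "a K = (let R = (\<chi> j. K $ Inl j); S = (\<chi> j. K $ Inr j) in
      if (R, S) \<in> F then c R S * (mfact R * mfact S) else 0)" for K
  have a_vjoin: "a (vjoin R S) = (if (R, S) \<in> F then c R S * (mfact R * mfact S) else 0)" for R S
    by (simp add: a_def)
  define T where "T = (\<lambda>(R, S). vjoin R S) ` F"
  have T: "finite T" using F(1) by (simp add: T_def)
  have supp: "a K = 0" if "K \<notin> T" for K
  proof -
    obtain R S where "K = vjoin R S" by (rule vjoin_cases)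
    then show ?thesis using that by (auto simp: T_def a_vjoin)
  qed
  then have e: "entire_coeffs a"
    by (intro entire_coeffs_finite_support finite_subset[OF _ T]) auto
  \<comment> \<open>The centre 0 is written as \<open>z - 0\<close> to fit the general series; the
    derivatives at \<open>p\<close> are then values away from the centre.\<close>
  have "f z = egf a (cnj_coords (z - 0))" for z
  proof -
    have "egf a (cnj_coords z) = (\<Sum>K\<in>T. a K * mterm (cnj_coords z) K)"
      unfolding egf_def by (intro infsumI has_sum_finite_neutralI) (use T supp in auto)
    also have "\<dots> = (\<Sum>(R, S)\<in>F. a (vjoin R S) * mterm (cnj_coords z) (vjoin R S))"
      unfolding T_def by (subst sum.reindex) (auto simp: inj_on_def case_prod_unfold)
    also have "\<dots> = f z"
      unfolding F(2) by (intro sum.cong) (auto simp: a_vjoin mterm_def mfact_vjoin mpow_vjoin cnj_coords_def)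
    finally show ?thesis by simp
  qed
  then have f_eq: "f = (\<lambda>z. egf a (cnj_coords (z - 0)))" by blast
  have w: "wirtinger R S f p = egf (shift (vjoin R S) a) (cnj_coords (p - 0))" for R S
    unfolding f_eq wirtinger_cnj_series[OF e] ..
  \<comment> \<open>The down-closure of the support: a derivative whose order lies outside it
    annihilates the polynomial.\<close>
  define U where "U = (\<Union>K\<in>T. {..K})"
  have U: "finite U" using T by (simp add: U_def)
  \<comment> \<open>The inserted 1 keeps the maximum defined for empty \<open>U\<close> and makes
    \<open>C\<close> positive.\<close>
  define C where "C = Max (insert 1 ((\<lambda>I. cmod (egf (shift I a) (cnj_coords (p - 0)))) ` U))"
  have C1: "1 \<le> C" unfolding C_def using U by (intro Max_ge) auto
  have bound: "cmod (wirtinger R S f p) \<le> C" for R S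
  proof (cases "vjoin R S \<in> U")
    case True
    then show ?thesis unfolding w C_def using U by (intro Max_ge) auto
  next
    case False
    have "shift (vjoin R S) a M = 0" for M
      unfolding shift_def
    proof (rule supp)
      have "vjoin R S \<le> vjoin R S + M" by (simp add: less_eq_vec_def)
      then show "vjoin R S + M \<notin> T" using False by (auto simp: U_def)
    qed
    then show ?thesis using C1 by (simp add: w egf_def)
  qed
  show ?thesis
  proof (rule geometric_bound_in_A_analytic[of f 1 1 C])
    show "real_analytic f" unfolding f_eq by (rule real_analytic_cnj_series[OF e])
  qed (use C1 bound in auto)
qed

end

theorem theorem3p6:
  fixes p :: "complex ^ 'n" and hb :: real
  assumes "hb > 0"
  shows
    "(locally_convex_tvs (A_space p hb) (A_topology p hb) \<and> Hausdorff_space (A_topology p hb))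
   \<and> (\<forall>X\<in>carrier (A_space p hb). \<exists>!f. f \<in> X \<and> real_analytic f)
   \<and> (\<forall>f\<in>A_analytic p hb.
        \<exists>!F :: (complex ^ 'n) \<times> (complex ^ 'n) \<Rightarrow> complex.
          (\<forall>w. holomorphic_Cn (\<lambda>z. F (z, w))) \<and>
          (\<forall>z. antiholomorphic_Cn (\<lambda>w. F (z, w))) \<and>
          f = F \<circ> (\<lambda>z. (z, z)))
   \<and> ((\<forall>f. real_analytic f \<and>
            (\<exists>a b c :: real. a > 0 \<and> b > 0 \<and> c > 0 \<and>
               (\<forall>R S. cmod (wirtinger S R f p) \<le> c * a ^ mabs R * b ^ mabs S)) \<longrightarrow>
          f \<in> A_analytic p hb)
      \<and> polynomial_functions \<subseteq> A_analytic p hb)"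
proof (intro conjI ballI allI impI subsetI)
  show "locally_convex_tvs (A_space p hb) (A_topology p hb)" by (rule A_locally_convex[OF assms])
  show "Hausdorff_space (A_topology p hb)" by (rule A_Hausdorff[OF assms])
next
  fix X assume "X \<in> carrier (A_space p hb)"
  then obtain h where h: "h \<in> A_tilde p hb" "X = taylor_rel p hb `` {h}"
    by (rule carrier_A_cases[OF assms])
  show "\<exists>!f. f \<in> X \<and> real_analytic f"
    unfolding h(2) using taylor_series_in_class[OF assms h(1)] real_analytic_representative_unique[OF assms]
    by blast
next
  fix f assume "f \<in> A_analytic p hb"
  then show "\<exists>!F :: (complex ^ 'n) \<times> (complex ^ 'n) \<Rightarrow> complex.
          (\<forall>w. holomorphic_Cn (\<lambda>z. F (z, w))) \<and>
          (\<forall>z. antiholomorphic_Cn (\<lambda>w. F (z, w))) \<and>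
          f = F \<circ> (\<lambda>z. (z, z))" by (rule A_analytic_extension[OF assms])
next
  fix f assume "real_analytic f \<and> (\<exists>a b c :: real. a > 0 \<and> b > 0 \<and> c > 0 \<and>
               (\<forall>R S. cmod (wirtinger S R f p) \<le> c * a ^ mabs R * b ^ mabs S))"
  then show "f \<in> A_analytic p hb" using geometric_bound_in_A_analytic[OF assms] less_imp_le by metis
next
  fix f assume "f \<in> (polynomial_functions :: (complex ^ 'n \<Rightarrow> complex) set)"
  then show "f \<in> A_analytic p hb" by (rule polynomial_in_A_analytic[OF assms])
qed

end
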